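(* Let $d,d'\in\mathbb{N}$, $\gamma>0$, and let $p_T$ be the transition density function at time $T>0$ of the diffusion process generated by $\frac12\Delta_{(\gamma)}$. Let $y\in\mathbb{R}^{d'}$. (i) For $x\in\mathbb{R}^d$ with $x\neq0$, $$\sqrt{T}^{\,d+d'}\,p_T((x,y),(x,y))\to\frac{1}{\sqrt{2\pi}^{\,d+d'}\,|x|^{\gamma d'}}\quad\text{as }T\to0.$$ (ii) It holds $$\sqrt{T}^{\,d+(1+\gamma)d'}\,p_T((0,y),(0,y))=\frac{1}{\sqrt{2\pi}^{\,d+d'}}\int_{\mathcal{W}_1^0}\Bigl(\int_0^1|\beta(t)|^{2\gamma}dt\Bigr)^{-\frac{d'}{2}}d\mu_1^0\quad\text{for }T\in(0,1].$$
   Context: The Grushin operator with parameter $\gamma$ on $\mathbb{R}^{d+d'}$ is $\Delta_{(\gamma)}=\Delta_x+|x|^{2\gamma}\Delta_y$, where $\Delta_x,\Delta_y$ are the Laplacians in $x\in\mathbb{R}^d$, $y\in\mathbb{R}^{d'}$. The diffusion process $Z^{(x,y)}$ generated by $\frac12\Delta_{(\gamma)}$ starting at $(x,y)$ is realized as $Z^{(x,y)}(t)=(x+b(t),\,y+\int_0^t|x+b(s)|^\gamma d\widehat b(s))$ (It\^o integral), where $b,\widehat b$ are independent standard Brownian motions in $\mathbb{R}^d$, $\mathbb{R}^{d'}$ starting at $0$. For $T>0$, $p_T$ denotes its transition density function, namely the unique continuous function on $(\mathbb{R}^d\times\mathbb{R}^{d'})^2$ with $\mathbf{E}[f(Z^{(x,y)}(T))]=\int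 f(\xi,\eta)p_T((x,y),(\xi,\eta))\,d\xi\,d\eta$ for all $(x,y)$ and all bounded continuous $f$ (such a function exists). $\mathcal{W}_1^0$ is the space of continuous $w:[0,1]\to\mathbb{R}^d$ with $w(0)=w(1)=0$; $\mu_1^0$ is the pinned Wiener measure on it (law of the $d$-dimensional Brownian bridge from $0$ to $0$ on $[0,1]$), and $\beta$ is the coordinate process, $\beta(t)(w)=w(t)$. *)

theory Defs
  imports "HOL-Probability.Probability"
begin

section \<open>Brownian motion\<close>

definition gauss_kernel :: "real \<Rightarrow> 'a::euclidean_space \<Rightarrow> real" where
  "gauss_kernel v z = exp (- (norm z)\<^sup>2 / (2 * v)) / sqrt (2 * pi * v) ^ DIM('a)"

text \<open>Processes are functions on \<^typ>\<open>real\<close>; only their values at nonnegative times are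
  constrained.\<close>

definition brownian_motion :: "'w measure \<Rightarrow> (real \<Rightarrow> 'w \<Rightarrow> 'a::euclidean_space) \<Rightarrow> bool" where
  "brownian_motion M B \<longleftrightarrow>
     prob_space M \<and>
     (\<forall>t\<ge>0. B t \<in> borel_measurable M) \<and>
     (\<forall>\<omega>\<in>space M. B 0 \<omega> = 0 \<and> continuous_on {0..} (\<lambda>t. B t \<omega>)) \<and>
     (\<forall>s t. 0 \<le> s \<longrightarrow> s < t \<longrightarrow>
        distributed M lborel (\<lambda>\<omega>. B t \<omega> - B s \<omega>) (\<lambda>z. ennreal (gauss_kernel (t - s) z))) \<and>
     (\<forall>n (\<tau>::nat \<Rightarrow> real). 0 \<le> \<tau> 0 \<longrightarrow> (\<forall>i<n. \<tau> i \<le> \<tau> (Suc i)) \<longrightarrow>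
        prob_space.indep_vars M (\<lambda>_. borel) (\<lambda>i \<omega>. B (\<tau> (Suc i)) \<omega> - B (\<tau> i) \<omega>) {..<n})"

definition generated_algebra ::
  "'w measure \<Rightarrow> (real \<Rightarrow> 'w \<Rightarrow> 'a::euclidean_space) \<Rightarrow> real set \<Rightarrow> 'w measure" where
  "generated_algebra M X I =
     vimage_algebra (space M) (\<lambda>\<omega>. \<lambda>s\<in>I. X s \<omega>) (PiM I (\<lambda>_. borel))"

definition natural_filtration ::
  "'w measure \<Rightarrow> (real \<Rightarrow> 'w \<Rightarrow> 'a::euclidean_space) \<Rightarrow> real \<Rightarrow> 'w measure" where
  "natural_filtration M X t = generated_algebra M X {0..t}"

definition indep_processes ::
  "'w measure \<Rightarrow> (real \<Rightarrow> 'w \<Rightarrow> 'a::euclidean_space) \<Rightarrow> (real \<Rightarrow> 'w \<Rightarrow> 'b::euclidean_space) \<Rightarrow> bool" where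
  "indep_processes M B B' \<longleftrightarrow>
     prob_space.indep_set M
       (sets (generated_algebra M B {0..})) (sets (generated_algebra M B' {0..}))"


section \<open>The Ito integral of real square-integrable integrands\<close>

text \<open>The data \<open>n, \<tau>, \<xi>\<close> encode the simple process that takes the value \<open>\<xi> i\<close> on
  the time interval from \<open>\<tau> i\<close> (exclusive) to \<open>\<tau> (Suc i)\<close> (inclusive), for \<open>i < n\<close>.\<close>

definition simple_integrand ::
  "'w measure \<Rightarrow> (real \<Rightarrow> 'w measure) \<Rightarrow> nat \<Rightarrow> (nat \<Rightarrow> real) \<Rightarrow> (nat \<Rightarrow> 'w \<Rightarrow> real) \<Rightarrow> bool" where
  "simple_integrand M F n \<tau> \<xi> \<longleftrightarrow>
     0 \<le> \<tau> 0 \<and>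
     (\<forall>i<n. \<tau> i \<le> \<tau> (Suc i) \<and> \<xi> i \<in> borel_measurable (F (\<tau> i)) \<and> bounded (\<xi> i ` space M))"

definition simple_process :: "nat \<Rightarrow> (nat \<Rightarrow> real) \<Rightarrow> (nat \<Rightarrow> 'w \<Rightarrow> real) \<Rightarrow> real \<Rightarrow> 'w \<Rightarrow> real" where
  "simple_process n \<tau> \<xi> s \<omega> = (\<Sum>i<n. \<xi> i \<omega> * indicator {\<tau> i<..\<tau> (Suc i)} s)"

definition simple_ito_integral ::
  "nat \<Rightarrow> (nat \<Rightarrow> real) \<Rightarrow> (nat \<Rightarrow> 'w \<Rightarrow> real) \<Rightarrow> (real \<Rightarrow> 'w \<Rightarrow> 'a::euclidean_space) \<Rightarrow>
   real \<Rightarrow> 'w \<Rightarrow> 'a" where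
  "simple_ito_integral n \<tau> \<xi> B t \<omega> =
     (\<Sum>i<n. \<xi> i \<omega> *\<^sub>R (B (min t (\<tau> (Suc i))) \<omega> - B (min t (\<tau> i)) \<omega>))"

text \<open>\<open>I\<close> is a version of the integral of \<open>H\<close> against \<open>B\<close> over \<open>{0..t}\<close>: it is the limit in mean
  square of the integrals of simple processes that approximate \<open>H\<close> in mean square. The
  nonnegative integral is used so that no integrability side condition is hidden; \<open>H\<close> is meant
  to be jointly measurable.\<close>

definition is_ito_integral ::
  "'w measure \<Rightarrow> (real \<Rightarrow> 'w measure) \<Rightarrow> (real \<Rightarrow> 'w \<Rightarrow> 'a::euclidean_space) \<Rightarrow>
   (real \<Rightarrow> 'w \<Rightarrow> real) \<Rightarrow> real \<Rightarrow> ('w \<Rightarrow> 'a) \<Rightarrow> bool" where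
  "is_ito_integral M F B H t I \<longleftrightarrow>
     I \<in> borel_measurable M \<and>
     (\<exists>n \<tau> \<xi>.
        (\<forall>k::nat. simple_integrand M F (n k) (\<tau> k) (\<xi> k)) \<and>
        (\<lambda>k. \<integral>\<^sup>+\<omega>. (\<integral>\<^sup>+s\<in>{0..t}.
             ennreal ((simple_process (n k) (\<tau> k) (\<xi> k) s \<omega> - H s \<omega>)\<^sup>2) \<partial>lborel) \<partial>M)
          \<longlonglongrightarrow> 0 \<and>
        (\<lambda>k. \<integral>\<^sup>+\<omega>. ennreal ((norm (simple_ito_integral (n k) (\<tau> k) (\<xi> k) B t \<omega> - I \<omega>))\<^sup>2) \<partial>M)
          \<longlonglongrightarrow> 0)"


section \<open>The Grushin diffusion and its transition density\<close>

definition grushin_diffusion ::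
  "real \<Rightarrow> 'w measure \<Rightarrow> (real \<Rightarrow> 'w \<Rightarrow> real^'d) \<Rightarrow> (real \<Rightarrow> 'w \<Rightarrow> real^'e) \<Rightarrow>
   (real^'d) \<times> (real^'e) \<Rightarrow> (real \<Rightarrow> 'w \<Rightarrow> (real^'d) \<times> (real^'e)) \<Rightarrow> bool" where
  "grushin_diffusion \<gamma> M b b' z Z \<longleftrightarrow>
     (\<exists>J. (\<forall>t\<ge>0. is_ito_integral M (natural_filtration M (\<lambda>s \<omega>. (b s \<omega>, b' s \<omega>))) b'
                 (\<lambda>s \<omega>. norm (fst z + b s \<omega>) powr \<gamma>) t (J t)) \<and>
          (\<forall>\<omega>\<in>space M. continuous_on {0..} (\<lambda>t. J t \<omega>)) \<and>
          (\<forall>t\<ge>0. \<forall>\<omega>\<in>space M. Z t \<omega> = (fst z + b t \<omega>, snd z + J t \<omega>)))"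

text \<open>\<open>Z z\<close> is the process started at \<open>z\<close>.\<close>

definition is_transition_density ::
  "'w measure \<Rightarrow> ('a::euclidean_space \<Rightarrow> real \<Rightarrow> 'w \<Rightarrow> 'a) \<Rightarrow> real \<Rightarrow> ('a \<times> 'a \<Rightarrow> real) \<Rightarrow> bool" where
  "is_transition_density M Z T p \<longleftrightarrow>
     continuous_on UNIV p \<and>
     (\<forall>z. \<forall>f::'a \<Rightarrow> real. continuous_on UNIV f \<longrightarrow> bounded (range f) \<longrightarrow>
        has_bochner_integral lborel (\<lambda>w. f w * p (z, w)) (\<integral>\<omega>. f (Z z T \<omega>) \<partial>M))"


section \<open>The pinned Wiener measure\<close>

definition gaussian_variable :: "'w measure \<Rightarrow> ('w \<Rightarrow> real) \<Rightarrow> bool" where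
  "gaussian_variable M X \<longleftrightarrow>
     X \<in> borel_measurable M \<and>
     (\<exists>m. (AE \<omega> in M. X \<omega> = m) \<or>
          (\<exists>\<sigma>>0. distributed M lborel X (\<lambda>u. ennreal (normal_density m \<sigma> u))))"

text \<open>The standard Brownian bridge from 0 to 0 on the unit interval, as the continuous
  centred Gaussian process with covariance \<open>(min s t - s t) Id\<close>.\<close>

definition brownian_bridge :: "'w measure \<Rightarrow> (real \<Rightarrow> 'w \<Rightarrow> 'a::euclidean_space) \<Rightarrow> bool" where
  "brownian_bridge M X \<longleftrightarrow>
     prob_space M \<and>
     (\<forall>t\<in>{0..1}. X t \<in> borel_measurable M) \<and>
     (\<forall>\<omega>\<in>space M. X 0 \<omega> = 0 \<and> X 1 \<omega> = 0 \<and> continuous_on {0..1} (\<lambda>t. X t \<omega>)) \<and>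
     (\<forall>S a. finite S \<longrightarrow> S \<subseteq> {0..1} \<longrightarrow> gaussian_variable M (\<lambda>\<omega>. \<Sum>t\<in>S. a t \<bullet> X t \<omega>)) \<and>
     (\<forall>t\<in>{0..1}. \<forall>u. (\<integral>\<omega>. u \<bullet> X t \<omega> \<partial>M) = 0) \<and>
     (\<forall>s\<in>{0..1}. \<forall>t\<in>{0..1}. \<forall>u v.
        (\<integral>\<omega>. (u \<bullet> X s \<omega>) * (v \<bullet> X t \<omega>) \<partial>M) = (min s t - s * t) * (u \<bullet> v))"

definition loop_space :: "(real \<Rightarrow> 'a::euclidean_space) set" where
  "loop_space = {w \<in> extensional {0..1}. continuous_on {0..1} w \<and> w 0 = 0 \<and> w 1 = 0}"

text \<open>The sigma-algebra generated by the coordinates, which is also the Borel sigma-algebra of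
  the supremum norm.\<close>

definition loop_measurable :: "(real \<Rightarrow> 'a::euclidean_space) measure" where
  "loop_measurable = restrict_space (PiM {0..1} (\<lambda>_. borel)) loop_space"

definition pinned_wiener_measure :: "(real \<Rightarrow> 'a::euclidean_space) measure \<Rightarrow> bool" where
  "pinned_wiener_measure \<mu> \<longleftrightarrow>
     sets \<mu> = sets loop_measurable \<and> brownian_bridge \<mu> (\<lambda>t w. w t)"

end

theory Submission imports Defs
begin

text \<open>
Conditionally on \<open>b\<close>, the integral \<open>\<integral> |x + b|\<^sup>\<gamma> db'\<close> is a centred Gaussian vector with covariance
\<open>V = \<integral> |x + b s|\<^bsup>2\<gamma>\<^esup> ds\<close> times the identity; this is read off characteristic functions of the
simple integrals approximating it. Replacing \<open>b\<close> on \<open>[0, T]\<close> by a scaled bridge plus an independent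
Gaussian linear part and testing against products, the density at \<open>((x, y), (x, y))\<close> becomes the heat
kernel at \<open>0\<close> in \<open>x\<close> times the expectation over the bridge of the heat kernel of variance \<open>V\<close> at \<open>0\<close>,
where now \<open>V = T \<integral>\<^sub>0\<^sup>1 |x + sqrt T w(s)|\<^bsup>2\<gamma>\<^esup> ds\<close>. At \<open>x = 0\<close> the power of \<open>T\<close> factors out. For
\<open>x \<noteq> 0\<close>, dominated convergence applies because the bridge can leave the ball of radius \<open>|x| / 2\<close>
around \<open>0\<close> very early only with a probability smaller than any power of the time.
\<close>

section \<open>Laws determined by characteristic functions\<close>

text \<open>Conditioning on \<open>b\<close> is never carried out: every law is handled as a joint
  characteristic function of \<open>b T\<close> and the integral, and turned into expectations of
  measurable functions by a uniqueness theorem built coordinate by coordinate from Levy's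
  one-dimensional one. \<open>is_ito_integral\<close> supplies only some approximating sequence,
  adapted to the filtration of both motions, and such integrals need not be Gaussian given
  \<open>b\<close>. They are exchanged, by means of the isometry, for integrals of step functions of
  a truncated \<open>g (b s)\<close> on a uniform grid, where independence of \<open>b\<close> and
  \<open>b'\<close> gives the Gaussian form explicitly. The density is known only through integrals
  against bounded continuous functions; its value at one point is recovered from continuity, first
  in the \<open>x\<close> variable and then in the \<open>y\<close> variable. For the limit, the
  variance is bounded below by a multiple of the time that the bridge spends within distance
  \<open>norm x / 2\<close> of the origin; the reciprocal \<open>e\<close>-th power of that time is
  dominated through an integral of \<open>norm (X s) ^ (2 * Suc e) / s ^ Suc e\<close>, with
  exponents chosen so that the Gaussian moment cancels the singularity at 0.\<close>

lemma iexp_bound_integrable: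
  assumes "prob_space M" and [measurable]: "R \<in> borel_measurable M" "\<theta> \<in> borel_measurable M"
    and "\<And>\<omega>. \<omega> \<in> space M \<Longrightarrow> \<bar>R \<omega>\<bar> \<le> C"
  shows "integrable M (\<lambda>\<omega>. of_real (R \<omega>) * iexp (\<theta> \<omega>) :: complex)"
proof -
  interpret prob_space M by fact
  show ?thesis
    by (rule integrable_const_bound[where B=C]) (use assms(4) in \<open>auto simp: norm_mult\<close>)
qed

lemma char_distr_density:
  assumes [measurable]: "Z \<in> borel_measurable M" "Y \<in> borel_measurable M"
    and "\<And>\<omega>. \<omega> \<in> space M \<Longrightarrow> 0 \<le> Z \<omega>"
  shows "char (distr (density M (\<lambda>\<omega>. ennreal (Z \<omega>))) borel Y) t = (\<integral>\<omega>. of_real (Z \<omega>) * iexp (t * Y \<omega>) \<partial>M)"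
  unfolding char_def using assms(3)
  by (subst integral_distr, simp, simp) (subst integral_density, auto simp: scaleR_conv_of_real)

text \<open>The weight \<open>Z\<close> is absorbed into the measure, which reduces the claim to Levy's theorem.\<close>

lemma weighted_char_unique:
  fixes Z Y :: "'w \<Rightarrow> real" and Z' Y' :: "'v \<Rightarrow> real"
  assumes P: "prob_space M" "prob_space M'"
    and [measurable]: "Z \<in> borel_measurable M" "Y \<in> borel_measurable M"
      "Z' \<in> borel_measurable M'" "Y' \<in> borel_measurable M'"
    and Z: "\<And>\<omega>. \<omega> \<in> space M \<Longrightarrow> 0 \<le> Z \<omega> \<and> Z \<omega> \<le> C"
      "\<And>\<omega>. \<omega> \<in> space M' \<Longrightarrow> 0 \<le> Z' \<omega> \<and> Z' \<omega> \<le> C"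
    and eq: "\<And>t. (\<integral>\<omega>. of_real (Z \<omega>) * iexp (t * Y \<omega>) \<partial>M) = (\<integral>\<omega>. of_real (Z' \<omega>) * iexp (t * Y' \<omega>) \<partial>M')"
    and [measurable]: "A \<in> sets borel"
  shows "(\<integral>\<omega>. Z \<omega> * indicator A (Y \<omega>) \<partial>M) = (\<integral>\<omega>. Z' \<omega> * indicator A (Y' \<omega>) \<partial>M')"
proof -
  interpret M: prob_space M by fact
  interpret M': prob_space M' by fact
  have int: "integrable M Z" "integrable M' Z'"
    using Z by (auto intro!: M.integrable_const_bound[where B=C] M'.integrable_const_bound[where B=C] AE_I2)
  define c where "c = integral\<^sup>L M Z"
  \<comment> \<open>Frequency 0 turns the hypothesis into equality of the total masses, so that one
    constant normalises both weights.\<close>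
  have c: "integral\<^sup>L M' Z' = c"
    using eq[of 0] unfolding c_def by simp
  have c0: "0 \<le> c" unfolding c_def using Z by (auto intro!: integral_nonneg_AE)
  show ?thesis
  proof (cases "c = 0")
    \<comment> \<open>A weight of mass 0 cannot be normalised; it vanishes almost everywhere and
      both sides are 0.\<close>
    case True
    have "AE \<omega> in M. Z \<omega> = 0" "AE \<omega> in M'. Z' \<omega> = 0"
      using integral_nonneg_eq_0_iff_AE[OF int(1)] integral_nonneg_eq_0_iff_AE[OF int(2)] Z True c c_def
      by (auto simp: AE_I2)
    then have "(\<integral>\<omega>. Z \<omega> * indicator A (Y \<omega>) \<partial>M) = 0" "(\<integral>\<omega>. Z' \<omega> * indicator A (Y' \<omega>) \<partial>M') = 0"
      by (auto intro!: integral_eq_zero_AE)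
    then show ?thesis by simp
  next
    case False
    with c0 have cp: "0 < c" by simp
    define N where "N = distr (density M (\<lambda>\<omega>. ennreal (Z \<omega> / c))) borel Y"
    define N' where "N' = distr (density M' (\<lambda>\<omega>. ennreal (Z' \<omega> / c))) borel Y'"
    have "(\<integral>\<^sup>+\<omega>. ennreal (Z \<omega> / c) \<partial>M) = 1"
      using Z cp int c_def by (subst nn_integral_eq_integral) auto
    then have "prob_space (density M (\<lambda>\<omega>. ennreal (Z \<omega> / c)))"
      by (intro prob_spaceI) (simp add: emeasure_density cong: nn_integral_cong_simp)
    then have N: "real_distribution N" unfolding N_def
      by (intro prob_space.real_distribution_distr) auto
    have "(\<integral>\<^sup>+\<omega>. ennreal (Z' \<omega> / c) \<partial>M') = 1"
      using Z cp int c by (subst nn_integral_eq_integral) auto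
    then have "prob_space (density M' (\<lambda>\<omega>. ennreal (Z' \<omega> / c)))"
      by (intro prob_spaceI) (simp add: emeasure_density cong: nn_integral_cong_simp)
    then have N': "real_distribution N'" unfolding N'_def
      by (intro prob_space.real_distribution_distr) auto
    have "char N = char N'"
    proof
      fix t
      have "char N t = (\<integral>\<omega>. of_real (Z \<omega> / c) * iexp (t * Y \<omega>) \<partial>M)"
        unfolding N_def using Z cp by (subst char_distr_density) auto
      also have "\<dots> = (\<integral>\<omega>. of_real (Z \<omega>) * iexp (t * Y \<omega>) \<partial>M) / of_real c" by simp
      also have "\<dots> = (\<integral>\<omega>. of_real (Z' \<omega>) * iexp (t * Y' \<omega>) \<partial>M') / of_real c" by (simp only: eq)
      also have "\<dots> = (\<integral>\<omega>. of_real (Z' \<omega> / c) * iexp (t * Y' \<omega>) \<partial>M')" by simp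
      also have "\<dots> = char N' t"
        unfolding N'_def using Z cp by (subst char_distr_density) auto
      finally show "char N t = char N' t" .
    qed
    then have "N = N'" using N N' by (intro Levy_uniqueness)
    then have "(\<integral>x. indicator A x \<partial>N) = (\<integral>x. indicator A x \<partial>N' :: real)" by simp
    moreover have "(\<integral>x. indicator A x \<partial>N) = (\<integral>\<omega>. Z \<omega> * indicator A (Y \<omega>) \<partial>M) / c"
      unfolding N_def using Z cp
      by (subst integral_distr, simp, simp) (subst integral_density, auto)
    moreover have "(\<integral>x. indicator A x \<partial>N') = (\<integral>\<omega>. Z' \<omega> * indicator A (Y' \<omega>) \<partial>M') / c"
      unfolding N'_def using Z cp
      by (subst integral_distr, simp, simp) (subst integral_density, auto)
    ultimately show ?thesis using cp by simp
  qed
qed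

text \<open>The factor \<open>1 + cos\<close> is nonnegative, so it may be part of a weight in
  \<open>weighted_char_unique\<close>; its expansion into exponentials leads back to characteristic
  functions with the frequencies 0, 1 and -1 of \<theta>.\<close>

lemma iexp_cos_expand:
  "of_real (R * (1 + cos (\<theta> + \<phi>))) * iexp u
   = of_real R * iexp u + iexp \<phi> / 2 * (of_real R * iexp (u + \<theta>)) + iexp (-\<phi>) / 2 * (of_real R * iexp (u - \<theta>))"
proof -
  have "of_real (1 + cos (\<theta> + \<phi>)) = 1 + (iexp (\<theta> + \<phi>) + iexp (-(\<theta> + \<phi>))) / 2"
    by (simp add: cos_of_real[symmetric] cos_exp_eq algebra_simps)
  then have "of_real (R * (1 + cos (\<theta> + \<phi>))) * iexp u
     = of_real R * (1 + (iexp (\<theta> + \<phi>) + iexp (-(\<theta> + \<phi>))) / 2) * iexp u" by simp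
  also have "\<dots> = of_real R * iexp u + 1 / 2 * (of_real R * (iexp (\<theta> + \<phi>) * iexp u)) + 1 / 2 * (of_real R * (iexp (-(\<theta> + \<phi>)) * iexp u))"
    by (simp add: algebra_simps)
  also have "iexp (\<theta> + \<phi>) * iexp u = iexp \<phi> * iexp (u + \<theta>)" by (simp add: exp_add[symmetric] algebra_simps)
  also have "iexp (-(\<theta> + \<phi>)) * iexp u = iexp (-\<phi>) * iexp (u - \<theta>)" by (simp add: exp_add[symmetric] algebra_simps)
  finally show ?thesis by (simp add: algebra_simps)
qed

text \<open>One coordinate \<open>Y\<close> passes from exponentials to indicators while \<theta>
  keeps its exponential. The complex factor \<open>iexp (\<theta> \<omega>)\<close> is not an
  admissible weight, but \<open>1 + cos (\<theta> \<omega> + \<phi>)\<close> is, and varying the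
  phase \<phi> recovers its real and imaginary parts.\<close>

lemma weighted_cos_unique:
  fixes R \<theta> Y :: "'w \<Rightarrow> real" and R' \<theta>' Y' :: "'v \<Rightarrow> real"
  assumes P: "prob_space M" "prob_space M'"
    and [measurable]: "R \<in> borel_measurable M" "\<theta> \<in> borel_measurable M" "Y \<in> borel_measurable M"
      "R' \<in> borel_measurable M'" "\<theta>' \<in> borel_measurable M'" "Y' \<in> borel_measurable M'"
    and R: "\<And>\<omega>. \<omega> \<in> space M \<Longrightarrow> 0 \<le> R \<omega> \<and> R \<omega> \<le> 1" "\<And>\<omega>. \<omega> \<in> space M' \<Longrightarrow> 0 \<le> R' \<omega> \<and> R' \<omega> \<le> 1"
    and eq: "\<And>t s. (\<integral>\<omega>. of_real (R \<omega>) * iexp (t * Y \<omega> + s * \<theta> \<omega>) \<partial>M) = (\<integral>\<omega>. of_real (R' \<omega>) * iexp (t * Y' \<omega> + s * \<theta>' \<omega>) \<partial>M')"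
    and [measurable]: "A \<in> sets borel"
  shows "(\<integral>\<omega>. of_real (R \<omega> * indicator A (Y \<omega>)) * iexp (\<theta> \<omega>) \<partial>M)
    = (\<integral>\<omega>. of_real (R' \<omega> * indicator A (Y' \<omega>)) * iexp (\<theta>' \<omega>) \<partial>M')"
proof -
  interpret M: prob_space M by fact
  interpret M': prob_space M' by fact
  have "\<bar>r\<bar> \<le> 1" if "0 \<le> r \<and> r \<le> 1" for r :: real using that by auto
  then have absR: "\<And>\<omega>. \<omega> \<in> space M \<Longrightarrow> \<bar>R \<omega>\<bar> \<le> 1" "\<And>\<omega>. \<omega> \<in> space M' \<Longrightarrow> \<bar>R' \<omega>\<bar> \<le> 1" using R by auto
  have int: "integrable M (\<lambda>\<omega>. of_real (R \<omega>) * iexp (u \<omega>) :: complex)" if "u \<in> borel_measurable M" for u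
    by (rule iexp_bound_integrable[OF P(1) _ that absR(1)]) measurable
  have int': "integrable M' (\<lambda>\<omega>. of_real (R' \<omega>) * iexp (u \<omega>) :: complex)" if "u \<in> borel_measurable M'" for u
    by (rule iexp_bound_integrable[OF P(2) _ that absR(2)]) measurable
  have Wcos: "(\<integral>\<omega>. R \<omega> * (1 + cos (\<theta> \<omega> + \<phi>)) * indicator A (Y \<omega>) \<partial>M)
      = (\<integral>\<omega>. R' \<omega> * (1 + cos (\<theta>' \<omega> + \<phi>)) * indicator A (Y' \<omega>) \<partial>M')" for \<phi>
  proof (rule weighted_char_unique[OF P, where C=2])
    have b: "0 \<le> r * (1 + cos x) \<and> r * (1 + cos x) \<le> 2" if "0 \<le> r \<and> r \<le> 1" for r x :: real
    proof -
      have "0 \<le> 1 + cos x" "1 + cos x \<le> 2" using cos_ge_minus_one[of x] cos_le_one[of x] by linarith+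
      with that show ?thesis using mult_mono[of r 1 "1 + cos x" 2] by auto
    qed
    show "0 \<le> R \<omega> * (1 + cos (\<theta> \<omega> + \<phi>)) \<and> R \<omega> * (1 + cos (\<theta> \<omega> + \<phi>)) \<le> 2" if "\<omega> \<in> space M" for \<omega>
      using b R that by simp
    show "0 \<le> R' \<omega> * (1 + cos (\<theta>' \<omega> + \<phi>)) \<and> R' \<omega> * (1 + cos (\<theta>' \<omega> + \<phi>)) \<le> 2" if "\<omega> \<in> space M'" for \<omega>
      using b R that by simp
    fix t
    have 1: "(\<integral>\<omega>. of_real (R \<omega> * (1 + cos (\<theta> \<omega> + \<phi>))) * iexp (t * Y \<omega>) \<partial>M)
      = (\<integral>\<omega>. of_real (R \<omega>) * iexp (t * Y \<omega>) \<partial>M)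
       + iexp \<phi> / 2 * (\<integral>\<omega>. of_real (R \<omega>) * iexp (t * Y \<omega> + \<theta> \<omega>) \<partial>M)
       + iexp (-\<phi>) / 2 * (\<integral>\<omega>. of_real (R \<omega>) * iexp (t * Y \<omega> - \<theta> \<omega>) \<partial>M)"
      unfolding iexp_cos_expand
      by (subst Bochner_Integration.integral_add integral_mult_right_zero, (intro Bochner_Integration.integrable_add integrable_mult_right int; measurable)+)+ simp
    have 2: "(\<integral>\<omega>. of_real (R' \<omega> * (1 + cos (\<theta>' \<omega> + \<phi>))) * iexp (t * Y' \<omega>) \<partial>M')
      = (\<integral>\<omega>. of_real (R' \<omega>) * iexp (t * Y' \<omega>) \<partial>M')
       + iexp \<phi> / 2 * (\<integral>\<omega>. of_real (R' \<omega>) * iexp (t * Y' \<omega> + \<theta>' \<omega>) \<partial>M')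
       + iexp (-\<phi>) / 2 * (\<integral>\<omega>. of_real (R' \<omega>) * iexp (t * Y' \<omega> - \<theta>' \<omega>) \<partial>M')"
      unfolding iexp_cos_expand
      by (subst Bochner_Integration.integral_add integral_mult_right_zero, (intro Bochner_Integration.integrable_add integrable_mult_right int'; measurable)+)+ simp
    show "(\<integral>\<omega>. of_real (R \<omega> * (1 + cos (\<theta> \<omega> + \<phi>))) * iexp (t * Y \<omega>) \<partial>M)
      = (\<integral>\<omega>. of_real (R' \<omega> * (1 + cos (\<theta>' \<omega> + \<phi>))) * iexp (t * Y' \<omega>) \<partial>M')"
      using 1 2 eq[of t 0] eq[of t 1] eq[of t "-1"] by simp
  qed measurable
  have ir: "integrable M (\<lambda>\<omega>. R \<omega> * h (\<theta> \<omega>) * indicator A (Y \<omega>))"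
    if "\<And>x. \<bar>h x\<bar> \<le> 2" and [measurable]: "h \<in> borel_measurable borel" for h :: "real \<Rightarrow> real"
  proof (rule M.integrable_const_bound[where B=2])
    show "AE x in M. norm (R x * h (\<theta> x) * indicator A (Y x)) \<le> 2"
      using absR that(1) mult_mono[of "\<bar>R x\<bar>" 1 "\<bar>h (\<theta> x)\<bar>" 2 for x]
      by (auto intro!: AE_I2 simp: abs_mult indicator_def)
  qed measurable
  have ir': "integrable M' (\<lambda>\<omega>. R' \<omega> * h (\<theta>' \<omega>) * indicator A (Y' \<omega>))"
    if "\<And>x. \<bar>h x\<bar> \<le> 2" and [measurable]: "h \<in> borel_measurable borel" for h :: "real \<Rightarrow> real"
  proof (rule M'.integrable_const_bound[where B=2])
    show "AE x in M'. norm (R' x * h (\<theta>' x) * indicator A (Y' x)) \<le> 2"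
      using absR that(1) mult_mono[of "\<bar>R' x\<bar>" 1 "\<bar>h (\<theta>' x)\<bar>" 2 for x]
      by (auto intro!: AE_I2 simp: abs_mult indicator_def)
  qed measurable
  have b2: "\<bar>1 + cos x\<bar> \<le> 2" "\<bar>cos x\<bar> \<le> 2" "\<bar>sin x\<bar> \<le> 2" for x :: real
    using abs_cos_le_one[of x] abs_sin_le_one[of x] by linarith+
  have cos: "(\<integral>\<omega>. R \<omega> * cos (\<theta> \<omega> + \<phi>) * indicator A (Y \<omega>) \<partial>M)
      = (\<integral>\<omega>. R' \<omega> * cos (\<theta>' \<omega> + \<phi>) * indicator A (Y' \<omega>) \<partial>M')" for \<phi>
  proof -
    \<comment> \<open>A shift of the phase by \<open>pi\<close> reverses the sign of the cosine, so
      the difference of the two nonnegative weights is twice the cosine term.\<close>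
    have e: "R \<omega> * cos (\<theta> \<omega> + \<phi>) * indicator A (Y \<omega>) = (R \<omega> * (1 + cos (\<theta> \<omega> + \<phi>)) * indicator A (Y \<omega>)
       - R \<omega> * (1 + cos (\<theta> \<omega> + (\<phi> + pi))) * indicator A (Y \<omega>)) / 2" for \<omega>
      by (simp add: algebra_simps cos_add sin_add)
    have e': "R' \<omega> * cos (\<theta>' \<omega> + \<phi>) * indicator A (Y' \<omega>) = (R' \<omega> * (1 + cos (\<theta>' \<omega> + \<phi>)) * indicator A (Y' \<omega>)
       - R' \<omega> * (1 + cos (\<theta>' \<omega> + (\<phi> + pi))) * indicator A (Y' \<omega>)) / 2" for \<omega>
      by (simp add: algebra_simps cos_add sin_add)
    show ?thesis unfolding e e'
      apply (subst integral_divide_zero, subst Bochner_Integration.integral_diff)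
        apply (rule ir, rule b2, measurable)
       apply (rule ir, rule b2, measurable)
      apply (subst integral_divide_zero, subst Bochner_Integration.integral_diff)
        apply (rule ir', rule b2, measurable)
       apply (rule ir', rule b2, measurable)
      by (simp only: Wcos)
  qed
  \<comment> \<open>The sine is the cosine with phase \<open>- (pi/2)\<close>.\<close>
  have sin: "(\<integral>\<omega>. R \<omega> * sin (\<theta> \<omega>) * indicator A (Y \<omega>) \<partial>M)
      = (\<integral>\<omega>. R' \<omega> * sin (\<theta>' \<omega>) * indicator A (Y' \<omega>) \<partial>M')"
    using cos[of "- (pi/2)"] by (simp add: cos_diff)
  have ex: "of_real (r * i) * iexp x = complex_of_real (r * cos x * i) + \<i> * complex_of_real (r * sin x * i)" for r i x :: real
    by (simp add: exp_Euler cos_of_real sin_of_real algebra_simps)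
  have split: "(\<integral>\<omega>. complex_of_real (f \<omega>) + \<i> * complex_of_real (g \<omega>) \<partial>N) = of_real (integral\<^sup>L N f) + \<i> * of_real (integral\<^sup>L N g)"
    if "integrable N f" "integrable N g" for N :: "'z measure" and f g
    using that by (subst Bochner_Integration.integral_add) auto
  have i: "integrable M (\<lambda>\<omega>. R \<omega> * cos (\<theta> \<omega>) * indicator A (Y \<omega>))" "integrable M (\<lambda>\<omega>. R \<omega> * sin (\<theta> \<omega>) * indicator A (Y \<omega>))"
    by (rule ir[of cos] ir[of sin]; use b2 in simp)+
  have i': "integrable M' (\<lambda>\<omega>. R' \<omega> * cos (\<theta>' \<omega>) * indicator A (Y' \<omega>))" "integrable M' (\<lambda>\<omega>. R' \<omega> * sin (\<theta>' \<omega>) * indicator A (Y' \<omega>))"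
    by (rule ir'[of cos] ir'[of sin]; use b2 in simp)+
  show ?thesis
    unfolding ex split[OF i] split[OF i'] using cos[of 0] sin by simp
qed

text \<open>Multivariate uniqueness from the one-dimensional theorem. By induction over
  \<open>J\<close>, the coordinates in \<open>J\<close> are tested by indicators and the remaining
  ones still by exponentials; \<open>weighted_cos_unique\<close> moves one coordinate across, with
  the indicators already obtained as its weight \<open>R\<close>.\<close>

lemma distr_PiM_eqI:
  assumes P: "prob_space M" "prob_space M'" and I: "finite I"
    and [measurable]: "\<And>i. i \<in> I \<Longrightarrow> Y i \<in> borel_measurable M" "\<And>i. i \<in> I \<Longrightarrow> Y' i \<in> borel_measurable M'"
    and eq: "\<And>a. (\<integral>\<omega>. iexp (\<Sum>i\<in>I. a i * Y i \<omega>) \<partial>M) = (\<integral>\<omega>. iexp (\<Sum>i\<in>I. a i * Y' i \<omega>) \<partial>M')"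
  shows "distr M (PiM I (\<lambda>_. borel :: real measure)) (\<lambda>\<omega>. \<lambda>i\<in>I. Y i \<omega>)
    = distr M' (PiM I (\<lambda>_. borel)) (\<lambda>\<omega>. \<lambda>i\<in>I. Y' i \<omega>)" (is "?D = ?D'")
proof -
  interpret M: prob_space M by fact
  interpret M': prob_space M' by fact
  have key: "(\<integral>\<omega>. of_real (\<Prod>j\<in>J. indicator (A j) (Y j \<omega>)) * iexp (\<Sum>i\<in>I-J. a i * Y i \<omega>) \<partial>M)
    = (\<integral>\<omega>. of_real (\<Prod>j\<in>J. indicator (A j) (Y' j \<omega>)) * iexp (\<Sum>i\<in>I-J. a i * Y' i \<omega>) \<partial>M')"
    if "J \<subseteq> I" and "\<And>j. j \<in> I \<Longrightarrow> A j \<in> sets borel" for J A a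
    using finite_subset[OF that(1) I] that(1)
  proof (induction J arbitrary: a rule: finite_induct)
    case empty
    then show ?case using eq[of a] by simp
  next
    case (insert k J)
    have J: "J \<subseteq> I" "k \<in> I - J" "finite J" using insert by auto
    have A[measurable]: "j \<in> I \<Longrightarrow> A j \<in> sets borel" for j by (rule that(2))
    have jI: "j \<in> I" if "j \<in> J" for j using J that by auto
    have iI: "j \<in> I" if "j \<in> I - insert k J" for j using that by auto
    note [measurable] = jI iI
    have kI[measurable]: "k \<in> I" using J by auto
    have split: "I - J = insert k (I - insert k J)" using J by auto
    have fin: "finite (I - insert k J)" using I by auto
    let ?r = "\<lambda>Y \<omega>. \<Prod>j\<in>J. indicator (A j) (Y j \<omega>) :: real"
    have r: "0 \<le> (\<Prod>j\<in>J. indicator (A j) (x j) :: real) \<and> (\<Prod>j\<in>J. indicator (A j) (x j) :: real) \<le> 1" for x :: "_ \<Rightarrow> real"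
      by (auto intro!: prod_nonneg prod_le_1)
    have *: "(\<integral>\<omega>. of_real (?r Y \<omega> * indicator (A k) (Y k \<omega>)) * iexp (\<Sum>i\<in>I - insert k J. a i * Y i \<omega>) \<partial>M)
      = (\<integral>\<omega>. of_real (?r Y' \<omega> * indicator (A k) (Y' k \<omega>)) * iexp (\<Sum>i\<in>I - insert k J. a i * Y' i \<omega>) \<partial>M')"
    proof (rule weighted_cos_unique[OF P])
      fix t s
      show "(\<integral>\<omega>. of_real (?r Y \<omega>) * iexp (t * Y k \<omega> + s * (\<Sum>i\<in>I - insert k J. a i * Y i \<omega>)) \<partial>M)
       = (\<integral>\<omega>. of_real (?r Y' \<omega>) * iexp (t * Y' k \<omega> + s * (\<Sum>i\<in>I - insert k J. a i * Y' i \<omega>)) \<partial>M')"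
      proof -
        \<comment> \<open>The induction hypothesis holds for all coefficient families: coordinate
          \<open>k\<close> receives the free frequency \<open>t\<close>, and the others are scaled
          by \<open>s\<close>.\<close>
        have e: "(\<Sum>i\<in>I - J. (if i = k then t else s * a i) * y i) = t * y k + s * (\<Sum>i\<in>I - insert k J. a i * y i)" for y :: "_ \<Rightarrow> real"
        proof -
          have "(\<Sum>i\<in>I - insert k J. (if i = k then t else s * a i) * y i) = (\<Sum>i\<in>I - insert k J. s * (a i * y i))"
            by (rule sum.cong) auto
          then show ?thesis unfolding split using fin by (simp add: sum_distrib_left)
        qed
        show ?thesis using insert.IH[OF J(1), of "\<lambda>i. if i = k then t else s * a i"] unfolding e .
      qed
    qed (use r in \<open>auto intro!: borel_measurable_prod borel_measurable_sum simp: jI\<close>)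
    show ?case using * J by (simp add: mult.commute)
  qed
  show ?thesis
  proof (rule measure_eqI_PiM_finite[OF I, where A="\<lambda>_::nat. (\<Pi>\<^sub>E i\<in>I. UNIV)"])
    fix A assume A[measurable]: "\<And>i. i \<in> I \<Longrightarrow> A i \<in> sets (borel :: real measure)"
    have *: "emeasure (distr N (PiM I (\<lambda>_. borel)) (\<lambda>\<omega>. \<lambda>i\<in>I. X i \<omega>)) (Pi\<^sub>E I A) = ennreal (\<integral>\<omega>. (\<Prod>j\<in>I. indicator (A j) (X j \<omega>)) \<partial>N)"
      if N: "prob_space N" and [measurable]: "\<And>i. i \<in> I \<Longrightarrow> X i \<in> borel_measurable N" for N :: "'z measure" and X
    proof -
      interpret N: prob_space N by fact
      have PA: "Pi\<^sub>E I A \<in> sets (PiM I (\<lambda>_. borel))" using I A by (rule sets_PiM_I_finite)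
      have S: "(\<lambda>\<omega>. \<lambda>i\<in>I. X i \<omega>) -` Pi\<^sub>E I A \<inter> space N \<in> sets N"
        by (rule measurable_sets[OF _ PA]) measurable
      have "(\<integral>\<omega>. (\<Prod>j\<in>I. indicator (A j) (X j \<omega>)) \<partial>N) = (\<integral>\<omega>. indicator ((\<lambda>\<omega>. \<lambda>i\<in>I. X i \<omega>) -` Pi\<^sub>E I A \<inter> space N) \<omega> \<partial>N :: real)"
        using I by (intro Bochner_Integration.integral_cong) (auto simp: indicator_def PiE_iff prod_zero_iff)
      also have "\<dots> = measure N ((\<lambda>\<omega>. \<lambda>i\<in>I. X i \<omega>) -` Pi\<^sub>E I A \<inter> space N)" using S by simp
      finally show ?thesis using PA by (subst emeasure_distr) (auto simp: N.emeasure_eq_measure)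
    qed
    \<comment> \<open>For \<open>J = I\<close> no exponential is left, and \<open>key\<close>
      compares the probabilities of rectangles.\<close>
    have "(\<integral>\<omega>. (\<Prod>j\<in>I. indicator (A j) (Y j \<omega>)) \<partial>M) = (\<integral>\<omega>. (\<Prod>j\<in>I. indicator (A j) (Y' j \<omega>)) \<partial>M' :: real)"
      using key[of I A, OF _ A] by (simp del: of_real_prod)
    then show "emeasure ?D (Pi\<^sub>E I A) = emeasure ?D' (Pi\<^sub>E I A)"
      by (subst (1 2) *) (auto simp: P)
  next
    show "range (\<lambda>_::nat. (\<Pi>\<^sub>E i\<in>I. UNIV)) \<subseteq> prod_algebra I (\<lambda>_. borel)"
      using I by (auto intro!: prod_algebraI_finite)
    show "emeasure ?D (\<Pi>\<^sub>E i\<in>I. UNIV) \<noteq> \<infinity>"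
      using M.prob_space_distr[of "\<lambda>\<omega>. \<lambda>i\<in>I. Y i \<omega>" "PiM I (\<lambda>_. borel)"]
      by (metis assms(4) finite_measure.emeasure_finite infinity_ennreal_def measurable_restrict prob_space.finite_measure)
  qed (auto simp: space_PiM)
qed

section \<open>Gaussian measures\<close>

definition gauss_measure :: "real \<Rightarrow> 'a::euclidean_space measure" where
  "gauss_measure v = density lborel (\<lambda>z. ennreal (gauss_kernel v z))"

lemma gauss_kernel_nonneg [simp]: "0 \<le> gauss_kernel v z" if "0 \<le> v"
  using that by (simp add: gauss_kernel_def)

lemma gauss_kernel_pos: "0 < gauss_kernel v z" if "0 < v"
  using that by (simp add: gauss_kernel_def)

lemma gauss_kernel_measurable [measurable]: "gauss_kernel v \<in> borel_measurable borel"
  unfolding gauss_kernel_def[abs_def] by measurable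

lemma space_gauss_measure [simp]: "space (gauss_measure v) = UNIV"
  and sets_gauss_measure [simp, measurable_cong]: "sets (gauss_measure v) = sets borel"
  by (auto simp: gauss_measure_def)

lemma gauss_kernel_prod:
  fixes z :: "'a::euclidean_space"
  assumes "0 < v"
  shows "gauss_kernel v z = (\<Prod>b\<in>Basis. normal_density 0 (sqrt v) (z \<bullet> b))"
proof -
  have "(\<Prod>b\<in>Basis. normal_density 0 (sqrt v) (z \<bullet> b))
    = (\<Prod>b\<in>(Basis::'a set). 1 / sqrt (2 * pi * v)) * (\<Prod>b\<in>Basis. exp (- (z \<bullet> b)\<^sup>2 / (2 * v)))"
    using assms by (simp add: normal_density_def prod.distrib power_one_over prod_dividef)
  also have "(\<Prod>b\<in>Basis. exp (- (z \<bullet> b)\<^sup>2 / (2 * v))) = exp (\<Sum>b\<in>Basis. - (z \<bullet> b)\<^sup>2 / (2 * v))"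
    by (simp add: exp_sum)
  also have "(\<Sum>b\<in>Basis. - (z \<bullet> b)\<^sup>2 / (2 * v)) = - (norm z)\<^sup>2 / (2 * v)"
    unfolding power2_norm_eq_inner euclidean_inner[of z z]
    by (simp add: power2_eq_square sum_divide_distrib sum_negf)
  finally show ?thesis unfolding gauss_kernel_def prod_constant power_one_over by simp
qed

text \<open>\<open>lborel\<close> is the image of the product of one-dimensional Lebesgue measures
  under the coordinate map, so products of functions of single coordinates integrate
  factorwise.\<close>

lemma
  fixes f :: "'a::euclidean_space \<Rightarrow> real \<Rightarrow> 'b::{real_normed_field, banach, second_countable_topology}"
  assumes f: "\<And>b. b \<in> Basis \<Longrightarrow> integrable lborel (f b)"
  shows integral_lborel_prod: "(\<integral>z. (\<Prod>b\<in>Basis. f b (z \<bullet> b)) \<partial>lborel) = (\<Prod>b\<in>Basis. integral\<^sup>L lborel (f b))"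
    and integrable_lborel_prod: "integrable lborel (\<lambda>z. (\<Prod>b\<in>Basis. f b (z \<bullet> b)))"
proof -
  interpret product_sigma_finite "\<lambda>_::'a. lborel :: real measure" ..
  have [measurable]: "b \<in> Basis \<Longrightarrow> f b \<in> borel_measurable borel" for b
    using borel_measurable_integrable[OF f] by simp
  have e: "(\<lambda>x. \<Prod>b\<in>Basis. f b ((\<Sum>b\<in>Basis. x b *\<^sub>R b) \<bullet> b)) = (\<lambda>x. \<Prod>b\<in>Basis. f b (x b))"
    by (auto simp: inner_sum_left_Basis)
  show "(\<integral>z. (\<Prod>b\<in>Basis. f b (z \<bullet> b)) \<partial>lborel) = (\<Prod>b\<in>Basis. integral\<^sup>L lborel (f b))"
    by (subst lborel_eq, subst integral_distr) (auto simp: e product_integral_prod f)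
  show "integrable lborel (\<lambda>z. (\<Prod>b\<in>Basis. f b (z \<bullet> b)))"
    by (subst lborel_eq, subst integrable_distr_eq) (auto simp: e f intro!: product_integrable_prod)
qed

lemma
  fixes f :: "'a::euclidean_space \<Rightarrow> real \<Rightarrow> 'b::{real_normed_field, banach, second_countable_topology}"
  assumes v: "0 < v" and f: "\<And>b. b \<in> Basis \<Longrightarrow> integrable (density lborel (normal_density 0 (sqrt v))) (f b)"
  shows integral_gauss_prod: "(\<integral>z. (\<Prod>b\<in>Basis. f b (z \<bullet> b)) \<partial>gauss_measure v)
      = (\<Prod>b\<in>Basis. integral\<^sup>L (density lborel (normal_density 0 (sqrt v))) (f b))"
    and integrable_gauss_prod: "integrable (gauss_measure v) (\<lambda>z. (\<Prod>b\<in>Basis. f b (z \<bullet> b)))"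
proof -
  have [measurable]: "b \<in> Basis \<Longrightarrow> f b \<in> borel_measurable borel" for b
    using borel_measurable_integrable[OF f] by simp
  have i: "integrable lborel (\<lambda>x. of_real (normal_density 0 (sqrt v) x) * f b x)" if "b \<in> Basis" for b
    using f[OF that] that by (subst (asm) integrable_density) (auto simp: scaleR_conv_of_real)
  have e: "gauss_kernel v z *\<^sub>R (\<Prod>b\<in>Basis. f b (z \<bullet> b))
    = (\<Prod>b\<in>Basis. of_real (normal_density 0 (sqrt v) (z \<bullet> b)) * f b (z \<bullet> b))" for z
    using v by (simp add: gauss_kernel_prod scaleR_conv_of_real prod.distrib)
  show "integrable (gauss_measure v) (\<lambda>z. (\<Prod>b\<in>Basis. f b (z \<bullet> b)))"
    unfolding gauss_measure_def using v
    by (subst integrable_density) (auto simp: e intro!: integrable_lborel_prod[where f="\<lambda>b x. of_real (normal_density 0 (sqrt v) x) * f b x"] i)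
  show "(\<integral>z. (\<Prod>b\<in>Basis. f b (z \<bullet> b)) \<partial>gauss_measure v)
      = (\<Prod>b\<in>Basis. integral\<^sup>L (density lborel (normal_density 0 (sqrt v))) (f b))"
    unfolding gauss_measure_def using v
    apply (subst integral_density)
       apply (auto simp: e)[3]
    apply (simp add: e)
    apply (subst integral_lborel_prod[where f="\<lambda>b x. of_real (normal_density 0 (sqrt v) x) * f b x"])
     apply (rule i, assumption)
    apply (rule prod.cong, simp)
    apply (subst integral_density)
       apply (auto simp: scaleR_conv_of_real)
    done
qed

text \<open>Makes facts about normally distributed variables applicable to the normal measure
  itself, with the identity as random variable.\<close>

lemma distributed_self_density:
  fixes f :: "real \<Rightarrow> real"
  assumes [measurable]: "f \<in> borel_measurable borel"
  shows "distributed (density lborel f) lborel (\<lambda>x. x) f"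
  unfolding distributed_def by (auto intro!: distr_id2)

lemma (in prob_space) normal_distributed_iexp:
  assumes "0 < \<sigma>" and D: "distributed M lborel X (normal_density 0 \<sigma>)"
  shows "(\<integral>\<omega>. iexp (s * X \<omega>) \<partial>M) = of_real (exp (- (s * \<sigma>)\<^sup>2 / 2))"
proof -
  have [measurable]: "X \<in> borel_measurable M" using distributed_measurable[OF D] by simp
  have "distributed M lborel (\<lambda>x. (X x - 0) / \<sigma>) std_normal_density"
    using normal_standard_normal_convert[of \<sigma> X 0] assms by simp
  then have "distr M lborel (\<lambda>x. X x / \<sigma>) = std_normal_distribution"
    using distributed_distr_eq_density by fastforce
  then have "char std_normal_distribution (s * \<sigma>) = (\<integral>y. iexp (s * \<sigma> * y) \<partial>distr M lborel (\<lambda>x. X x / \<sigma>))"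
    by (simp add: char_def)
  also have "\<dots> = (\<integral>\<omega>. iexp (s * \<sigma> * (X \<omega> / \<sigma>)) \<partial>M)" by (subst integral_distr) auto
  finally show ?thesis using assms(1) by (simp add: char_std_normal_distribution)
qed

lemma prob_space_gauss_measure: "0 < v \<Longrightarrow> prob_space (gauss_measure v :: 'a::euclidean_space measure)"
proof -
  assume v: "0 < v"
  have "(\<integral>\<^sup>+x. ennreal (normal_density 0 (sqrt v) x) \<partial>lborel) = 1"
    using v by (subst nn_integral_eq_integral) auto
  moreover have "(\<integral>\<^sup>+z. ennreal (gauss_kernel v (z::'a)) \<partial>lborel)
    = (\<integral>\<^sup>+z. (\<Prod>b\<in>(Basis::'a set). ennreal (normal_density 0 (sqrt v) (z \<bullet> b))) \<partial>lborel)"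
    using v by (simp add: gauss_kernel_prod prod_ennreal)
  ultimately have "(\<integral>\<^sup>+z. ennreal (gauss_kernel v (z::'a)) \<partial>lborel) = 1"
    by (simp add: nn_integral_lborel_prod[of "\<lambda>_ x. ennreal (normal_density 0 (sqrt v) x)"])
  then show ?thesis
    by (intro prob_spaceI) (simp add: gauss_measure_def emeasure_density)
qed

lemma gauss_measure_iexp:
  fixes u :: "'a::euclidean_space"
  assumes v: "0 < v"
  shows "(\<integral>z. iexp (u \<bullet> z) \<partial>gauss_measure v) = of_real (exp (- v * (norm u)\<^sup>2 / 2))"
proof -
  interpret prob_space "density lborel (normal_density 0 (sqrt v))"
    using v by (intro prob_space_normal_density) simp
  have "(\<integral>z. iexp (u \<bullet> z) \<partial>gauss_measure v) = (\<integral>z. (\<Prod>b\<in>Basis. iexp ((u \<bullet> b) * (z \<bullet> b))) \<partial>gauss_measure v)"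
    by (subst euclidean_inner) (simp add: exp_sum[symmetric] sum_distrib_left)
  also have "\<dots> = (\<Prod>b\<in>Basis. \<integral>x. iexp ((u \<bullet> b) * x) \<partial>density lborel (normal_density 0 (sqrt v)))"
    by (subst integral_gauss_prod[OF v, where f="\<lambda>b x. iexp ((u \<bullet> b) * x)"]) (auto intro!: integrable_iexp)
  also have "\<dots> = (\<Prod>b\<in>Basis. of_real (exp (- (u \<bullet> b * sqrt v)\<^sup>2 / 2)))"
    using v by (subst normal_distributed_iexp[OF _ distributed_self_density]) auto
  also have "\<dots> = of_real (exp (\<Sum>b\<in>Basis. - (u \<bullet> b * sqrt v)\<^sup>2 / 2))"
    by (simp add: exp_sum)
  also have "(\<Sum>b\<in>Basis. - (u \<bullet> b * sqrt v)\<^sup>2 / 2) = - v * (norm u)\<^sup>2 / 2"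
    using v by (simp add: power2_norm_eq_inner euclidean_inner[of u u] power_mult_distrib)
       (simp add: power2_eq_square sum_divide_distrib sum_negf sum_distrib_left mult.commute)
  finally show ?thesis .
qed

lemma gauss_measure_coordinate:
  fixes g :: "real \<Rightarrow> real" and e :: "'a::euclidean_space"
  assumes v: "0 < v" and e: "e \<in> Basis" and g: "integrable (density lborel (normal_density 0 (sqrt v))) g"
  shows "integrable (gauss_measure v) (\<lambda>z. g (z \<bullet> e))"
    and "(\<integral>z. g (z \<bullet> e) \<partial>gauss_measure v) = integral\<^sup>L (density lborel (normal_density 0 (sqrt v))) g"
proof -
  interpret prob_space "density lborel (normal_density 0 (sqrt v))"
    using v by (intro prob_space_normal_density) simp
  define f where "f b = (if b = e then g else (\<lambda>_. 1))" for b
  have f: "integrable (density lborel (normal_density 0 (sqrt v))) (f b)" for b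
    using g by (simp add: f_def)
  have p: "(\<Prod>b\<in>Basis. f b (z \<bullet> b)) = g (z \<bullet> e)" for z
    using e by (subst prod.remove[OF _ e]) (auto simp: f_def)
  have q: "(\<Prod>b\<in>Basis. integral\<^sup>L (density lborel (normal_density 0 (sqrt v))) (f b)) = integral\<^sup>L (density lborel (normal_density 0 (sqrt v))) g"
    using e by (subst prod.remove[OF _ e]) (auto simp: f_def prob_space[simplified])
  show "integrable (gauss_measure v) (\<lambda>z. g (z \<bullet> e))"
    using integrable_gauss_prod[OF v, of f] f by (simp add: p)
  show "(\<integral>z. g (z \<bullet> e) \<partial>gauss_measure v) = integral\<^sup>L (density lborel (normal_density 0 (sqrt v))) g"
    using integral_gauss_prod[OF v, of f] f by (simp add: p q)
qed

lemma gauss_measure_moments: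
  fixes e :: "'a::euclidean_space"
  assumes v: "0 < v" and e: "e \<in> Basis"
  shows "integrable (gauss_measure v) (\<lambda>z. z \<bullet> e)" "(\<integral>z. z \<bullet> e \<partial>gauss_measure v) = 0"
    "integrable (gauss_measure v) (\<lambda>z. (z \<bullet> e)\<^sup>2)" "(\<integral>z. (z \<bullet> e)\<^sup>2 \<partial>gauss_measure v) = v"
proof -
  have s: "0 < sqrt v" using v by simp
  have d: "integrable (density lborel (normal_density 0 (sqrt v))) g \<longleftrightarrow> integrable lborel (\<lambda>x. normal_density 0 (sqrt v) x * g x)"
    "integral\<^sup>L (density lborel (normal_density 0 (sqrt v))) g = (\<integral>x. normal_density 0 (sqrt v) x * g x \<partial>lborel)"
    if "g \<in> borel_measurable borel" for g :: "real \<Rightarrow> real"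
    using that by (auto simp: integrable_density integral_density)
  have d1: "integrable (density lborel (normal_density 0 (sqrt v))) (\<lambda>x. x)"
      "integral\<^sup>L (density lborel (normal_density 0 (sqrt v))) (\<lambda>x. x) = 0"
    using integrable_normal_moment[OF s, of 0 1] integral_normal_moment_odd[OF s, of 0 0]
    by (auto simp: d)
  have d2: "integrable (density lborel (normal_density 0 (sqrt v))) (\<lambda>x. x\<^sup>2)"
      "integral\<^sup>L (density lborel (normal_density 0 (sqrt v))) (\<lambda>x. x\<^sup>2) = v"
    using integrable_normal_moment[OF s, of 0 2] integral_normal_moment_even[OF s, of 0 1] v
    by (auto simp: d)
  show "integrable (gauss_measure v) (\<lambda>z. z \<bullet> e)" "(\<integral>z. z \<bullet> e \<partial>gauss_measure v) = 0"
    "integrable (gauss_measure v) (\<lambda>z. (z \<bullet> e)\<^sup>2)" "(\<integral>z. (z \<bullet> e)\<^sup>2 \<partial>gauss_measure v) = v"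
    using gauss_measure_coordinate[OF v e d1(1)] gauss_measure_coordinate[OF v e d2(1)] d1 d2 by auto
qed

lemma gauss_kernel_scale:
  fixes z :: "'a::euclidean_space"
  assumes v: "0 < v"
  shows "sqrt v ^ DIM('a) * gauss_kernel v (sqrt v *\<^sub>R z) = gauss_kernel 1 z"
  using v by (simp add: gauss_kernel_def real_sqrt_mult power_mult_distrib field_simps)

lemma integral_gauss_affine:
  fixes F :: "'a::euclidean_space \<Rightarrow> 'b::{banach, second_countable_topology}"
  assumes v: "0 < v" and [measurable]: "F \<in> borel_measurable borel"
  shows "(\<integral>n. F (x + sqrt v *\<^sub>R n) \<partial>gauss_measure 1) = (\<integral>\<xi>. gauss_kernel v (\<xi> - x) *\<^sub>R F \<xi> \<partial>lborel)"
proof -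
  have s: "sqrt v \<noteq> 0" using v by simp
  have s0: "0 \<le> sqrt v ^ DIM('a)" using v by simp
  show "(\<integral>n. F (x + sqrt v *\<^sub>R n) \<partial>gauss_measure 1) = (\<integral>\<xi>. gauss_kernel v (\<xi> - x) *\<^sub>R F \<xi> \<partial>lborel)"
    unfolding gauss_measure_def
    by (subst (2) lborel_affine[OF s, of x], subst (1 2) integral_density)
       (use v s0 in \<open>auto simp: integral_distr gauss_kernel_scale simp del: integral_scaleR_right\<close>)
qed

lemma gaussian_variable_measurable: "gaussian_variable M X \<Longrightarrow> X \<in> borel_measurable M"
  by (simp add: gaussian_variable_def)

text \<open>\<open>gaussian_variable\<close> admits almost surely constant variables, so each fact
  has a degenerate and a normal case; the three are proved together to share this split.\<close>

lemma (in prob_space)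
  assumes G: "gaussian_variable M X"
  shows gaussian_variable_integrable: "integrable M (\<lambda>\<omega>. X \<omega> ^ k)"
    and gaussian_variable_iexp: "expectation X = 0 \<Longrightarrow> (\<integral>\<omega>. iexp (X \<omega>) \<partial>M) = of_real (exp (- expectation (\<lambda>\<omega>. (X \<omega>)\<^sup>2) / 2))"
    and gaussian_variable_moment: "expectation X = 0 \<Longrightarrow> expectation (\<lambda>\<omega>. (X \<omega>) ^ (2 * q))
      = fact (2 * q) / (2 ^ q * fact q) * expectation (\<lambda>\<omega>. (X \<omega>)\<^sup>2) ^ q"
proof -
  have [measurable]: "X \<in> borel_measurable M" using G by (simp add: gaussian_variable_def)
  from G obtain m where m: "(AE \<omega> in M. X \<omega> = m) \<or> (\<exists>\<sigma>>0. distributed M lborel X (\<lambda>u. ennreal (normal_density m \<sigma> u)))"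
    by (auto simp: gaussian_variable_def)
  have "integrable M (\<lambda>\<omega>. X \<omega> ^ k) \<and> (expectation X = 0 \<longrightarrow>
      (\<integral>\<omega>. iexp (X \<omega>) \<partial>M) = of_real (exp (- expectation (\<lambda>\<omega>. (X \<omega>)\<^sup>2) / 2)) \<and>
       expectation (\<lambda>\<omega>. (X \<omega>) ^ (2 * q)) = fact (2 * q) / (2 ^ q * fact q) * expectation (\<lambda>\<omega>. (X \<omega>)\<^sup>2) ^ q)"
  proof (cases "AE \<omega> in M. X \<omega> = m")
    case True
    have c: "integral\<^sup>L M (\<lambda>\<omega>. g (X \<omega>)) = g m" if [measurable]: "g \<in> borel_measurable borel" for g :: "real \<Rightarrow> 'z::{banach, second_countable_topology}"
    proof -
      have "integral\<^sup>L M (\<lambda>\<omega>. g (X \<omega>)) = integral\<^sup>L M (\<lambda>\<omega>. g m)"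
        using True by (intro integral_cong_AE) auto
      then show ?thesis by (simp add: prob_space)
    qed
    have "integrable M (\<lambda>\<omega>. X \<omega> ^ k) \<longleftrightarrow> integrable M (\<lambda>\<omega>. m ^ k)"
      using True by (intro integrable_cong_AE) auto
    \<comment> \<open>A centred constant is 0, so both sides of the moment formula are 0, except for
      \<open>q = 0\<close>, where both are 1.\<close>
    then show ?thesis
      using c[of "\<lambda>x. x"] c[of iexp] c[of "\<lambda>x. x\<^sup>2"] c[of "\<lambda>x. x ^ (2*q)"]
      by (cases "q = 0") (auto simp: power_0_left)
  next
    case False
    then obtain \<sigma> where \<sigma>: "0 < \<sigma>" and D: "distributed M lborel X (\<lambda>u. ennreal (normal_density m \<sigma> u))" using m by blast
    have E: "integral\<^sup>L M X = m" by (rule normal_distributed_expectation[OF \<sigma> D])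
    have I: "integrable M (\<lambda>\<omega>. (X \<omega> - m) ^ j)" for j
      using integrable_normal_moment[OF \<sigma>, of m j] distributed_integrable[OF D, of "\<lambda>x. (x - m) ^ j"] \<sigma> by auto
    \<comment> \<open>The moments at hand are taken about the mean \<open>m\<close>; the binomial
      formula passes to powers of \<open>X\<close> itself.\<close>
    have "integrable M (\<lambda>\<omega>. (\<Sum>j\<le>k. of_nat (k choose j) * ((X \<omega> - m) ^ j * m ^ (k - j))))"
      using I by (intro Bochner_Integration.integrable_sum integrable_mult_right integrable_mult_left)
    also have "(\<lambda>\<omega>. (\<Sum>j\<le>k. of_nat (k choose j) * ((X \<omega> - m) ^ j * m ^ (k - j)))) = (\<lambda>\<omega>. X \<omega> ^ k)"
      using binomial_ring[of "X _ - m" m k] by (simp add: mult.assoc)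
    finally have 1: "integrable M (\<lambda>\<omega>. X \<omega> ^ k)" .
    {
      assume E0: "integral\<^sup>L M X = 0"
      then have m0: "m = 0" using E by simp
      have mom: "expectation (\<lambda>\<omega>. (X \<omega>) ^ (2 * q)) = fact (2 * q) / ((2 / \<sigma>\<^sup>2)^q * fact q)" for q
        using integral_normal_moment_even[OF \<sigma>, of m q] distributed_integral[OF D, of "\<lambda>x. (x - m) ^ (2 * q)"] \<sigma> m0 by simp
      have v: "expectation (\<lambda>\<omega>. (X \<omega>)\<^sup>2) = \<sigma>\<^sup>2" using mom[of 1] by simp
      have "(\<integral>\<omega>. iexp (X \<omega>) \<partial>M) = of_real (exp (- \<sigma>\<^sup>2 / 2))"
        using normal_distributed_iexp[OF \<sigma>, of X 1] D m0 by simp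
      moreover have "expectation (\<lambda>\<omega>. (X \<omega>) ^ (2 * q)) = fact (2 * q) / (2 ^ q * fact q) * (\<sigma>\<^sup>2) ^ q"
        unfolding mom by (simp add: power_divide)
      ultimately have "(\<integral>\<omega>. iexp (X \<omega>) \<partial>M) = of_real (exp (- expectation (\<lambda>\<omega>. (X \<omega>)\<^sup>2) / 2)) \<and>
       expectation (\<lambda>\<omega>. (X \<omega>) ^ (2 * q)) = fact (2 * q) / (2 ^ q * fact q) * expectation (\<lambda>\<omega>. (X \<omega>)\<^sup>2) ^ q"
        unfolding v by simp
    }
    with 1 show ?thesis by blast
  qed
  then show "integrable M (\<lambda>\<omega>. X \<omega> ^ k)"
    "expectation X = 0 \<Longrightarrow> (\<integral>\<omega>. iexp (X \<omega>) \<partial>M) = of_real (exp (- expectation (\<lambda>\<omega>. (X \<omega>)\<^sup>2) / 2))"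
    "expectation X = 0 \<Longrightarrow> expectation (\<lambda>\<omega>. (X \<omega>) ^ (2 * q))
      = fact (2 * q) / (2 ^ q * fact q) * expectation (\<lambda>\<omega>. (X \<omega>)\<^sup>2) ^ q" by auto
qed

section \<open>Step approximation of continuous processes\<close>

lemma divided_floor_ge: "s - 1 / n \<le> real_of_int \<lfloor>s * n\<rfloor> / n" if "0 < n" for s n :: real
proof -
  have "s * n - 1 \<le> real_of_int \<lfloor>s * n\<rfloor>" by linarith
  from divide_right_mono[OF this, of n] that show ?thesis by (simp add: diff_divide_distrib)
qed

text \<open>Rounding time down to multiples of \<open>1 / Suc i\<close> leaves countably many times,
  so the rounded process is jointly measurable; path continuity gives the limit. Time is clipped
  because the hypotheses concern \<open>{0..T}\<close> only.\<close>

lemma clipped_process_measurable: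
  fixes X :: "real \<Rightarrow> 'w \<Rightarrow> 'a::{second_countable_topology, metric_space}"
  assumes T: "0 \<le> T" and X: "\<And>t. t \<in> {0..T} \<Longrightarrow> X t \<in> borel_measurable M"
    and cont: "\<And>\<omega>. \<omega> \<in> space M \<Longrightarrow> continuous_on {0..T} (\<lambda>t. X t \<omega>)"
  shows "(\<lambda>z. X (max 0 (min T (fst z))) (snd z)) \<in> borel_measurable (borel \<Otimes>\<^sub>M M)"
proof (rule borel_measurable_LIMSEQ_metric)
  define c where "c s = max 0 (min T s)" for s :: real
  have c: "c s \<in> {0..T}" for s using T by (auto simp: c_def)
  fix i :: nat
  have "(\<lambda>z. X (c (real_of_int \<lfloor>fst z * real (Suc i)\<rfloor> / real (Suc i))) (snd z)) \<in> borel_measurable (borel \<Otimes>\<^sub>M M)"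
    by (rule measurable_compose_countable[where f="\<lambda>j z. X (c (real_of_int j / real (Suc i))) (snd z)" and g="\<lambda>z. \<lfloor>fst z * real (Suc i)\<rfloor>"])
       (auto intro!: measurable_compose[OF measurable_snd] X c)
  then show "(\<lambda>z. X (max 0 (min T (real_of_int \<lfloor>fst z * real (Suc i)\<rfloor> / real (Suc i)))) (snd z)) \<in> borel_measurable (borel \<Otimes>\<^sub>M M)"
    by (simp add: c_def)
next
  fix z :: "real \<times> 'w" assume z: "z \<in> space (borel \<Otimes>\<^sub>M M)"
  define s where "s = fst z"
  have \<omega>: "snd z \<in> space M" using z by (auto simp: space_pair_measure)
  have "(\<lambda>i. real_of_int \<lfloor>s * real (Suc i)\<rfloor> / real (Suc i)) \<longlonglongrightarrow> s"
  proof (rule tendsto_sandwich[where f="\<lambda>i. s - 1 / real (Suc i)" and h="\<lambda>i. s"])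
    show "\<forall>\<^sub>F i in sequentially. s - 1 / real (Suc i) \<le> real_of_int \<lfloor>s * real (Suc i)\<rfloor> / real (Suc i)"
      by (intro always_eventually allI divided_floor_ge) simp
    show "\<forall>\<^sub>F i in sequentially. real_of_int \<lfloor>s * real (Suc i)\<rfloor> / real (Suc i) \<le> s"
      by (intro always_eventually allI) (simp add: field_simps)
    show "(\<lambda>i. s - 1 / real (Suc i)) \<longlonglongrightarrow> s"
      using tendsto_diff[OF tendsto_const LIMSEQ_inverse_real_of_nat, of s] by (simp add: field_simps)
  qed simp
  then have "(\<lambda>i. max 0 (min T (real_of_int \<lfloor>s * real (Suc i)\<rfloor> / real (Suc i)))) \<longlonglongrightarrow> max 0 (min T s)"
    by (intro tendsto_intros)
  moreover have "continuous_on {0..T} (\<lambda>t. X t (snd z))" by (rule cont[OF \<omega>])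
  ultimately show "(\<lambda>i. X (max 0 (min T (real_of_int \<lfloor>fst z * real (Suc i)\<rfloor> / real (Suc i)))) (snd z))
    \<longlonglongrightarrow> X (max 0 (min T (fst z))) (snd z)"
    unfolding s_def[symmetric] using T
    by (intro continuous_on_tendsto_compose[of "{0..T}" "\<lambda>t. X t (snd z)"]) auto
qed

text \<open>The cells, open on the left and closed on the right, partition \<open>{0<..T}\<close>.
  The last clause holds for all \<open>g\<close> with the same \<open>k\<close>, which allows a step
  function and its square to be evaluated together.\<close>

lemma grid_step_cases:
  fixes s T :: real
  assumes s: "0 < s" "s \<le> T"
  obtains k where "k < Suc m" "s \<in> {real k * T / Suc m<..real (Suc k) * T / Suc m}"
    "\<And>g :: nat \<Rightarrow> real. (\<Sum>k<Suc m. g k * indicator {real k * T / Suc m<..real (Suc k) * T / Suc m} s) = g k"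
proof -
  have T: "0 < T" using s by simp
  \<comment> \<open>Cells contain their right endpoint, hence the ceiling: \<open>j\<close> numbers
    the right endpoint of the cell of \<open>s\<close>, and \<open>k = j - 1\<close> the left
    one.\<close>
  define j where "j = nat \<lceil>s * Suc m / T\<rceil>"
  have pos: "0 < s * Suc m / T" using s T by simp
  have j1: "real j - 1 < s * Suc m / T" "s * Suc m / T \<le> real j"
    unfolding j_def using pos by linarith+
  have "s * Suc m \<le> T * Suc m" using s by (intro mult_right_mono) auto
  then have "s * Suc m / T \<le> Suc m" by (simp add: pos_divide_le_eq[OF T] mult.commute del: of_nat_Suc)
  then have "\<lceil>s * Suc m / T\<rceil> \<le> int (Suc m)" unfolding ceiling_le_iff by (simp only: of_int_of_nat_eq)
  then have j2: "j \<le> Suc m" unfolding j_def by (simp only: nat_le_iff)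
  have j3: "0 < j" using j1 pos by linarith
  define k where "k = j - 1"
  have j: "j = Suc k" using j3 by (simp add: k_def)
  have in1: "s \<in> {real k * T / Suc m<..real (Suc k) * T / Suc m}"
    using j1 T by (simp add: j field_simps)
  have uniq: "i = k" if "s \<in> {real i * T / Suc m<..real (Suc i) * T / Suc m}" for i
  proof -
    have "real i * T / Suc m < real (Suc k) * T / Suc m" "real k * T / Suc m < real (Suc i) * T / Suc m"
      using that in1 by (auto simp del: of_nat_Suc)
    then have "real i * T < real (Suc k) * T" "real k * T < real (Suc i) * T"
      using divide_less_cancel by (metis of_nat_0_less_iff not_less_iff_gr_or_eq zero_less_Suc)+
    then have "i < Suc k" "k < Suc i" using T by (auto simp del: of_nat_Suc)
    then show ?thesis by simp
  qed
  show ?thesis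
  proof (rule that[OF _ in1])
    show k: "k < Suc m" using j j2 by simp
    fix g :: "nat \<Rightarrow> real"
    have "(\<Sum>i<Suc m. g i * indicator {real i * T / Suc m<..real (Suc i) * T / Suc m} s) = (\<Sum>i<Suc m. if i = k then g i else 0)"
    proof (rule sum.cong[OF refl])
      fix i
      show "g i * indicator {real i * T / Suc m<..real (Suc i) * T / Suc m} s = (if i = k then g i else 0)"
        using uniq[of i] in1 by (cases "i = k") (auto simp: indicator_def)
    qed
    also have "\<dots> = g k" using k by simp
    finally show "(\<Sum>k<Suc m. g k * indicator {real k * T / Suc m<..real (Suc k) * T / Suc m} s) = g k" .
  qed
qed

text \<open>At \<open>s\<close> the step function equals \<open>f\<close> at the left endpoint of
  the cell of \<open>s\<close>, which lies within \<open>T / Suc m\<close> of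
  \<open>s\<close>.\<close>

lemma grid_step_tendsto:
  fixes f :: "real \<Rightarrow> real"
  assumes s: "0 < s" "s \<le> T" and f: "continuous_on {0..T} f"
  shows "(\<lambda>m. \<Sum>k<Suc m. f (real k * T / Suc m) * indicator {real k * T / Suc m<..real (Suc k) * T / Suc m} s) \<longlonglongrightarrow> f s"
proof -
  have T: "0 < T" using s by simp
  have "\<exists>t. t \<in> {0..T} \<and> \<bar>t - s\<bar> \<le> T / Suc m \<and>
    (\<Sum>k<Suc m. f (real k * T / Suc m) * indicator {real k * T / Suc m<..real (Suc k) * T / Suc m} s) = f t" for m
  proof -
    obtain k where k: "k < Suc m" "s \<in> {real k * T / Suc m<..real (Suc k) * T / Suc m}"
      "\<And>g :: nat \<Rightarrow> real. (\<Sum>k<Suc m. g k * indicator {real k * T / Suc m<..real (Suc k) * T / Suc m} s) = g k"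
      using grid_step_cases[OF s, of m] by blast
    have "real k * T / Suc m \<in> {0..T}" using k s T by auto
    moreover have "\<bar>real k * T / Suc m - s\<bar> \<le> T / Suc m"
    proof -
      have "real (Suc k) * T / Suc m = real k * T / Suc m + T / Suc m"
        by (simp add: add_divide_distrib distrib_right)
      then show ?thesis using k(2) by auto
    qed
    ultimately show ?thesis using k(3)[of "\<lambda>k. f (real k * T / Suc m)"] by blast
  qed
  then obtain t where t: "\<And>m. t m \<in> {0..T}" "\<And>m. \<bar>t m - s\<bar> \<le> T / Suc m"
    "\<And>m. (\<Sum>k<Suc m. f (real k * T / Suc m) * indicator {real k * T / Suc m<..real (Suc k) * T / Suc m} s) = f (t m)"
    by metis
  have "(\<lambda>m. T * (1 / Suc m)) \<longlonglongrightarrow> T * 0"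
    by (intro tendsto_mult tendsto_const) (use LIMSEQ_inverse_real_of_nat in \<open>simp add: field_simps\<close>)
  then have "(\<lambda>m. T / Suc m) \<longlonglongrightarrow> 0" by simp
  then have "(\<lambda>m. t m - s) \<longlonglongrightarrow> 0"
    by (rule Lim_null_comparison[rotated]) (use t(2) in auto)
  then have "t \<longlonglongrightarrow> s" by (simp add: LIM_zero_iff)
  then have "(\<lambda>m. f (t m)) \<longlonglongrightarrow> f s"
    using s t by (intro continuous_on_tendsto_compose[OF f]) auto
  then show ?thesis by (simp only: t(3))
qed

lemma grid_step_abs_le:
  fixes g :: "nat \<Rightarrow> real"
  assumes "\<And>k. k < Suc m \<Longrightarrow> \<bar>g k\<bar> \<le> B" "0 \<le> B" "0 < T"
  shows "\<bar>\<Sum>k<Suc m. g k * indicator {real k * T / Suc m<..real (Suc k) * T / Suc m} s\<bar> \<le> B * indicator {0..T} s"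
proof (cases "0 < s \<and> s \<le> T")
  case True
  then obtain k where k: "k < Suc m"
    "\<And>g :: nat \<Rightarrow> real. (\<Sum>k<Suc m. g k * indicator {real k * T / Suc m<..real (Suc k) * T / Suc m} s) = g k"
    using grid_step_cases[of s T m] by blast
  show ?thesis unfolding k(2) using assms(1)[OF k(1)] True by simp
next
  case False
  have "indicator {real k * T / Suc m<..real (Suc k) * T / Suc m} s = (0::real)" if k: "k < Suc m" for k
  proof -
    have "0 \<le> real k * T / Suc m" using assms by simp
    moreover have "real (Suc k) * T \<le> real (Suc m) * T" using k assms by (intro mult_right_mono) auto
    then have "real (Suc k) * T / Suc m \<le> T" by (simp add: field_simps)
    ultimately show ?thesis using False by (auto simp: indicator_def)
  qed
  then have "(\<Sum>k<Suc m. g k * indicator {real k * T / Suc m<..real (Suc k) * T / Suc m} s) = 0"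
    by (intro sum.neutral) auto
  then show ?thesis using assms by simp
qed

lemma integral_grid_step:
  fixes g :: "nat \<Rightarrow> real"
  assumes "0 < T"
  shows "(\<integral>s. (\<Sum>k<Suc m. g k * indicator {real k * T / Suc m<..real (Suc k) * T / Suc m} s) \<partial>lborel) = T / Suc m * (\<Sum>k<Suc m. g k)"
proof -
  have em: "emeasure lborel {real k * T / Suc m<..real (Suc k) * T / Suc m} = ennreal (T / Suc m)" for k
  proof -
    have "real (Suc k) * T / Suc m = real k * T / Suc m + T / Suc m"
      by (simp add: add_divide_distrib distrib_right)
    then show ?thesis using assms by (simp del: of_nat_Suc)
  qed
  have m: "measure lborel {real k * T / Suc m<..real (Suc k) * T / Suc m} = T / Suc m" for k
    using assms em[of k] by (simp add: measure_def del: of_nat_Suc)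
  have i: "integrable lborel (\<lambda>s. g k * indicator {real k * T / Suc m<..real (Suc k) * T / Suc m} s)" for k
    by (intro integrable_mult_right integrable_real_indicator) (auto simp: em simp del: of_nat_Suc)
  have "(\<integral>s. g k * indicator {real k * T / Suc m<..real (Suc k) * T / Suc m} s \<partial>lborel) = T / Suc m * g k" for k
    using m[of k] by (simp del: of_nat_Suc)
  then show ?thesis
    by (subst Bochner_Integration.integral_sum[OF i]) (simp only: sum_distrib_left)
qed

text \<open>Left Riemann sums are integrals of step functions, to which dominated convergence
  applies, with a bound of \<open>f\<close> on \<open>{0..T}\<close> as majorant.\<close>

lemma riemann_sum_tendsto:
  fixes f :: "real \<Rightarrow> real"
  assumes T: "0 < T" and f: "continuous_on {0..T} f"
  shows "(\<lambda>m. T / Suc m * (\<Sum>k<Suc m. f (real k * T / Suc m))) \<longlonglongrightarrow> (\<integral>s\<in>{0..T}. f s \<partial>lborel)"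
proof -
  have "bounded (f ` {0..T})" using compact_continuous_image[OF f] compact_imp_bounded by auto
  then obtain B where "\<forall>y\<in>f ` {0..T}. norm y \<le> B" unfolding bounded_iff by blast
  then have B0: "\<And>s. s \<in> {0..T} \<Longrightarrow> \<bar>f s\<bar> \<le> B" by auto
  have B: "0 \<le> B" using B0[of 0] T by auto
  have le: "real k * T / Suc m \<in> {0..T}" if "k < Suc m" for k m
  proof -
    have "real k * T \<le> T * Suc m" using that T by (subst mult.commute, intro mult_left_mono) auto
    then show ?thesis using T by (simp add: pos_divide_le_eq del: of_nat_Suc)
  qed
  have meas: "(\<lambda>s. indicator {0..T} s *\<^sub>R f s) \<in> borel_measurable lborel"
    using borel_measurable_continuous_on_indicator[OF _ f] by simp
  have "(\<lambda>m. \<integral>s. (\<Sum>k<Suc m. f (real k * T / Suc m) * indicator {real k * T / Suc m<..real (Suc k) * T / Suc m} s) \<partial>lborel)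
      \<longlonglongrightarrow> (\<integral>s. indicator {0..T} s *\<^sub>R f s \<partial>lborel)"
  proof (rule integral_dominated_convergence[where w="\<lambda>s. B * indicator {0..T} s"])
    show "AE s in lborel. (\<lambda>m. \<Sum>k<Suc m. f (real k * T / Suc m) * indicator {real k * T / Suc m<..real (Suc k) * T / Suc m} s) \<longlonglongrightarrow> indicator {0..T} s *\<^sub>R f s"
    proof -
      \<comment> \<open>The point 0 lies in no cell, so convergence may fail there.\<close>
      have "AE s in lborel. s \<noteq> (0::real)" by (rule AE_lborel_singleton)
      then show ?thesis
      proof eventually_elim
        case (elim s)
        show ?case
        proof (cases "0 < s \<and> s \<le> T")
          case True then show ?thesis using grid_step_tendsto[OF _ _ f, of s] by simp
        next
          case False
          have "\<bar>\<Sum>k<Suc m. f (real k * T / Suc m) * indicator {real k * T / Suc m<..real (Suc k) * T / Suc m} s\<bar> \<le> B * indicator {0..T} s" for m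
            by (rule grid_step_abs_le) (use B0 B T le in auto)
          then show ?thesis using False elim by (auto simp del: of_nat_Suc sum.lessThan_Suc)
        qed
      qed
    qed
    show "AE s in lborel. norm (\<Sum>k<Suc m. f (real k * T / Suc m) * indicator {real k * T / Suc m<..real (Suc k) * T / Suc m} s) \<le> B * indicator {0..T} s" for m
      unfolding real_norm_def by (intro AE_I2 grid_step_abs_le) (use B0 B T le in auto)
    show "(\<lambda>s. \<Sum>k<Suc m. f (real k * T / Suc m) * indicator {real k * T / Suc m<..real (Suc k) * T / Suc m} s) \<in> borel_measurable lborel" for m
      by measurable
    show "integrable lborel (\<lambda>s. B * indicator {0..T} s)" by (simp add: emeasure_lborel_Icc_eq)
  qed (rule meas)
  then show ?thesis by (simp only: integral_grid_step[OF T] set_lebesgue_integral_def)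
qed

section \<open>Independence of Brownian increments from the past\<close>

lemma space_generated_algebra [simp]: "space (generated_algebra M X I) = space M"
  by (simp add: generated_algebra_def)

lemma generated_algebra_component:
  assumes "s \<in> I"
  shows "X s \<in> borel_measurable (generated_algebra M X I)"
proof -
  have "(\<lambda>\<omega>. \<lambda>s\<in>I. X s \<omega>) \<in> measurable (generated_algebra M X I) (PiM I (\<lambda>_. borel))"
    unfolding generated_algebra_def by (rule measurable_vimage_algebra1) (auto simp: space_PiM)
  from measurable_compose[OF this measurable_component_singleton[OF assms]]
  show ?thesis using assms by simp
qed

lemma generated_algebra_least:
  assumes "space N = space M" "\<And>s. s \<in> I \<Longrightarrow> X s \<in> borel_measurable N"
  shows "sets (generated_algebra M X I) \<subseteq> sets N"
  unfolding generated_algebra_def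
proof (rule sets_image_in_sets)
  show "(\<lambda>\<omega>. \<lambda>s\<in>I. X s \<omega>) \<in> measurable N (PiM I (\<lambda>_. borel))"
    using assms(2) by (rule measurable_restrict)
qed (use assms in simp)

lemma generated_algebra_mono:
  "I \<subseteq> J \<Longrightarrow> sets (generated_algebra M X I) \<subseteq> sets (generated_algebra M X J)"
  by (rule generated_algebra_least) (auto intro: generated_algebra_component)

lemma measurable_sub_sets:
  assumes "f \<in> measurable N K" "space N = space N'" "sets N \<subseteq> sets N'"
  shows "f \<in> measurable N' K"
  using assms by (auto simp: measurable_def)

text \<open>Exhibits the cylinder sets as generator; they are stable under intersection, as
  independence arguments require.\<close>

lemma sets_generated_algebra:
  "sets (generated_algebra M X I)
   = sigma_sets (space M) {(\<lambda>\<omega>. \<lambda>s\<in>I. X s \<omega>) -` A \<inter> space M | A. A \<in> prod_algebra I (\<lambda>_. borel)}"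
proof -
  have "sets (generated_algebra M X I)
    = sets (vimage_algebra (space M) (\<lambda>\<omega>. \<lambda>s\<in>I. X s \<omega>) (sigma (\<Pi>\<^sub>E i\<in>I. space borel) (prod_algebra I (\<lambda>_. borel))))"
    unfolding generated_algebra_def
    by (rule sets_vimage_algebra_cong) (simp only: sets_PiM sets_measure_of[OF prod_algebra_sets_into_space])
  also have "\<dots> = sets (sigma (space M) {(\<lambda>\<omega>. \<lambda>s\<in>I. X s \<omega>) -` A \<inter> space M | A. A \<in> prod_algebra I (\<lambda>_. borel)})"
    by (subst vimage_algebra_sigma) (use prod_algebra_sets_into_space[of I "\<lambda>_. borel"] in auto)
  also have "\<dots> = sigma_sets (space M) {(\<lambda>\<omega>. \<lambda>s\<in>I. X s \<omega>) -` A \<inter> space M | A. A \<in> prod_algebra I (\<lambda>_. borel)}"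
    by (rule sets_measure_of) auto
  finally show ?thesis .
qed

lemma brownian_motionD:
  assumes "brownian_motion M B"
  shows "prob_space M" "\<And>t. 0 \<le> t \<Longrightarrow> B t \<in> borel_measurable M" "\<And>\<omega>. \<omega> \<in> space M \<Longrightarrow> B 0 \<omega> = 0"
    "\<And>\<omega>. \<omega> \<in> space M \<Longrightarrow> continuous_on {0..} (\<lambda>t. B t \<omega>)"
    "\<And>s t. 0 \<le> s \<Longrightarrow> s < t \<Longrightarrow> distributed M lborel (\<lambda>\<omega>. B t \<omega> - B s \<omega>) (\<lambda>z. ennreal (gauss_kernel (t - s) z))"
    "\<And>n (\<tau>::nat \<Rightarrow> real). 0 \<le> \<tau> 0 \<Longrightarrow> (\<And>i. i < n \<Longrightarrow> \<tau> i \<le> \<tau> (Suc i)) \<Longrightarrow>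
        prob_space.indep_vars M (\<lambda>_. borel) (\<lambda>i \<omega>. B (\<tau> (Suc i)) \<omega> - B (\<tau> i) \<omega>) {..<n}"
  using assms unfolding brownian_motion_def by blast+

text \<open>Independence of increments is given along increasing times only. The past times are
  therefore sorted together with 0 and \<open>c\<close>, and \<open>d\<close> is appended: past
  values become partial sums of the first \<open>n\<close> increments, and the increment from
  \<open>c\<close> to \<open>d\<close> is the last one.\<close>

lemma brownian_past_indep_finite:
  fixes B :: "real \<Rightarrow> 'w \<Rightarrow> 'a::euclidean_space"
  assumes bm: "brownian_motion M B" and c: "0 \<le> c" "c \<le> d" and J: "finite J" "J \<subseteq> {0..c}"
    and E: "\<And>j. j \<in> J \<Longrightarrow> E j \<in> sets borel" and S: "S \<in> sets borel"
  shows "measure M ((\<lambda>\<omega>. \<lambda>j\<in>J. B j \<omega> - B 0 \<omega>) -` (Pi\<^sub>E J E) \<inter> space M \<inter> ((\<lambda>\<omega>. B d \<omega> - B c \<omega>) -` S \<inter> space M))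
    = measure M ((\<lambda>\<omega>. \<lambda>j\<in>J. B j \<omega> - B 0 \<omega>) -` (Pi\<^sub>E J E) \<inter> space M) * measure M ((\<lambda>\<omega>. B d \<omega> - B c \<omega>) -` S \<inter> space M)"
proof -
  interpret prob_space M using bm by (rule brownian_motionD)
  define K where "K = insert 0 (insert c J)"
  define xs where "xs = sorted_list_of_set K"
  have finK: "finite K" using J by (simp add: K_def)
  have xs: "set xs = K" "sorted xs" using finK by (auto simp: xs_def)
  have len: "0 < length xs" using xs(1) by (auto simp: K_def)
  define n where "n = length xs - 1"
  have n: "length xs = Suc n" using len by (simp add: n_def)
  define \<tau> where "\<tau> i = (if i < length xs then xs ! i else d)" for i
  have K: "K \<subseteq> {0..c}" using J c by (auto simp: K_def)
  have xin: "xs ! i \<in> {0..c}" if "i < length xs" for i using nth_mem[OF that] xs K by auto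
  have idx: "\<exists>i\<le>n. \<tau> i = k" if "k \<in> K" for k
    using that unfolding xs(1)[symmetric] in_set_conv_nth \<tau>_def n by auto
  have tau0: "\<tau> 0 = 0"
  proof -
    obtain i where i: "i \<le> n" "\<tau> i = 0" using idx[of 0] by (auto simp: K_def)
    then have "xs ! i = 0" using n by (auto simp: \<tau>_def split: if_splits)
    then have "xs ! 0 \<le> 0" using sorted_nth_mono[OF xs(2), of 0 i] i n by simp
    then show ?thesis using xin[OF len] len by (simp add: \<tau>_def)
  qed
  have taun: "\<tau> n = c"
  proof -
    obtain i where i: "i \<le> n" "\<tau> i = c" using idx[of c] by (auto simp: K_def)
    then have "xs ! i = c" using n by (auto simp: \<tau>_def split: if_splits)
    then have "c \<le> xs ! n" using sorted_nth_mono[OF xs(2), of i n] i n by simp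
    then show ?thesis using xin[of n] n by (simp add: \<tau>_def)
  qed
  have tauS: "\<tau> (Suc n) = d" using n by (simp add: \<tau>_def)
  have mono: "\<tau> i \<le> \<tau> (Suc i)" if "i < Suc n" for i
  proof (cases "i = n")
    case True then show ?thesis using taun tauS c by simp
  next
    case False then show ?thesis using sorted_nth_mono[OF xs(2), of i "Suc i"] that n by (simp add: \<tau>_def)
  qed
  define D where "D i \<omega> = B (\<tau> (Suc i)) \<omega> - B (\<tau> i) \<omega>" for i \<omega>
  have "indep_vars (\<lambda>_. borel) D {..<Suc n}"
    unfolding D_def by (rule brownian_motionD(6)[OF bm]) (use tau0 mono in auto)
  then have ind: "indep_var (PiM {..<n} (\<lambda>_. borel)) (\<lambda>\<omega>. restrict (\<lambda>i. D i \<omega>) {..<n}) (PiM {n} (\<lambda>_. borel)) (\<lambda>\<omega>. restrict (\<lambda>i. D i \<omega>) {n})"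
    by (rule indep_var_restrict) auto
  obtain ix where ix: "\<And>j. j \<in> K \<Longrightarrow> ix j \<le> n \<and> \<tau> (ix j) = j" using idx by metis
  \<comment> \<open>Recovers the past values, relative to time 0, from the increments;
    \<open>ix j\<close> is the position of \<open>j\<close> in the sorted list.\<close>
  define Y1 where "Y1 = (\<lambda>f::nat \<Rightarrow> 'a. \<lambda>j\<in>J. \<Sum>i<ix j. f i)"
  have Y1: "Y1 \<in> PiM {..<n} (\<lambda>_. borel) \<rightarrow>\<^sub>M PiM J (\<lambda>_. borel)"
    unfolding Y1_def
  proof (rule measurable_restrict)
    fix j assume "j \<in> J"
    then have "ix j \<le> n" using ix by (auto simp: K_def)
    then show "(\<lambda>f. \<Sum>i<ix j. f i) \<in> borel_measurable (PiM {..<n} (\<lambda>_. borel :: 'a measure))"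
      by (intro borel_measurable_sum measurable_component_singleton) auto
  qed
  have Y2: "(\<lambda>f::nat \<Rightarrow> 'a. f n) \<in> PiM {n} (\<lambda>_. borel) \<rightarrow>\<^sub>M borel"
    by (rule measurable_component_singleton) simp
  have PE: "Pi\<^sub>E J E \<in> sets (PiM J (\<lambda>_. borel))" using J E by (intro sets_PiM_I_finite) auto
  have c1: "Y1 \<circ> (\<lambda>\<omega>. restrict (\<lambda>i. D i \<omega>) {..<n}) = (\<lambda>\<omega>. \<lambda>j\<in>J. B j \<omega> - B 0 \<omega>)"
  proof (intro ext)
    fix \<omega> j
    show "(Y1 \<circ> (\<lambda>\<omega>. restrict (\<lambda>i. D i \<omega>) {..<n})) \<omega> j = (\<lambda>j\<in>J. B j \<omega> - B 0 \<omega>) j"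
    proof (cases "j \<in> J")
      case True
      then have i: "ix j \<le> n" "\<tau> (ix j) = j" using ix by (auto simp: K_def)
      have "(\<Sum>i<ix j. restrict (\<lambda>i. D i \<omega>) {..<n} i) = (\<Sum>i<ix j. D i \<omega>)"
        using i by (intro sum.cong) auto
      also have "\<dots> = B j \<omega> - B 0 \<omega>" unfolding D_def using i tau0 sum_lessThan_telescope[of "\<lambda>i. B (\<tau> i) \<omega>" "ix j"] by simp
      finally show ?thesis using True by (simp add: Y1_def)
    qed (simp add: Y1_def)
  qed
  have c2: "(\<lambda>f. f n) \<circ> (\<lambda>\<omega>. restrict (\<lambda>i. D i \<omega>) {n}) = (\<lambda>\<omega>. B d \<omega> - B c \<omega>)"
    by (auto simp: D_def taun tauS)
  let ?R1 = "\<lambda>\<omega>. restrict (\<lambda>i. D i \<omega>) {..<n}" and ?R2 = "\<lambda>\<omega>. restrict (\<lambda>i. D i \<omega>) {n}"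
  define P1 where "P1 = Y1 -` Pi\<^sub>E J E \<inter> space (PiM {..<n} (\<lambda>_. borel))"
  define P2 where "P2 = (\<lambda>f::nat \<Rightarrow> 'a. f n) -` S \<inter> space (PiM {n} (\<lambda>_. borel))"
  have e1: "?R1 -` P1 \<inter> space M = (\<lambda>\<omega>. \<lambda>j\<in>J. B j \<omega> - B 0 \<omega>) -` (Pi\<^sub>E J E) \<inter> space M"
    unfolding c1[symmetric] P1_def by (auto simp: space_PiM)
  have e2: "?R2 -` P2 \<inter> space M = (\<lambda>\<omega>. B d \<omega> - B c \<omega>) -` S \<inter> space M"
    unfolding c2[symmetric] P2_def by (auto simp: space_PiM)
  have "prob ((\<lambda>x. (?R1 x, ?R2 x)) -` (P1 \<times> P2) \<inter> space M) = prob (?R1 -` P1 \<inter> space M) * prob (?R2 -` P2 \<inter> space M)"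
    by (rule indep_varD[OF ind]) (use measurable_sets[OF Y1 PE] measurable_sets[OF Y2 S] in \<open>auto simp: P1_def P2_def\<close>)
  moreover have "(\<lambda>x. (?R1 x, ?R2 x)) -` (P1 \<times> P2) \<inter> space M = ?R1 -` P1 \<inter> space M \<inter> (?R2 -` P2 \<inter> space M)" by auto
  ultimately show ?thesis unfolding e1 e2 by simp
qed

text \<open>Cylinder sets form an intersection-stable generator of the past, so the
  finite-dimensional case carries over to the sigma-algebra.\<close>

lemma brownian_past_indep:
  fixes B :: "real \<Rightarrow> 'w \<Rightarrow> 'a::euclidean_space"
  assumes bm: "brownian_motion M B" and c: "0 \<le> c" "c \<le> d"
  shows "prob_space.indep_set M (sets (generated_algebra M B {0..c}))
    {(\<lambda>\<omega>. B d \<omega> - B c \<omega>) -` S \<inter> space M | S. S \<in> sets borel}" (is "prob_space.indep_set M _ ?D")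
proof -
  interpret prob_space M using bm by (rule brownian_motionD)
  note [measurable] = brownian_motionD(2)[OF bm]
  let ?E = "{(\<lambda>\<omega>. \<lambda>s\<in>{0..c}. B s \<omega>) -` A \<inter> space M | A. A \<in> prod_algebra {0..c} (\<lambda>_. borel)}"
  have dm: "(\<lambda>\<omega>. B d \<omega> - B c \<omega>) \<in> borel_measurable M"
    using c by (intro borel_measurable_diff brownian_motionD(2)[OF bm]) auto
  have Dv: "?D = sets (vimage_algebra (space M) (\<lambda>\<omega>. B d \<omega> - B c \<omega>) borel)"
    by (subst sets_vimage_algebra2) auto
  have Eev: "?E \<subseteq> events"
  proof -
    have "sets (generated_algebra M B {0..c}) \<subseteq> events"
      by (rule generated_algebra_least) (auto intro: brownian_motionD(2)[OF bm])
    then show ?thesis unfolding sets_generated_algebra by (meson order_trans sigma_sets_superset_generator)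
  qed
  have "indep_set (sigma_sets (space M) ?E) (sigma_sets (space M) ?D)"
  proof (rule indep_set_sigma_sets)
    show "indep_set ?E ?D"
      unfolding indep_sets2_eq
    proof (intro conjI ballI)
      show "?E \<subseteq> events" by (rule Eev)
      show "?D \<subseteq> events" using measurable_sets[OF dm] by auto
      fix a e assume "a \<in> ?E" "e \<in> ?D"
      then obtain A S where A: "A \<in> prod_algebra {0..c} (\<lambda>_. borel :: 'a measure)" and a: "a = (\<lambda>\<omega>. \<lambda>s\<in>{0..c}. B s \<omega>) -` A \<inter> space M"
        and S: "S \<in> sets borel" and e: "e = (\<lambda>\<omega>. B d \<omega> - B c \<omega>) -` S \<inter> space M" by auto
      from prod_algebraE[OF A] obtain J E where J: "A = prod_emb {0..c} (\<lambda>_. borel) J (Pi\<^sub>E J E)" "finite J" "J \<subseteq> {0..c}" "\<And>i. i \<in> J \<Longrightarrow> E i \<in> sets borel"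
        by metis
      \<comment> \<open>\<open>B 0\<close> is 0 on all of \<open>space M\<close>, so values and
        increments from time 0 define the same cylinder set.\<close>
      have a': "a = (\<lambda>\<omega>. \<lambda>j\<in>J. B j \<omega> - B 0 \<omega>) -` (Pi\<^sub>E J E) \<inter> space M"
        unfolding a J(1) using J(3) brownian_motionD(3)[OF bm]
        by (auto simp: prod_emb_def PiE_iff subset_eq restrict_def extensional_def space_PiM)
      show "prob (a \<inter> e) = prob a * prob e"
        unfolding a' e by (rule brownian_past_indep_finite[OF bm c J(2,3,4) S])
    qed
    show "Int_stable ?E"
    proof (rule Int_stableI)
      fix a a' assume "a \<in> ?E" "a' \<in> ?E"
      then obtain A A' where "A \<in> prod_algebra {0..c} (\<lambda>_. borel)" "A' \<in> prod_algebra {0..c} (\<lambda>_. borel)"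
        "a = (\<lambda>\<omega>. \<lambda>s\<in>{0..c}. B s \<omega>) -` A \<inter> space M" "a' = (\<lambda>\<omega>. \<lambda>s\<in>{0..c}. B s \<omega>) -` A' \<inter> space M" by auto
      then show "a \<inter> a' \<in> ?E" using Int_stable_prod_algebra[of "{0..c}" "\<lambda>_. borel"]
        by (auto simp: Int_stable_def intro!: exI[of _ "A \<inter> A'"])
    qed
    show "Int_stable ?D" unfolding Dv by (auto simp: Int_stable_def)
  qed
  then show ?thesis
    unfolding sets_generated_algebra[symmetric] Dv
    using sets.sigma_sets_eq[of "vimage_algebra (space M) (\<lambda>\<omega>. B d \<omega> - B c \<omega>) borel"] by simp
qed

lemma (in prob_space) indep_set_mono:
  "indep_set A B \<Longrightarrow> A' \<subseteq> A \<Longrightarrow> B' \<subseteq> B \<Longrightarrow> indep_set A' B'"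
  unfolding indep_sets2_eq by blast

section \<open>Increments of one motion against the joint past of two independent motions\<close>

locale brownian_pair = prob_space M for M :: "'w measure" +
  fixes b :: "real \<Rightarrow> 'w \<Rightarrow> 'a::euclidean_space" and b' :: "real \<Rightarrow> 'w \<Rightarrow> 'b::euclidean_space"
  assumes bm: "brownian_motion M b" and bm': "brownian_motion M b'"
    and indep: "indep_processes M b b'"
begin

abbreviation "filt \<equiv> natural_filtration M (\<lambda>s \<omega>. (b s \<omega>, b' s \<omega>))"

lemma b_measurable [measurable]: "0 \<le> t \<Longrightarrow> b t \<in> borel_measurable M"
  and b'_measurable [measurable]: "0 \<le> t \<Longrightarrow> b' t \<in> borel_measurable M"
  by (rule brownian_motionD(2)[OF bm] brownian_motionD(2)[OF bm'], assumption)+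

lemma space_filt [simp]: "space (filt t) = space M"
  by (simp add: natural_filtration_def)

lemma filt_mono: "s \<le> t \<Longrightarrow> sets (filt s) \<subseteq> sets (filt t)"
  unfolding natural_filtration_def by (rule generated_algebra_mono) auto

lemma sets_filt: "sets (filt t) \<subseteq> events"
  unfolding natural_filtration_def by (rule generated_algebra_least) auto

lemma filt_measurable: "Y \<in> measurable (filt t) N \<Longrightarrow> Y \<in> measurable M N"
  by (rule measurable_sub_sets[OF _ _ sets_filt]) auto

lemma filt_measurable_mono: "Y \<in> measurable (filt s) N \<Longrightarrow> s \<le> t \<Longrightarrow> Y \<in> measurable (filt t) N"
  by (rule measurable_sub_sets[OF _ _ filt_mono]) auto

lemma
  assumes "0 \<le> s" "s \<le> t"
  shows b_filt: "b s \<in> borel_measurable (filt t)" and b'_filt: "b' s \<in> borel_measurable (filt t)"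
proof -
  have "(\<lambda>\<omega>. (b s \<omega>, b' s \<omega>)) \<in> borel_measurable (filt t)"
    using generated_algebra_component[of s "{0..t}" "\<lambda>s \<omega>. (b s \<omega>, b' s \<omega>)" M] assms
    by (simp add: natural_filtration_def)
  then have *: "(\<lambda>\<omega>. (b s \<omega>, b' s \<omega>)) \<in> measurable (filt t) (borel \<Otimes>\<^sub>M borel)" by (simp add: borel_prod)
  show "b s \<in> borel_measurable (filt t)" using measurable_compose[OF * measurable_fst] by simp
  show "b' s \<in> borel_measurable (filt t)" using measurable_compose[OF * measurable_snd] by simp
qed

lemma filt_indep_increment_sets:
  assumes c: "0 \<le> c" "c \<le> d"
  shows "indep_set (sets (filt c)) {(\<lambda>\<omega>. b' d \<omega> - b' c \<omega>) -` S \<inter> space M | S. S \<in> sets borel}" (is "indep_set _ ?D")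
proof -
  let ?G = "{U \<inter> U' | U U'. U \<in> sets (generated_algebra M b {0..}) \<and> U' \<in> sets (generated_algebra M b' {0..c})}"
  have gb: "sets (generated_algebra M b {0..}) \<subseteq> events" by (rule generated_algebra_least) auto
  have gb': "sets (generated_algebra M b' {0..}) \<subseteq> events" by (rule generated_algebra_least) auto
  have gc: "sets (generated_algebra M b' {0..c}) \<subseteq> sets (generated_algebra M b' {0..})" by (rule generated_algebra_mono) auto
  have dm: "(\<lambda>\<omega>. b' d \<omega> - b' c \<omega>) \<in> borel_measurable M"
    using c by (intro borel_measurable_diff b'_measurable) auto
  have dm': "(\<lambda>\<omega>. b' d \<omega> - b' c \<omega>) \<in> borel_measurable (generated_algebra M b' {0..})"
    using c by (intro borel_measurable_diff generated_algebra_component) auto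
  have Dv: "?D = sets (vimage_algebra (space M) (\<lambda>\<omega>. b' d \<omega> - b' c \<omega>) borel)"
    by (subst sets_vimage_algebra2) auto
  have Dg: "?D \<subseteq> sets (generated_algebra M b' {0..})"
    using measurable_sets[OF dm'] by auto
  have bb: "prob (U \<inter> V) = prob U * prob V" if "U \<in> sets (generated_algebra M b {0..})" "V \<in> sets (generated_algebra M b' {0..})" for U V
    using indep that unfolding indep_processes_def indep_sets2_eq by blast
  have bc: "prob (U \<inter> V) = prob U * prob V" if "U \<in> sets (generated_algebra M b' {0..c})" "V \<in> ?D" for U V
    using brownian_past_indep[OF bm' c] that unfolding indep_sets2_eq by blast
  have "indep_set (sigma_sets (space M) ?G) (sigma_sets (space M) ?D)"
  proof (rule indep_set_sigma_sets)
    show "indep_set ?G ?D"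
      unfolding indep_sets2_eq
    proof (intro conjI ballI)
      show "?G \<subseteq> events" using gb gb' gc by blast
      show "?D \<subseteq> events" using measurable_sets[OF dm] by auto
      fix g e assume "g \<in> ?G" and e: "e \<in> ?D"
      then obtain U U' where U: "U \<in> sets (generated_algebra M b {0..})" and U': "U' \<in> sets (generated_algebra M b' {0..c})" and g: "g = U \<inter> U'" by auto
      have U'': "U' \<in> sets (generated_algebra M b' {0..})" using U' gc by blast
      have e': "e \<in> sets (generated_algebra M b' {0..})" using e Dg by blast
      have "prob (g \<inter> e) = prob (U \<inter> (U' \<inter> e))" by (simp add: g Int_assoc)
      also have "\<dots> = prob U * prob (U' \<inter> e)" by (rule bb[OF U sets.Int[OF U'' e']])
      also have "\<dots> = prob U * prob U' * prob e" using bc[OF U' e] by simp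
      also have "\<dots> = prob g * prob e" using bb[OF U U''] by (simp add: g)
      finally show "prob (g \<inter> e) = prob g * prob e" .
    qed
    show "Int_stable ?G"
    proof (rule Int_stableI)
      fix g h assume "g \<in> ?G" "h \<in> ?G"
      then obtain U U' V V' where "U \<in> sets (generated_algebra M b {0..})" "U' \<in> sets (generated_algebra M b' {0..c})" "g = U \<inter> U'"
        "V \<in> sets (generated_algebra M b {0..})" "V' \<in> sets (generated_algebra M b' {0..c})" "h = V \<inter> V'" by auto
      then show "g \<inter> h \<in> ?G"
        by (intro CollectI exI[of _ "U \<inter> V"] exI[of _ "U' \<inter> V'"]) auto
    qed
    show "Int_stable ?D" unfolding Dv by (auto simp: Int_stable_def)
  qed
  \<comment> \<open>Events of either motion alone belong to \<open>?G\<close>, with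
    \<open>space M\<close> as the other factor, so both motions up to time \<open>c\<close> are
    measurable for the sigma-algebra that it generates.\<close>
  moreover have "sets (filt c) \<subseteq> sigma_sets (space M) ?G"
  proof -
    have Gp: "?G \<subseteq> Pow (space M)" using gb gb' gc sets.sets_into_space by blast
    have s: "sets (sigma (space M) ?G) = sigma_sets (space M) ?G" by (rule sets_measure_of[OF Gp])
    have top: "space M \<in> sets (generated_algebra M b {0..})" "space M \<in> sets (generated_algebra M b' {0..c})"
      using sets.top[of "generated_algebra M b {0..}"] sets.top[of "generated_algebra M b' {0..c}"] by auto
    have 1: "sets (generated_algebra M b {0..}) \<subseteq> sigma_sets (space M) ?G"
    proof
      fix U assume U: "U \<in> sets (generated_algebra M b {0..})"
      then have "U = U \<inter> space M" using sets.sets_into_space by fastforce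
      then have "U \<in> ?G" using U top by blast
      then show "U \<in> sigma_sets (space M) ?G" by (rule sigma_sets.Basic)
    qed
    have 2: "sets (generated_algebra M b' {0..c}) \<subseteq> sigma_sets (space M) ?G"
    proof
      fix U assume U: "U \<in> sets (generated_algebra M b' {0..c})"
      then have "U = space M \<inter> U" using sets.sets_into_space by fastforce
      then have "U \<in> ?G" using U top by blast
      then show "U \<in> sigma_sets (space M) ?G" by (rule sigma_sets.Basic)
    qed
    have sp: "space (sigma (space M) ?G) = space M" by (rule space_measure_of[OF Gp])
    have "sets (filt c) \<subseteq> sets (sigma (space M) ?G)"
      unfolding natural_filtration_def
    proof (rule generated_algebra_least[OF sp])
      fix s assume "s \<in> {0..c}"
      then have "b s \<in> borel_measurable (generated_algebra M b {0..})" "b' s \<in> borel_measurable (generated_algebra M b' {0..c})"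
        by (auto intro!: generated_algebra_component)
      then have "b s \<in> borel_measurable (sigma (space M) ?G)" "b' s \<in> borel_measurable (sigma (space M) ?G)"
        using 1 2 sp s by (auto elim!: measurable_sub_sets)
      then show "(\<lambda>\<omega>. (b s \<omega>, b' s \<omega>)) \<in> borel_measurable (sigma (space M) ?G)"
        by (rule borel_measurable_Pair)
    qed
    then show ?thesis unfolding s .
  qed
  ultimately show ?thesis
    by (rule indep_set_mono) (rule sigma_sets_superset_generator)
qed

lemma filt_indep_increment:
  fixes Y :: "'w \<Rightarrow> real" and g :: "'b \<Rightarrow> real"
  assumes c: "0 \<le> c" "c \<le> d" and Y: "Y \<in> borel_measurable (filt c)" and g: "g \<in> borel_measurable borel"
  shows "indep_var borel Y borel (\<lambda>\<omega>. g (b' d \<omega> - b' c \<omega>))"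
proof -
  have dm: "(\<lambda>\<omega>. b' d \<omega> - b' c \<omega>) \<in> borel_measurable M"
    using c by (intro borel_measurable_diff b'_measurable) auto
  have YM: "Y \<in> borel_measurable M" by (rule filt_measurable[OF Y])
  have gm: "(\<lambda>\<omega>. g (b' d \<omega> - b' c \<omega>)) \<in> borel_measurable M" using measurable_compose[OF dm g] .
  show ?thesis
    unfolding indep_var_eq
  proof (intro conjI YM gm)
    let ?D = "{(\<lambda>\<omega>. g (b' d \<omega> - b' c \<omega>)) -` S \<inter> space M | S. S \<in> sets borel}"
    have "?D \<subseteq> {(\<lambda>\<omega>. b' d \<omega> - b' c \<omega>) -` S \<inter> space M | S. S \<in> sets borel}"
    proof
      fix e assume "e \<in> ?D"
      then obtain S where S: "S \<in> sets borel" "e = (\<lambda>\<omega>. g (b' d \<omega> - b' c \<omega>)) -` S \<inter> space M" by blast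
      have "g -` S \<in> sets borel" using measurable_sets[OF g S(1)] by simp
      moreover have "e = (\<lambda>\<omega>. b' d \<omega> - b' c \<omega>) -` (g -` S) \<inter> space M" using S(2) by auto
      ultimately show "e \<in> {(\<lambda>\<omega>. b' d \<omega> - b' c \<omega>) -` S \<inter> space M | S. S \<in> sets borel}" by blast
    qed
    moreover
    have "{Y -` A \<inter> space M | A. A \<in> sets borel} \<subseteq> sets (filt c)"
      using measurable_sets[OF Y] by auto
    ultimately have "indep_set {Y -` A \<inter> space M | A. A \<in> sets borel} ?D"
      by (intro indep_set_mono[OF filt_indep_increment_sets[OF c]])
    moreover have "{Y -` A \<inter> space M | A. A \<in> sets borel} = sets (vimage_algebra (space M) Y borel)"
       "?D = sets (vimage_algebra (space M) (\<lambda>\<omega>. g (b' d \<omega> - b' c \<omega>)) borel)"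
      by (subst sets_vimage_algebra2; auto)+
    ultimately show "indep_set (sigma_sets (space M) {Y -` A \<inter> space M |A. A \<in> sets borel}) (sigma_sets (space M) ?D)"
      by (intro indep_set_sigma_sets) (auto simp: Int_stable_def)
  qed
qed

end

section \<open>The Ito isometry\<close>

lemma distributed_gauss:
  fixes X :: "'w \<Rightarrow> 'a::euclidean_space"
  assumes D: "distributed M lborel X (\<lambda>z. ennreal (gauss_kernel v z))"
    and [measurable]: "h \<in> borel_measurable borel"
  shows "(\<integral>\<omega>. h (X \<omega>) \<partial>M) = (\<integral>z. (h z :: 'c::{banach,second_countable_topology}) \<partial>gauss_measure v)"
    and "integrable M (\<lambda>\<omega>. h (X \<omega>)) \<longleftrightarrow> integrable (gauss_measure v) h"
proof -
  have [measurable]: "X \<in> borel_measurable M" using distributed_measurable[OF D] by simp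
  have "distr M lborel X = gauss_measure v"
    using distributed_distr_eq_density[OF D] by (simp add: gauss_measure_def)
  then have e: "gauss_measure v = distr M lborel X" by simp
  show "(\<integral>\<omega>. h (X \<omega>) \<partial>M) = (\<integral>z. h z \<partial>gauss_measure v)" unfolding e by (subst integral_distr) auto
  show "integrable M (\<lambda>\<omega>. h (X \<omega>)) \<longleftrightarrow> integrable (gauss_measure v) h" unfolding e by (subst integrable_distr_eq) auto
qed

lemma brownian_increment_integral:
  fixes B :: "real \<Rightarrow> 'w \<Rightarrow> 'a::euclidean_space"
  assumes "brownian_motion M B" "0 \<le> s" "s < t" and "h \<in> borel_measurable borel"
  shows "(\<integral>\<omega>. h (B t \<omega> - B s \<omega>) \<partial>M) = (\<integral>z. (h z :: 'c::{banach,second_countable_topology}) \<partial>gauss_measure (t - s))"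
    and "integrable M (\<lambda>\<omega>. h (B t \<omega> - B s \<omega>)) \<longleftrightarrow> integrable (gauss_measure (t - s)) h"
  by (rule distributed_gauss[OF brownian_motionD(5)[OF assms(1-3)] assms(4)])+

lemma brownian_increment_moments:
  fixes B :: "real \<Rightarrow> 'w \<Rightarrow> 'a::euclidean_space"
  assumes B: "brownian_motion M B" and s: "0 \<le> s" "s \<le> t" and e: "e \<in> Basis"
  shows "integrable M (\<lambda>\<omega>. (B t \<omega> - B s \<omega>) \<bullet> e)" "(\<integral>\<omega>. (B t \<omega> - B s \<omega>) \<bullet> e \<partial>M) = 0"
    "integrable M (\<lambda>\<omega>. ((B t \<omega> - B s \<omega>) \<bullet> e)\<^sup>2)" "(\<integral>\<omega>. ((B t \<omega> - B s \<omega>) \<bullet> e)\<^sup>2 \<partial>M) = t - s"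
proof -
  have "integrable M (\<lambda>\<omega>. (B t \<omega> - B s \<omega>) \<bullet> e) \<and> (\<integral>\<omega>. (B t \<omega> - B s \<omega>) \<bullet> e \<partial>M) = 0 \<and>
    integrable M (\<lambda>\<omega>. ((B t \<omega> - B s \<omega>) \<bullet> e)\<^sup>2) \<and> (\<integral>\<omega>. ((B t \<omega> - B s \<omega>) \<bullet> e)\<^sup>2 \<partial>M) = t - s"
  proof (cases "s = t")
    case False
    then have "s < t" "0 < t - s" using s by auto
    then show ?thesis
      using brownian_increment_integral[OF B s(1) \<open>s < t\<close>, of "\<lambda>z. z \<bullet> e"] brownian_increment_integral[OF B s(1) \<open>s < t\<close>, of "\<lambda>z. (z \<bullet> e)\<^sup>2"]
        gauss_measure_moments[OF \<open>0 < t - s\<close> e] by simp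
  qed simp
  then show "integrable M (\<lambda>\<omega>. (B t \<omega> - B s \<omega>) \<bullet> e)" "(\<integral>\<omega>. (B t \<omega> - B s \<omega>) \<bullet> e \<partial>M) = 0"
    "integrable M (\<lambda>\<omega>. ((B t \<omega> - B s \<omega>) \<bullet> e)\<^sup>2)" "(\<integral>\<omega>. ((B t \<omega> - B s \<omega>) \<bullet> e)\<^sup>2 \<partial>M) = t - s" by auto
qed

lemma integrable_bounded_mult:
  fixes X :: "'w \<Rightarrow> real"
  assumes "integrable M X" "Y \<in> borel_measurable M" "\<And>\<omega>. \<omega> \<in> space M \<Longrightarrow> \<bar>Y \<omega>\<bar> \<le> C"
  shows "integrable M (\<lambda>\<omega>. Y \<omega> * X \<omega>)"
proof (rule Bochner_Integration.integrable_bound)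
  show "integrable M (\<lambda>\<omega>. C * X \<omega>)" using assms(1) by simp
  show "(\<lambda>\<omega>. Y \<omega> * X \<omega>) \<in> borel_measurable M" using assms(1,2) by measurable
  show "AE \<omega> in M. norm (Y \<omega> * X \<omega>) \<le> norm (C * X \<omega>)"
  proof (rule AE_I2)
    fix \<omega> assume "\<omega> \<in> space M"
    then have "\<bar>Y \<omega>\<bar> \<le> \<bar>C\<bar>" using assms(3) by fastforce
    then show "norm (Y \<omega> * X \<omega>) \<le> norm (C * X \<omega>)" by (simp add: abs_mult mult_right_mono)
  qed
qed

lemma
  fixes f :: "'i \<Rightarrow> 'j \<Rightarrow> 'w \<Rightarrow> real"
  assumes "\<And>i j. i \<in> I \<Longrightarrow> j \<in> J \<Longrightarrow> integrable N (f i j)"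
  shows integrable_double_sum: "integrable N (\<lambda>x. \<Sum>i\<in>I. \<Sum>j\<in>J. f i j x)"
    and integral_double_sum: "(\<integral>x. (\<Sum>i\<in>I. \<Sum>j\<in>J. f i j x) \<partial>N) = (\<Sum>i\<in>I. \<Sum>j\<in>J. integral\<^sup>L N (f i j))"
  using assms by (simp_all add: Bochner_Integration.integral_sum)

section \<open>Second moments of weighted increments\<close>

context brownian_pair
begin

definition incr :: "'b \<Rightarrow> real \<Rightarrow> real \<Rightarrow> 'w \<Rightarrow> real" where
  "incr e s t \<omega> = (b' t \<omega> - b' s \<omega>) \<bullet> e"

lemma incr_filt: "0 \<le> s \<Longrightarrow> s \<le> t \<Longrightarrow> t \<le> u \<Longrightarrow> incr e s t \<in> borel_measurable (filt u)"
  unfolding incr_def[abs_def] by (intro borel_measurable_inner borel_measurable_diff b'_filt) auto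

lemma incr_split: "incr e s u \<omega> = incr e s t \<omega> + incr e t u \<omega>"
  by (simp add: incr_def inner_diff_left)

text \<open>Takes the place of conditioning on time \<open>s\<close>: \<open>Y\<close> is known at
  \<open>s\<close>, hence independent of the increment, and the expectation factors.\<close>

lemma incr_mult_integral:
  assumes Y: "Y \<in> borel_measurable (filt s)" "integrable M Y" and s: "0 \<le> s" "s \<le> t" and e: "e \<in> Basis"
  shows "integrable M (\<lambda>\<omega>. Y \<omega> * incr e s t \<omega>)" "expectation (\<lambda>\<omega>. Y \<omega> * incr e s t \<omega>) = 0"
    "integrable M (\<lambda>\<omega>. Y \<omega> * (incr e s t \<omega>)\<^sup>2)" "expectation (\<lambda>\<omega>. Y \<omega> * (incr e s t \<omega>)\<^sup>2) = expectation Y * (t - s)"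
proof -
  note m = brownian_increment_moments[OF bm' s e, folded incr_def]
  have 1: "indep_var borel Y borel (incr e s t)"
    using filt_indep_increment[OF s Y(1), of "\<lambda>z. z \<bullet> e"] by (simp add: incr_def[abs_def])
  have 2: "indep_var borel Y borel (\<lambda>\<omega>. (incr e s t \<omega>)\<^sup>2)"
    using filt_indep_increment[OF s Y(1), of "\<lambda>z. (z \<bullet> e)\<^sup>2"] by (simp add: incr_def[abs_def])
  show "integrable M (\<lambda>\<omega>. Y \<omega> * incr e s t \<omega>)" by (rule indep_var_integrable[OF 1 Y(2) m(1)])
  show "expectation (\<lambda>\<omega>. Y \<omega> * incr e s t \<omega>) = 0" using indep_var_lebesgue_integral[OF 1 Y(2) m(1)] m(2) by simp
  show "integrable M (\<lambda>\<omega>. Y \<omega> * (incr e s t \<omega>)\<^sup>2)" by (rule indep_var_integrable[OF 2 Y(2) m(3)])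
  show "expectation (\<lambda>\<omega>. Y \<omega> * (incr e s t \<omega>)\<^sup>2) = expectation Y * (t - s)" using indep_var_lebesgue_integral[OF 2 Y(2) m(3)] m(4) by simp
qed

lemma bounded_filt_integrable:
  fixes Y :: "'w \<Rightarrow> real"
  assumes "Y \<in> borel_measurable (filt s)" "\<And>\<omega>. \<omega> \<in> space M \<Longrightarrow> \<bar>Y \<omega>\<bar> \<le> C"
  shows "integrable M Y"
  using filt_measurable[OF assms(1)] assms(2) by (intro integrable_const_bound[where B=C]) auto

lemma bounded_incr_integrable:
  assumes "Y \<in> borel_measurable (filt u)" "\<And>\<omega>. \<omega> \<in> space M \<Longrightarrow> \<bar>Y \<omega>\<bar> \<le> C" "0 \<le> s" "s \<le> t" "e \<in> Basis"
  shows "integrable M (\<lambda>\<omega>. Y \<omega> * incr e s t \<omega>)"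
  using brownian_increment_moments(1)[OF bm' assms(3-5)] filt_measurable[OF assms(1)] assms(2)
  by (intro integrable_bounded_mult) (auto simp: incr_def)

text \<open>The longer increment is split at \<open>t\<close>: its first piece produces a square,
  and its second piece has mean 0 against everything known at \<open>t\<close>.\<close>

lemma incr_nested:
  assumes Y: "Y \<in> borel_measurable (filt s)" "\<And>\<omega>. \<omega> \<in> space M \<Longrightarrow> \<bar>Y \<omega>\<bar> \<le> C"
    and s: "0 \<le> s" "s \<le> t" "t \<le> u" and e: "e \<in> Basis"
  shows "integrable M (\<lambda>\<omega>. Y \<omega> * (incr e s t \<omega> * incr e s u \<omega>))"
    "expectation (\<lambda>\<omega>. Y \<omega> * (incr e s t \<omega> * incr e s u \<omega>)) = expectation Y * (t - s)"
proof -
  have eq: "Y \<omega> * (incr e s t \<omega> * incr e s u \<omega>) = Y \<omega> * (incr e s t \<omega>)\<^sup>2 + Y \<omega> * incr e s t \<omega> * incr e t u \<omega>" for \<omega>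
    using incr_split[of e s u \<omega> t] by (simp add: algebra_simps power2_eq_square)
  note 1 = incr_mult_integral(3,4)[OF Y(1) bounded_filt_integrable[OF Y] s(1,2) e]
  have m: "(\<lambda>\<omega>. Y \<omega> * incr e s t \<omega>) \<in> borel_measurable (filt t)"
    by (intro borel_measurable_times filt_measurable_mono[OF Y(1) s(2)] incr_filt s) simp
  note 2 = incr_mult_integral(1,2)[OF m bounded_incr_integrable[OF Y s(1,2) e] _ s(3) e]
  show "integrable M (\<lambda>\<omega>. Y \<omega> * (incr e s t \<omega> * incr e s u \<omega>))"
    unfolding eq using 1 2 s by auto
  show "expectation (\<lambda>\<omega>. Y \<omega> * (incr e s t \<omega> * incr e s u \<omega>)) = expectation Y * (t - s)"
    unfolding eq using 1 2 s by (subst Bochner_Integration.integral_add) auto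
qed

lemma incr_pair_ordered:
  assumes \<xi>: "\<xi> \<in> borel_measurable (filt s)" "\<And>\<omega>. \<omega> \<in> space M \<Longrightarrow> \<bar>\<xi> \<omega>\<bar> \<le> C"
    and \<eta>: "\<eta> \<in> borel_measurable (filt u)" "\<And>\<omega>. \<omega> \<in> space M \<Longrightarrow> \<bar>\<eta> \<omega>\<bar> \<le> D"
    and s: "0 \<le> s" "s \<le> t" "s \<le> u" "u \<le> v" and e: "e \<in> Basis"
  shows "integrable M (\<lambda>\<omega>. (\<xi> \<omega> * incr e s t \<omega>) * (\<eta> \<omega> * incr e u v \<omega>)) \<and>
    expectation (\<lambda>\<omega>. (\<xi> \<omega> * incr e s t \<omega>) * (\<eta> \<omega> * incr e u v \<omega>))
      = expectation (\<lambda>\<omega>. \<xi> \<omega> * \<eta> \<omega>) * measure lborel ({s<..t} \<inter> {u<..v})"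
proof -
  define Y where "Y \<omega> = \<xi> \<omega> * \<eta> \<omega>" for \<omega>
  have Y: "Y \<in> borel_measurable (filt u)"
    unfolding Y_def[abs_def] by (intro borel_measurable_times \<eta> filt_measurable_mono[OF \<xi>(1)] s)
  have Yb: "\<bar>Y \<omega>\<bar> \<le> C * D" if "\<omega> \<in> space M" for \<omega>
    unfolding Y_def abs_mult using \<xi>(2)[OF that] \<eta>(2)[OF that] by (intro mult_mono) auto
  \<comment> \<open>The part of the first increment up to a time \<open>r \<le> u\<close> is known
    at \<open>u\<close>, so its product with the second increment has mean 0. Only the overlap of
    the intervals will contribute.\<close>
  have before: "integrable M (\<lambda>\<omega>. Y \<omega> * incr e s r \<omega> * incr e u v \<omega>)"
      "expectation (\<lambda>\<omega>. Y \<omega> * incr e s r \<omega> * incr e u v \<omega>) = 0" if r: "s \<le> r" "r \<le> u" for r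
  proof -
    have m: "(\<lambda>\<omega>. Y \<omega> * incr e s r \<omega>) \<in> borel_measurable (filt u)"
      by (intro borel_measurable_times Y incr_filt s r)
    show "integrable M (\<lambda>\<omega>. Y \<omega> * incr e s r \<omega> * incr e u v \<omega>)"
      "expectation (\<lambda>\<omega>. Y \<omega> * incr e s r \<omega> * incr e u v \<omega>) = 0"
      using incr_mult_integral(1,2)[OF m bounded_incr_integrable[OF Y Yb s(1) r(1) e] _ s(4) e] s by auto
  qed
  have eq0: "(\<xi> \<omega> * incr e s t \<omega>) * (\<eta> \<omega> * incr e u v \<omega>) = Y \<omega> * incr e s t \<omega> * incr e u v \<omega>" for \<omega>
    by (simp add: Y_def)
  show ?thesis
  proof (cases "t \<le> u")
    case True
    then have "{s<..t} \<inter> {u<..v} = {}" by auto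
    then have m0: "measure lborel ({s<..t} \<inter> {u<..v}) = 0" by (simp only: measure_empty)
    show ?thesis unfolding eq0 m0 using before[OF s(2) True] by simp
  next
    case False
    then have ut: "u \<le> t" by simp
    have eq: "Y \<omega> * incr e s t \<omega> * incr e u v \<omega> = Y \<omega> * incr e s u \<omega> * incr e u v \<omega> + Y \<omega> * (incr e u t \<omega> * incr e u v \<omega>)" for \<omega>
      using incr_split[of e s t \<omega> u] by (simp add: algebra_simps)
    have ov: "{s<..t} \<inter> {u<..v} = {u<..min t v}" using s by auto
    \<comment> \<open>The two increments now start together at \<open>u\<close>; the case split
      arranges the shorter one first, as \<open>incr_nested\<close> requires.\<close>
    have n: "integrable M (\<lambda>\<omega>. Y \<omega> * (incr e u t \<omega> * incr e u v \<omega>)) \<and>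
      expectation (\<lambda>\<omega>. Y \<omega> * (incr e u t \<omega> * incr e u v \<omega>)) = expectation Y * (min t v - u)"
    proof (cases "t \<le> v")
      case True
      then show ?thesis using incr_nested[OF Y Yb _ ut True e] s by auto
    next
      case False
      then show ?thesis using incr_nested[OF Y Yb _ s(4) _ e, of t] s by (auto simp: mult.commute)
    qed
    show ?thesis unfolding eq0 eq ov using before[OF s(3)] n ut s
      by (subst Bochner_Integration.integral_add) (auto simp: Y_def[symmetric, abs_def])
  qed
qed

lemma incr_pair:
  assumes \<xi>: "\<xi> \<in> borel_measurable (filt s)" "\<And>\<omega>. \<omega> \<in> space M \<Longrightarrow> \<bar>\<xi> \<omega>\<bar> \<le> C"
    and \<eta>: "\<eta> \<in> borel_measurable (filt u)" "\<And>\<omega>. \<omega> \<in> space M \<Longrightarrow> \<bar>\<eta> \<omega>\<bar> \<le> D"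
    and s: "0 \<le> s" "s \<le> t" "0 \<le> u" "u \<le> v" and e: "e \<in> Basis"
  shows "integrable M (\<lambda>\<omega>. (\<xi> \<omega> * incr e s t \<omega>) * (\<eta> \<omega> * incr e u v \<omega>)) \<and>
    expectation (\<lambda>\<omega>. (\<xi> \<omega> * incr e s t \<omega>) * (\<eta> \<omega> * incr e u v \<omega>))
      = expectation (\<lambda>\<omega>. \<xi> \<omega> * \<eta> \<omega>) * measure lborel ({s<..t} \<inter> {u<..v})"
proof (cases "s \<le> u")
  case True
  then show ?thesis using incr_pair_ordered[OF \<xi> \<eta>] s e by blast
next
  case False
  then have "u \<le> s" by simp
  then show ?thesis using incr_pair_ordered[OF \<eta> \<xi> s(3,4) _ s(2) e]
    by (simp add: mult.commute Int_commute)
qed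

text \<open>No ordering of the intervals is required, so that the difference of two simple integrands
  needs no common refinement of their partitions.\<close>

lemma ito_isometry_elementary:
  assumes I: "finite I"
    and \<xi>: "\<And>i. i \<in> I \<Longrightarrow> \<xi> i \<in> borel_measurable (filt (s i))" "\<And>i \<omega>. i \<in> I \<Longrightarrow> \<omega> \<in> space M \<Longrightarrow> \<bar>\<xi> i \<omega>\<bar> \<le> C i"
    and s: "\<And>i. i \<in> I \<Longrightarrow> 0 \<le> s i" "\<And>i. i \<in> I \<Longrightarrow> s i \<le> t i"
  shows "(\<integral>\<^sup>+\<omega>. ennreal ((norm (\<Sum>i\<in>I. \<xi> i \<omega> *\<^sub>R (b' (t i) \<omega> - b' (s i) \<omega>)))\<^sup>2) \<partial>M)
    = ennreal (real DIM('b)) * (\<integral>\<^sup>+\<omega>. (\<integral>\<^sup>+r. ennreal ((\<Sum>i\<in>I. \<xi> i \<omega> * indicator {s i<..t i} r)\<^sup>2) \<partial>lborel) \<partial>M)"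
proof -
  \<comment> \<open>The contribution of one coordinate direction. It is the same for all directions,
    whence the factor \<open>DIM('b)\<close>.\<close>
  define V where "V = (\<Sum>i\<in>I. \<Sum>j\<in>I. expectation (\<lambda>\<omega>. \<xi> i \<omega> * \<xi> j \<omega>) * measure lborel ({s i<..t i} \<inter> {s j<..t j}))"
  have P: "integrable M (\<lambda>\<omega>. (\<xi> i \<omega> * incr e (s i) (t i) \<omega>) * (\<xi> j \<omega> * incr e (s j) (t j) \<omega>)) \<and>
    expectation (\<lambda>\<omega>. (\<xi> i \<omega> * incr e (s i) (t i) \<omega>) * (\<xi> j \<omega> * incr e (s j) (t j) \<omega>))
      = expectation (\<lambda>\<omega>. \<xi> i \<omega> * \<xi> j \<omega>) * measure lborel ({s i<..t i} \<inter> {s j<..t j})"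
    if "i \<in> I" "j \<in> I" "e \<in> Basis" for i j e
    using \<xi> s that by (intro incr_pair[where C="C i" and D="C j"]) auto
  have n: "(norm (\<Sum>i\<in>I. \<xi> i \<omega> *\<^sub>R (b' (t i) \<omega> - b' (s i) \<omega>)))\<^sup>2
    = (\<Sum>e\<in>Basis. \<Sum>i\<in>I. \<Sum>j\<in>I. (\<xi> i \<omega> * incr e (s i) (t i) \<omega>) * (\<xi> j \<omega> * incr e (s j) (t j) \<omega>))" for \<omega>
  proof -
    let ?z = "\<Sum>i\<in>I. \<xi> i \<omega> *\<^sub>R (b' (t i) \<omega> - b' (s i) \<omega>)"
    have "(norm ?z)\<^sup>2 = (\<Sum>e\<in>Basis. (?z \<bullet> e) * (?z \<bullet> e))"
      unfolding power2_norm_eq_inner by (rule euclidean_inner)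
    also have "\<dots> = (\<Sum>e\<in>Basis. (\<Sum>i\<in>I. \<xi> i \<omega> * incr e (s i) (t i) \<omega>) * (\<Sum>i\<in>I. \<xi> i \<omega> * incr e (s i) (t i) \<omega>))"
      by (simp add: inner_sum_left incr_def)
    finally show ?thesis by (simp add: sum_product)
  qed
  have "integrable M (\<lambda>\<omega>. (norm (\<Sum>i\<in>I. \<xi> i \<omega> *\<^sub>R (b' (t i) \<omega> - b' (s i) \<omega>)))\<^sup>2)"
    unfolding n by (intro Bochner_Integration.integrable_sum integrable_double_sum conjunct1[OF P])
  then have "(\<integral>\<^sup>+\<omega>. ennreal ((norm (\<Sum>i\<in>I. \<xi> i \<omega> *\<^sub>R (b' (t i) \<omega> - b' (s i) \<omega>)))\<^sup>2) \<partial>M)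
    = ennreal (expectation (\<lambda>\<omega>. (norm (\<Sum>i\<in>I. \<xi> i \<omega> *\<^sub>R (b' (t i) \<omega> - b' (s i) \<omega>)))\<^sup>2))"
    by (intro nn_integral_eq_integral) auto
  also have "expectation (\<lambda>\<omega>. (norm (\<Sum>i\<in>I. \<xi> i \<omega> *\<^sub>R (b' (t i) \<omega> - b' (s i) \<omega>)))\<^sup>2) = (\<Sum>e\<in>(Basis::'b set). V)"
  proof -
    have "expectation (\<lambda>\<omega>. \<Sum>i\<in>I. \<Sum>j\<in>I. (\<xi> i \<omega> * incr e (s i) (t i) \<omega>) * (\<xi> j \<omega> * incr e (s j) (t j) \<omega>)) = V" if "e \<in> Basis" for e
      unfolding V_def using P[OF _ _ that] by (subst integral_double_sum) (simp_all cong: sum.cong)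
    then show ?thesis
      unfolding n
      by (subst Bochner_Integration.integral_sum) (intro integrable_double_sum conjunct1[OF P], auto)
  qed
  finally have L: "(\<integral>\<^sup>+\<omega>. ennreal ((norm (\<Sum>i\<in>I. \<xi> i \<omega> *\<^sub>R (b' (t i) \<omega> - b' (s i) \<omega>)))\<^sup>2) \<partial>M) = ennreal (real DIM('b) * V)"
    by simp
  let ?m = "\<lambda>i j. measure lborel ({s i<..t i} \<inter> {s j<..t j})"
  have sq: "(\<Sum>i\<in>I. x i * indicator {s i<..t i} r)\<^sup>2 = (\<Sum>i\<in>I. \<Sum>j\<in>I. (x i * x j) * indicator ({s i<..t i} \<inter> {s j<..t j}) r)" for x :: "_ \<Rightarrow> real" and r
    unfolding power2_eq_square sum_product by (intro sum.cong refl) (auto simp: indicator_def)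
  have fin: "emeasure lborel ({s i<..t i} \<inter> {s j<..t j}) < \<infinity>" for i j
  proof -
    have "emeasure lborel ({s i<..t i} \<inter> {s j<..t j}) \<le> emeasure lborel {s i..t i}"
      by (rule emeasure_mono) auto
    also have "\<dots> < \<infinity>" by (simp add: emeasure_lborel_Icc_eq)
    finally show ?thesis .
  qed
  have inner: "(\<integral>\<^sup>+r. ennreal ((\<Sum>i\<in>I. \<xi> i \<omega> * indicator {s i<..t i} r)\<^sup>2) \<partial>lborel)
      = ennreal (\<Sum>i\<in>I. \<Sum>j\<in>I. \<xi> i \<omega> * \<xi> j \<omega> * ?m i j)"
    and nn: "0 \<le> (\<Sum>i\<in>I. \<Sum>j\<in>I. \<xi> i \<omega> * \<xi> j \<omega> * ?m i j)" for \<omega>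
  proof -
    have ii: "integrable lborel (\<lambda>r. (\<xi> i \<omega> * \<xi> j \<omega>) * indicator ({s i<..t i} \<inter> {s j<..t j}) r)" for i j
      by (intro integrable_mult_right integrable_real_indicator fin) simp
    have i: "integrable lborel (\<lambda>r. (\<Sum>i\<in>I. \<xi> i \<omega> * indicator {s i<..t i} r)\<^sup>2)"
      unfolding sq by (intro integrable_double_sum ii)
    have e: "(\<integral>r. (\<Sum>i\<in>I. \<xi> i \<omega> * indicator {s i<..t i} r)\<^sup>2 \<partial>lborel) = (\<Sum>i\<in>I. \<Sum>j\<in>I. \<xi> i \<omega> * \<xi> j \<omega> * ?m i j)"
      unfolding sq by (subst integral_double_sum[OF ii]) (simp_all del: Int_greaterThanAtMost)
    show "(\<integral>\<^sup>+r. ennreal ((\<Sum>i\<in>I. \<xi> i \<omega> * indicator {s i<..t i} r)\<^sup>2) \<partial>lborel)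
      = ennreal (\<Sum>i\<in>I. \<Sum>j\<in>I. \<xi> i \<omega> * \<xi> j \<omega> * ?m i j)"
      unfolding e[symmetric] by (rule nn_integral_eq_integral[OF i]) auto
    show "0 \<le> (\<Sum>i\<in>I. \<Sum>j\<in>I. \<xi> i \<omega> * \<xi> j \<omega> * ?m i j)"
      unfolding e[symmetric] by (rule integral_nonneg_AE) auto
  qed
  have xij: "integrable M (\<lambda>\<omega>. \<xi> i \<omega> * \<xi> j \<omega>)" if "i \<in> I" "j \<in> I" for i j
    by (rule integrable_bounded_mult[OF bounded_filt_integrable[OF \<xi>(1)[OF that(2)] \<xi>(2)[OF that(2)]] filt_measurable[OF \<xi>(1)[OF that(1)]] \<xi>(2)[OF that(1)]])
  have "(\<integral>\<^sup>+\<omega>. (\<integral>\<^sup>+r. ennreal ((\<Sum>i\<in>I. \<xi> i \<omega> * indicator {s i<..t i} r)\<^sup>2) \<partial>lborel) \<partial>M)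
     = (\<integral>\<^sup>+\<omega>. ennreal (\<Sum>i\<in>I. \<Sum>j\<in>I. \<xi> i \<omega> * \<xi> j \<omega> * ?m i j) \<partial>M)" unfolding inner ..
  also have "\<dots> = ennreal (expectation (\<lambda>\<omega>. \<Sum>i\<in>I. \<Sum>j\<in>I. \<xi> i \<omega> * \<xi> j \<omega> * ?m i j))"
    using nn by (intro nn_integral_eq_integral integrable_double_sum integrable_mult_left xij) auto
  also have "expectation (\<lambda>\<omega>. \<Sum>i\<in>I. \<Sum>j\<in>I. \<xi> i \<omega> * \<xi> j \<omega> * ?m i j) = V"
    unfolding V_def by (subst integral_double_sum) (simp_all add: xij del: Int_greaterThanAtMost)
  finally have R: "(\<integral>\<^sup>+\<omega>. (\<integral>\<^sup>+r. ennreal ((\<Sum>i\<in>I. \<xi> i \<omega> * indicator {s i<..t i} r)\<^sup>2) \<partial>lborel) \<partial>M) = ennreal V" .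
  show ?thesis unfolding L R by (rule ennreal_mult') simp
qed

text \<open>The difference of two simple integrals is a single elementary sum over the disjoint
  union of the index sets, with the second family of coefficients negated and all times cut at
  \<open>T\<close>.\<close>

lemma ito_isometry_diff:
  assumes T: "0 \<le> T" and S: "simple_integrand M filt n \<tau> \<xi>" and S': "simple_integrand M filt n' \<tau>' \<xi>'"
  shows "(\<integral>\<^sup>+\<omega>. ennreal ((norm (simple_ito_integral n \<tau> \<xi> b' T \<omega> - simple_ito_integral n' \<tau>' \<xi>' b' T \<omega>))\<^sup>2) \<partial>M)
    = ennreal (real DIM('b)) * (\<integral>\<^sup>+\<omega>. (\<integral>\<^sup>+r\<in>{0..T}. ennreal ((simple_process n \<tau> \<xi> r \<omega> - simple_process n' \<tau>' \<xi>' r \<omega>)\<^sup>2) \<partial>lborel) \<partial>M)"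
proof -
  define I where "I = {..<n} <+> {..<n'}"
  define s where "s = (\<lambda>i. min T (case i of Inl i \<Rightarrow> \<tau> i | Inr i \<Rightarrow> \<tau>' i))"
  define t where "t = (\<lambda>i. min T (case i of Inl i \<Rightarrow> \<tau> (Suc i) | Inr i \<Rightarrow> \<tau>' (Suc i)))"
  \<comment> \<open>An interval that starts after \<open>T\<close> becomes empty when cut, but its
    coefficient is known only at its original starting time; the value 0 restores measurability at
    time \<open>T\<close>.\<close>
  define X where "X = (\<lambda>i \<omega>. if (case i of Inl i \<Rightarrow> \<tau> i | Inr i \<Rightarrow> \<tau>' i) \<le> T then (case i of Inl i \<Rightarrow> \<xi> i \<omega> | Inr i \<Rightarrow> - \<xi>' i \<omega>) else 0)"
  have pos: "0 \<le> \<tau> i" if "i \<le> n" "simple_integrand M filt n \<tau> \<xi>" for i n \<tau> \<xi>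
    using that(1)
  proof (induction i)
    case 0 then show ?case using that(2) by (simp add: simple_integrand_def)
  next
    case (Suc i)
    then have "\<tau> i \<le> \<tau> (Suc i)" using that(2) by (auto simp: simple_integrand_def)
    then show ?case using Suc by simp
  qed
  have bd: "\<exists>C. \<forall>\<omega>\<in>space M. \<bar>\<xi> i \<omega>\<bar> \<le> C" if "i < n" "simple_integrand M filt n \<tau> \<xi>" for i n \<tau> \<xi>
    using that by (auto simp: simple_integrand_def bounded_iff)
  have s0: "0 \<le> s i" if "i \<in> I" for i
    using that pos[OF _ S] pos[OF _ S'] T by (auto simp: I_def s_def)
  have tT: "t i \<le> T" for i by (simp add: t_def)
  have "\<exists>C. \<forall>\<omega>\<in>space M. \<bar>X i \<omega>\<bar> \<le> C" if "i \<in> I" for i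
  proof (cases i)
    case (Inl k)
    then have "k < n" using that by (auto simp: I_def)
    from bd[OF this S] Inl show ?thesis by (cases "\<tau> k \<le> T") (auto simp: X_def)
  next
    case (Inr k)
    then have "k < n'" using that by (auto simp: I_def)
    from bd[OF this S'] Inr show ?thesis by (cases "\<tau>' k \<le> T") (auto simp: X_def)
  qed
  then obtain C where C: "\<And>i \<omega>. i \<in> I \<Longrightarrow> \<omega> \<in> space M \<Longrightarrow> \<bar>X i \<omega>\<bar> \<le> C i" by metis
  have "(\<integral>\<^sup>+\<omega>. ennreal ((norm (\<Sum>i\<in>I. X i \<omega> *\<^sub>R (b' (t i) \<omega> - b' (s i) \<omega>)))\<^sup>2) \<partial>M)
    = ennreal (real DIM('b)) * (\<integral>\<^sup>+\<omega>. (\<integral>\<^sup>+r. ennreal ((\<Sum>i\<in>I. X i \<omega> * indicator {s i<..t i} r)\<^sup>2) \<partial>lborel) \<partial>M)"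
  proof (rule ito_isometry_elementary[OF _ _ C])
    show "finite I" by (simp add: I_def)
    fix i assume i: "i \<in> I"
    show "0 \<le> s i" by (rule s0[OF i])
    show "s i \<le> t i" using i S S' by (auto simp: I_def s_def t_def simple_integrand_def min.coboundedI2)
    show "X i \<in> borel_measurable (filt (s i))"
    proof (cases i)
      case (Inl k)
      then have "\<xi> k \<in> borel_measurable (filt (\<tau> k))" using i S by (auto simp: I_def simple_integrand_def)
      then show ?thesis using Inl by (cases "\<tau> k \<le> T") (auto simp: X_def[abs_def] s_def min_def)
    next
      case (Inr k)
      then have "\<xi>' k \<in> borel_measurable (filt (\<tau>' k))" using i S' by (auto simp: I_def simple_integrand_def)
      then show ?thesis using Inr by (cases "\<tau>' k \<le> T") (auto simp: X_def[abs_def] s_def min_def)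
    qed
  qed
  moreover have "(\<Sum>i\<in>I. X i \<omega> *\<^sub>R (b' (t i) \<omega> - b' (s i) \<omega>)) = simple_ito_integral n \<tau> \<xi> b' T \<omega> - simple_ito_integral n' \<tau>' \<xi>' b' T \<omega>" for \<omega>
  proof -
    have 1: "(\<Sum>i<n. X (Inl i) \<omega> *\<^sub>R (b' (t (Inl i)) \<omega> - b' (s (Inl i)) \<omega>)) = simple_ito_integral n \<tau> \<xi> b' T \<omega>"
      unfolding simple_ito_integral_def using S
      by (intro sum.cong) (auto simp: X_def s_def t_def simple_integrand_def min_def)
    have 2: "(\<Sum>i<n'. X (Inr i) \<omega> *\<^sub>R (b' (t (Inr i)) \<omega> - b' (s (Inr i)) \<omega>)) = - simple_ito_integral n' \<tau>' \<xi>' b' T \<omega>"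
      unfolding simple_ito_integral_def sum_negf[symmetric] using S'
      by (intro sum.cong) (auto simp: X_def s_def t_def simple_integrand_def min_def)
    show ?thesis unfolding I_def by (subst sum.Plus) (simp_all add: 1 2)
  qed
  moreover have "ennreal ((\<Sum>i\<in>I. X i \<omega> * indicator {s i<..t i} r)\<^sup>2)
    = ennreal ((simple_process n \<tau> \<xi> r \<omega> - simple_process n' \<tau>' \<xi>' r \<omega>)\<^sup>2) * indicator {0..T} r" for \<omega> r
  proof (cases "r \<in> {0..T}")
    case True
    have 1: "(\<Sum>i<n. X (Inl i) \<omega> * indicator {s (Inl i)<..t (Inl i)} r) = simple_process n \<tau> \<xi> r \<omega>"
      unfolding simple_process_def using S True
      by (intro sum.cong) (auto simp: X_def s_def t_def simple_integrand_def min_def indicator_def)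
    have 2: "(\<Sum>i<n'. X (Inr i) \<omega> * indicator {s (Inr i)<..t (Inr i)} r) = - simple_process n' \<tau>' \<xi>' r \<omega>"
      unfolding simple_process_def sum_negf[symmetric] using S' True
      by (intro sum.cong) (auto simp: X_def s_def t_def simple_integrand_def min_def indicator_def)
    have "(\<Sum>i\<in>I. X i \<omega> * indicator {s i<..t i} r) = simple_process n \<tau> \<xi> r \<omega> - simple_process n' \<tau>' \<xi>' r \<omega>"
      unfolding I_def by (subst sum.Plus) (simp_all add: 1 2)
    then show ?thesis using True by simp
  next
    case False
    have "indicator {s i<..t i} r = (0::real)" if "i \<in> I" for i
      using False s0[OF that] tT[of i] by (auto simp: indicator_def)
    then show ?thesis using False by simp
  qed
  ultimately show ?thesis by simp
qed

end

section \<open>Ito integrals of functions of an independent Brownian motion\<close>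

lemma sq_diff_le: "(a - c)\<^sup>2 \<le> 2 * (a - b)\<^sup>2 + 2 * (b - c)\<^sup>2" for a b c :: real
proof -
  have "0 \<le> ((a - b) - (b - c))\<^sup>2" by simp
  then show ?thesis by (simp add: power2_eq_square algebra_simps)
qed

lemma norm_sq_diff_le:
  fixes a b c :: "'a::real_normed_vector"
  shows "(norm (a - c))\<^sup>2 \<le> 2 * (norm (a - b))\<^sup>2 + 2 * (norm (b - c))\<^sup>2"
proof -
  have "norm (a - c) \<le> norm (a - b) + norm (b - c)" by norm
  then have "(norm (a - c))\<^sup>2 \<le> (norm (a - b) + norm (b - c))\<^sup>2" by (intro power_mono) auto
  also have "\<dots> \<le> 2 * (norm (a - b))\<^sup>2 + 2 * (norm (b - c))\<^sup>2"
    using sq_diff_le[of "norm (a - b)" "- norm (b - c)" 0] by simp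
  finally show ?thesis .
qed

lemma brownian_grid_char:
  fixes B :: "real \<Rightarrow> 'w \<Rightarrow> 'a::euclidean_space" and a :: "nat \<Rightarrow> 'a"
  assumes B: "brownian_motion M B" and T: "0 < T"
  shows "(\<integral>\<omega>. iexp (\<Sum>k<Suc m. a k \<bullet> (B (real (Suc k) * T / Suc m) \<omega> - B (real k * T / Suc m) \<omega>)) \<partial>M)
    = of_real (exp (- (T / Suc m * (\<Sum>k<Suc m. (norm (a k))\<^sup>2)) / 2))"
proof -
  interpret prob_space M using B by (rule brownian_motionD)
  define D where "D k \<omega> = B (real (Suc k) * T / Suc m) \<omega> - B (real k * T / Suc m) \<omega>" for k \<omega>
  have ind: "indep_vars (\<lambda>_. borel) D {..<Suc m}"
    unfolding D_def
    by (rule brownian_motionD(6)[OF B, of "\<lambda>k. real k * T / Suc m"]) (use T in \<open>auto intro!: divide_right_mono mult_right_mono\<close>)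
  have Dm: "D k \<in> borel_measurable M" for k
    unfolding D_def[abs_def] using T by (intro borel_measurable_diff brownian_motionD(2)[OF B]) auto
  have char: "(\<integral>\<omega>. iexp (a k \<bullet> D k \<omega>) \<partial>M) = of_real (exp (- (T / Suc m) * (norm (a k))\<^sup>2 / 2))" for k
  proof -
    have d: "real (Suc k) * T / Suc m - real k * T / Suc m = T / Suc m"
      by (simp add: add_divide_distrib distrib_right)
    have l: "real k * T / Suc m < real (Suc k) * T / Suc m"
      using T d by (smt (verit) divide_pos_pos of_nat_0_less_iff zero_less_Suc)
    have "(\<integral>\<omega>. iexp (a k \<bullet> D k \<omega>) \<partial>M) = (\<integral>z. iexp (a k \<bullet> z) \<partial>gauss_measure (T / Suc m))"
      unfolding D_def using brownian_increment_integral(1)[OF B _ l, of "\<lambda>z. iexp (a k \<bullet> z)"] T unfolding d by simp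
    then show ?thesis using gauss_measure_iexp[of "T / Suc m" "a k"] T by simp
  qed
  have "(\<integral>\<omega>. iexp (\<Sum>k<Suc m. a k \<bullet> D k \<omega>) \<partial>M) = (\<integral>\<omega>. (\<Prod>k<Suc m. iexp (a k \<bullet> D k \<omega>)) \<partial>M)"
    by (intro Bochner_Integration.integral_cong refl) (simp only: of_real_sum sum_distrib_left exp_sum[OF finite_lessThan])
  also have "\<dots> = (\<Prod>k<Suc m. \<integral>\<omega>. iexp (a k \<bullet> D k \<omega>) \<partial>M)"
  proof (rule indep_vars_lebesgue_integral)
    show "indep_vars (\<lambda>_. borel) (\<lambda>k \<omega>. iexp (a k \<bullet> D k \<omega>)) {..<Suc m}"
      by (rule indep_vars_compose2[OF ind]) measurable
    show "complex_integrable M (\<lambda>\<omega>. iexp (a k \<bullet> D k \<omega>))" for k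
      by (rule integrable_iexp) (use Dm in measurable)
  qed simp
  also have "\<dots> = of_real (exp (\<Sum>k<Suc m. - (T / Suc m) * (norm (a k))\<^sup>2 / 2))"
    by (simp only: char exp_sum[OF finite_lessThan] of_real_prod)
  also have "(\<Sum>k<Suc m. - (T / Suc m) * (norm (a k))\<^sup>2 / 2) = - (T / Suc m * (\<Sum>k<Suc m. (norm (a k))\<^sup>2)) / 2"
    by (simp only: sum_distrib_left sum_divide_distrib[symmetric] sum_negf mult_minus_left)
  finally show ?thesis unfolding D_def .
qed

text \<open>Young's inequality bounds the difference of the squares by a small multiple of the
  square of \<open>H\<close> plus a large multiple of the squared error, which involves only
  integrals that are known to exist.\<close>

lemma L2_norm_tendsto:
  fixes S :: "nat \<Rightarrow> 'x \<Rightarrow> real"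
  assumes S: "\<And>j. integrable N (\<lambda>x. (S j x)\<^sup>2)" and H: "integrable N (\<lambda>x. (H x)\<^sup>2)"
    and D: "\<And>j. integrable N (\<lambda>x. (S j x - H x)\<^sup>2)" and lim: "(\<lambda>j. \<integral>x. (S j x - H x)\<^sup>2 \<partial>N) \<longlonglongrightarrow> 0"
  shows "(\<lambda>j. \<integral>x. (S j x)\<^sup>2 \<partial>N) \<longlonglongrightarrow> (\<integral>x. (H x)\<^sup>2 \<partial>N)"
proof (rule LIMSEQ_I)
  fix e :: real assume e: "0 < e"
  define h where "h = (\<integral>x. (H x)\<^sup>2 \<partial>N)"
  have h: "0 \<le> h" unfolding h_def by (intro integral_nonneg_AE) auto
  \<comment> \<open>Chosen so that \<open>\<delta> * h\<close> is at most \<open>e / 2\<close>;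
    \<open>h + 1\<close> keeps the denominator positive when \<open>h = 0\<close>.\<close>
  define \<delta> where "\<delta> = e / (2 * (h + 1))"
  have \<delta>: "0 < \<delta>" using e h by (simp add: \<delta>_def)
  have "\<delta> * h \<le> \<delta> * (h + 1)" using \<delta> by simp
  also have "\<dots> = e / 2" using h by (simp add: \<delta>_def field_simps)
  finally have \<delta>h: "\<delta> * h \<le> e / 2" .
  have ineq: "\<bar>x\<^sup>2 - y\<^sup>2\<bar> \<le> \<delta> * y\<^sup>2 + (1 + 1 / \<delta>) * (x - y)\<^sup>2" for x y :: real
  proof -
    have "2 * \<bar>y\<bar> * \<bar>x - y\<bar> \<le> \<delta> * y\<^sup>2 + (x - y)\<^sup>2 / \<delta>"
    proof -
      have "0 \<le> (\<delta> * \<bar>y\<bar> - \<bar>x - y\<bar>)\<^sup>2 / \<delta>" using \<delta> by simp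
      also have "\<dots> = \<delta> * y\<^sup>2 + (x - y)\<^sup>2 / \<delta> - 2 * \<bar>y\<bar> * \<bar>x - y\<bar>"
        using \<delta> by (simp add: power2_eq_square field_simps abs_mult_self_eq)
      finally show ?thesis by simp
    qed
    moreover have "x\<^sup>2 - y\<^sup>2 = (x - y)\<^sup>2 + 2 * y * (x - y)" by (simp add: power2_eq_square algebra_simps)
    then have "\<bar>x\<^sup>2 - y\<^sup>2\<bar> \<le> (x - y)\<^sup>2 + 2 * \<bar>y\<bar> * \<bar>x - y\<bar>"
      by (simp only:) (rule order_trans[OF abs_triangle_ineq], simp add: abs_mult)
    ultimately show ?thesis by (simp add: distrib_right)
  qed
  have bound: "\<bar>(\<integral>x. (S j x)\<^sup>2 \<partial>N) - h\<bar> \<le> \<delta> * h + (1 + 1 / \<delta>) * (\<integral>x. (S j x - H x)\<^sup>2 \<partial>N)" for j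
  proof -
    have "\<bar>(\<integral>x. (S j x)\<^sup>2 \<partial>N) - h\<bar> = \<bar>\<integral>x. (S j x)\<^sup>2 - (H x)\<^sup>2 \<partial>N\<bar>"
      unfolding h_def using S H by (subst Bochner_Integration.integral_diff) auto
    also have "\<dots> \<le> (\<integral>x. \<bar>(S j x)\<^sup>2 - (H x)\<^sup>2\<bar> \<partial>N)" by (rule integral_abs_bound)
    also have "\<dots> \<le> (\<integral>x. \<delta> * (H x)\<^sup>2 + (1 + 1 / \<delta>) * (S j x - H x)\<^sup>2 \<partial>N)"
      using S H D ineq by (intro integral_mono) auto
    also have "\<dots> = \<delta> * h + (1 + 1 / \<delta>) * (\<integral>x. (S j x - H x)\<^sup>2 \<partial>N)"
      unfolding h_def using H D by (subst Bochner_Integration.integral_add) auto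
    finally show ?thesis .
  qed
  have "(\<lambda>j. (1 + 1 / \<delta>) * (\<integral>x. (S j x - H x)\<^sup>2 \<partial>N)) \<longlonglongrightarrow> (1 + 1 / \<delta>) * 0"
    by (intro tendsto_mult tendsto_const lim)
  then have "eventually (\<lambda>j. (1 + 1 / \<delta>) * (\<integral>x. (S j x - H x)\<^sup>2 \<partial>N) < e / 2) sequentially"
    by (rule order_tendstoD) (use e in simp)
  then obtain n where n: "\<And>j. n \<le> j \<Longrightarrow> (1 + 1 / \<delta>) * (\<integral>x. (S j x - H x)\<^sup>2 \<partial>N) < e / 2"
    unfolding eventually_sequentially by blast
  then show "\<exists>n. \<forall>j\<ge>n. norm ((\<integral>x. (S j x)\<^sup>2 \<partial>N) - (\<integral>x. (H x)\<^sup>2 \<partial>N)) < e"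
  proof (intro exI[of _ n] allI impI)
    fix j assume "n \<le> j"
    with n have "(1 + 1 / \<delta>) * (\<integral>x. (S j x - H x)\<^sup>2 \<partial>N) < e / 2" by blast
    with bound[of j] \<delta>h show "norm ((\<integral>x. (S j x)\<^sup>2 \<partial>N) - (\<integral>x. (H x)\<^sup>2 \<partial>N)) < e"
      unfolding h_def[symmetric] real_norm_def by linarith
  qed
qed

text \<open>Geometric bounds make the integral of the whole series finite, so the series converges
  almost everywhere and its terms tend to 0. Approximations chosen at this rate converge almost
  surely without extraction of a subsequence.\<close>

lemma nn_integral_summable_AE_tendsto_0:
  assumes [measurable]: "\<And>j. W j \<in> borel_measurable M" and W: "\<And>j. (\<integral>\<^sup>+x. W j x \<partial>M) \<le> ennreal ((1/2)^j)"
  shows "AE x in M. (\<lambda>j. W j x) \<longlonglongrightarrow> (0::ennreal)"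
proof -
  have "(\<integral>\<^sup>+x. (\<Sum>j. W j x) \<partial>M) = (\<Sum>j. \<integral>\<^sup>+x. W j x \<partial>M)" by (rule nn_integral_suminf) measurable
  also have "\<dots> \<le> (\<Sum>j. ennreal ((1/2)^j))" by (intro suminf_le W) auto
  also have "\<dots> = ennreal (\<Sum>j. (1/2)^j)" by (intro suminf_ennreal2) auto
  also have "\<dots> < \<infinity>" by simp
  finally have "AE x in M. (\<Sum>j. W j x) \<noteq> \<infinity>" by (intro nn_integral_noteq_infinite) auto
  then show ?thesis
  proof eventually_elim
    case (elim x)
    have "W j x \<noteq> \<infinity>" for j
    proof
      assume "W j x = \<infinity>"
      moreover have "W j x \<le> (\<Sum>j. W j x)" using sum_le_suminf[of "\<lambda>j. W j x" "{j}"] by simp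
      ultimately show False using elim by (simp add: top_unique)
    qed
    then obtain r where r: "\<And>j. W j x = ennreal (r j)" "\<And>j. 0 \<le> r j"
      by (intro that[of "\<lambda>j. enn2real (W j x)"]) (auto simp: less_top)
    have "summable r" using elim r(2) unfolding r(1) by (intro summable_suminf_not_top) auto
    then have "r \<longlonglongrightarrow> 0" by (rule summable_LIMSEQ_zero)
    then show ?case unfolding r(1) using tendsto_ennrealI[of r 0 sequentially] by simp
  qed
qed

section \<open>Mean-square approximation by step functions of the path\<close>

context brownian_pair
begin

text \<open>The squared distance whose convergence to 0 is the first limit in
  \<open>is_ito_integral\<close>.\<close>

definition dist2 :: "real \<Rightarrow> (real \<Rightarrow> 'w \<Rightarrow> real) \<Rightarrow> (real \<Rightarrow> 'w \<Rightarrow> real) \<Rightarrow> ennreal" where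
  "dist2 T F G = (\<integral>\<^sup>+\<omega>. (\<integral>\<^sup>+s\<in>{0..T}. ennreal ((F s \<omega> - G s \<omega>)\<^sup>2) \<partial>lborel) \<partial>M)"

text \<open>Clipped, since \<open>b\<close> is constrained at nonnegative times only;
  \<open>dist2 T\<close> looks at times in \<open>{0..T}\<close>, where clipping changes
  nothing.\<close>

definition jointly_measurable :: "real \<Rightarrow> (real \<Rightarrow> 'w \<Rightarrow> real) \<Rightarrow> bool" where
  "jointly_measurable T F \<longleftrightarrow> (\<lambda>z. F (max 0 (min T (snd z))) (fst z)) \<in> borel_measurable (M \<Otimes>\<^sub>M lborel)"

lemma dist2_eq:
  assumes F: "jointly_measurable T F" and G: "jointly_measurable T G"
  shows "(\<lambda>z. ennreal ((F (max 0 (min T (snd z))) (fst z) - G (max 0 (min T (snd z))) (fst z))\<^sup>2) * indicator {0..T} (snd z)) \<in> borel_measurable (M \<Otimes>\<^sub>M lborel)" (is "?f \<in> _")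
    and "dist2 T F G = (\<integral>\<^sup>+z. ennreal ((F (max 0 (min T (snd z))) (fst z) - G (max 0 (min T (snd z))) (fst z))\<^sup>2) * indicator {0..T} (snd z) \<partial>(M \<Otimes>\<^sub>M lborel))"
    and "(\<lambda>\<omega>. \<integral>\<^sup>+s\<in>{0..T}. ennreal ((F s \<omega> - G s \<omega>)\<^sup>2) \<partial>lborel) \<in> borel_measurable M"
proof -
  note [measurable] = F[unfolded jointly_measurable_def] G[unfolded jointly_measurable_def]
  show m: "?f \<in> borel_measurable (M \<Otimes>\<^sub>M lborel)" by measurable
  have e: "(\<integral>\<^sup>+s\<in>{0..T}. ennreal ((F s \<omega> - G s \<omega>)\<^sup>2) \<partial>lborel) = (\<integral>\<^sup>+s. ?f (\<omega>, s) \<partial>lborel)" for \<omega>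
    by (intro nn_integral_cong) (auto simp: indicator_def min_def max_def)
  show "dist2 T F G = (\<integral>\<^sup>+z. ?f z \<partial>(M \<Otimes>\<^sub>M lborel))"
    unfolding dist2_def e by (rule lborel.nn_integral_fst[OF m])
  show "(\<lambda>\<omega>. \<integral>\<^sup>+s\<in>{0..T}. ennreal ((F s \<omega> - G s \<omega>)\<^sup>2) \<partial>lborel) \<in> borel_measurable M"
    unfolding e by (rule lborel.borel_measurable_nn_integral_fst[OF m])
qed

lemma dist2_commute: "dist2 T F G = dist2 T G F"
  by (simp add: dist2_def power2_commute)

text \<open>\<open>dist2\<close> is a squared distance, hence the factors 2.\<close>

lemma dist2_triangle:
  assumes "jointly_measurable T F" "jointly_measurable T G" "jointly_measurable T H"
  shows "dist2 T F H \<le> 2 * dist2 T F G + 2 * dist2 T G H"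
proof -
  let ?c = "\<lambda>z. max 0 (min T (snd z)) :: real"
  have "dist2 T F H \<le> (\<integral>\<^sup>+z. 2 * (ennreal ((F (?c z) (fst z) - G (?c z) (fst z))\<^sup>2) * indicator {0..T} (snd z))
     + 2 * (ennreal ((G (?c z) (fst z) - H (?c z) (fst z))\<^sup>2) * indicator {0..T} (snd z)) \<partial>(M \<Otimes>\<^sub>M lborel))"
    unfolding dist2_eq(2)[OF assms(1,3)]
  proof (rule nn_integral_mono)
    fix z
    have "ennreal ((a - c)\<^sup>2) \<le> 2 * ennreal ((a - b)\<^sup>2) + 2 * ennreal ((b - c)\<^sup>2)" for a b c :: real
    proof -
      have "2 * ennreal ((a - b)\<^sup>2) + 2 * ennreal ((b - c)\<^sup>2) = ennreal (2 * (a - b)\<^sup>2 + 2 * (b - c)\<^sup>2)"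
        by (simp add: ennreal_plus ennreal_mult)
      then show ?thesis by (simp only:) (intro ennreal_leI sq_diff_le)
    qed
    then show "ennreal ((F (?c z) (fst z) - H (?c z) (fst z))\<^sup>2) * indicator {0..T} (snd z) \<le> 2 * (ennreal ((F (?c z) (fst z) - G (?c z) (fst z))\<^sup>2) * indicator {0..T} (snd z))
     + 2 * (ennreal ((G (?c z) (fst z) - H (?c z) (fst z))\<^sup>2) * indicator {0..T} (snd z))"
      by (auto simp: indicator_def)
  qed
  also have "\<dots> = 2 * dist2 T F G + 2 * dist2 T G H"
    unfolding dist2_eq(2)[OF assms(1,2)] dist2_eq(2)[OF assms(2,3)]
    using dist2_eq(1)[OF assms(1,2)] dist2_eq(1)[OF assms(2,3)]
    by (subst nn_integral_add) (auto simp: nn_integral_cmult)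
  finally show ?thesis .
qed

lemma jointly_measurable_b:
  assumes T: "0 \<le> T" and g: "continuous_on UNIV (g :: 'a \<Rightarrow> real)"
  shows "jointly_measurable T (\<lambda>s \<omega>. g (b s \<omega>))"
proof -
  have "(\<lambda>z. b (max 0 (min T (fst z))) (snd z)) \<in> borel_measurable (borel \<Otimes>\<^sub>M M)"
    by (rule clipped_process_measurable[OF T])
       (auto intro: continuous_on_subset[OF brownian_motionD(4)[OF bm]])
  from measurable_compose[OF measurable_Pair[OF measurable_snd measurable_fst] this]
  have "(\<lambda>z. b (max 0 (min T (snd z))) (fst z)) \<in> borel_measurable (M \<Otimes>\<^sub>M borel)" by simp
  then have "(\<lambda>z. b (max 0 (min T (snd z))) (fst z)) \<in> borel_measurable (M \<Otimes>\<^sub>M lborel)"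
    by (simp cong: measurable_cong_sets)
  moreover have "g \<in> borel_measurable borel" using g by (rule borel_measurable_continuous_onI)
  ultimately show ?thesis unfolding jointly_measurable_def by (rule measurable_compose)
qed

lemma jointly_measurable_simple:
  assumes "simple_integrand M filt n \<tau> \<xi>"
  shows "jointly_measurable T (\<lambda>s \<omega>. simple_process n \<tau> \<xi> s \<omega>)"
proof -
  have "\<xi> i \<in> borel_measurable M" if "i < n" for i
    using assms that by (auto simp: simple_integrand_def intro: filt_measurable)
  then show ?thesis
    unfolding jointly_measurable_def simple_process_def
    by (intro borel_measurable_sum borel_measurable_times) (auto intro: measurable_compose[OF measurable_fst])
qed

definition grid_value :: "('a \<Rightarrow> real) \<Rightarrow> real \<Rightarrow> nat \<Rightarrow> nat \<Rightarrow> 'w \<Rightarrow> real" where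
  "grid_value f T m k \<omega> = f (b (real k * T / Suc m) \<omega>)"

lemma grid_simple_integrand:
  assumes T: "0 < T" and f: "continuous_on UNIV f" "\<And>z. \<bar>f z\<bar> \<le> K"
  shows "simple_integrand M filt (Suc m) (\<lambda>k. real k * T / Suc m) (grid_value f T m)"
  unfolding simple_integrand_def
proof (intro conjI allI impI)
  have fm: "f \<in> borel_measurable borel" using f(1) by (rule borel_measurable_continuous_onI)
  fix k
  show "real k * T / Suc m \<le> real (Suc k) * T / Suc m" using T by (auto intro!: divide_right_mono mult_right_mono)
  show "grid_value f T m k \<in> borel_measurable (filt (real k * T / Suc m))"
    unfolding grid_value_def[abs_def] using T by (intro measurable_compose[OF b_filt fm]) auto
  show "bounded (grid_value f T m k ` space M)"
    unfolding bounded_iff using f(2) by (auto simp: grid_value_def)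
qed simp

text \<open>Dominated convergence on the product of probability space and time, by continuity of the
  paths. The bound on \<open>f\<close> provides the majorant \<open>(2 * K)\<^sup>2\<close> on
  \<open>{0..T}\<close>, which is why unbounded integrands are truncated before this is
  applied.\<close>

lemma grid_approx_tendsto:
  assumes T: "0 < T" and f: "continuous_on UNIV f" "\<And>z. \<bar>f z\<bar> \<le> K"
  shows "(\<lambda>m. dist2 T (\<lambda>s \<omega>. simple_process (Suc m) (\<lambda>k. real k * T / Suc m) (grid_value f T m) s \<omega>) (\<lambda>s \<omega>. f (b s \<omega>))) \<longlonglongrightarrow> 0"
proof -
  let ?S = "\<lambda>m s \<omega>. simple_process (Suc m) (\<lambda>k. real k * T / Suc m) (grid_value f T m) s \<omega>"
  let ?F = "\<lambda>m z. ennreal ((?S m (max 0 (min T (snd z))) (fst z) - f (b (max 0 (min T (snd z))) (fst z)))\<^sup>2) * indicator {0..T} (snd z)"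
  have jm: "jointly_measurable T (\<lambda>s \<omega>. ?S m s \<omega>)" "jointly_measurable T (\<lambda>s \<omega>. f (b s \<omega>))" for m
    by (rule jointly_measurable_simple[OF grid_simple_integrand[OF T f]])
      (rule jointly_measurable_b[OF less_imp_le[OF T] f(1)])
  have K: "0 \<le> K" using f(2)[of 0] by linarith
  have "(\<lambda>m. \<integral>\<^sup>+z. ?F m z \<partial>(M \<Otimes>\<^sub>M lborel)) \<longlonglongrightarrow> (\<integral>\<^sup>+z. 0 \<partial>(M \<Otimes>\<^sub>M (lborel :: real measure)))"
  proof (rule nn_integral_dominated_convergence[where w="\<lambda>z. ennreal ((2 * K)\<^sup>2) * indicator {0..T} (snd z)"])
    show "?F m \<in> borel_measurable (M \<Otimes>\<^sub>M lborel)" for m by (rule dist2_eq(1)[OF jm])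
    show "(\<integral>\<^sup>+z. ennreal ((2 * K)\<^sup>2) * indicator {0..T} (snd z) \<partial>(M \<Otimes>\<^sub>M lborel)) < \<infinity>"
    proof -
      have "(\<lambda>z. ennreal ((2 * K)\<^sup>2) * indicator {0..T} (snd z)) \<in> borel_measurable (M \<Otimes>\<^sub>M lborel)" by measurable
      from lborel.nn_integral_fst[OF this, symmetric] show ?thesis
        using T by (simp add: nn_integral_cmult emeasure_space_1 ennreal_mult_less_top)
    qed
    fix m
    show "AE z in M \<Otimes>\<^sub>M lborel. ?F m z \<le> ennreal ((2 * K)\<^sup>2) * indicator {0..T} (snd z)"
    proof (rule AE_I2)
      fix z :: "'w \<times> real"
      let ?c = "max 0 (min T (snd z))"
      have "\<bar>?S m ?c (fst z)\<bar> \<le> K * indicator {0..T} ?c"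
        unfolding simple_process_def grid_value_def using f(2) K T by (intro grid_step_abs_le) auto
      also have "\<dots> \<le> K" using K by (simp add: indicator_def)
      finally have "\<bar>?S m ?c (fst z) - f (b ?c (fst z))\<bar> \<le> \<bar>2 * K\<bar>" using f(2)[of "b ?c (fst z)"] by linarith
      then have "(?S m ?c (fst z) - f (b ?c (fst z)))\<^sup>2 \<le> (2 * K)\<^sup>2" by (simp only: abs_le_square_iff)
      then show "?F m z \<le> ennreal ((2 * K)\<^sup>2) * indicator {0..T} (snd z)"
        by (intro mult_right_mono ennreal_leI) auto
    qed
  next
    have n0: "AE z in M \<Otimes>\<^sub>M lborel. snd z \<noteq> (0::real)"
    proof -
      interpret P: pair_sigma_finite M "lborel :: real measure" ..
      have "AE x in M. AE y in lborel. y \<noteq> (0::real)" by (intro AE_I2 AE_lborel_singleton)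
      moreover have "{z \<in> space (M \<Otimes>\<^sub>M lborel). snd z \<noteq> (0::real)} = snd -` (- {0}) \<inter> space (M \<Otimes>\<^sub>M lborel)" by auto
      moreover have "snd -` (- {0}) \<inter> space (M \<Otimes>\<^sub>M lborel) \<in> sets (M \<Otimes>\<^sub>M (lborel :: real measure))"
        by (rule measurable_sets[OF measurable_snd]) simp
      ultimately show ?thesis by (intro P.AE_pair_measure) simp_all
    qed
    have "AE z in M \<Otimes>\<^sub>M (lborel :: real measure). z \<in> space (M \<Otimes>\<^sub>M lborel)" by (rule AE_space)
    with n0 show "AE z in M \<Otimes>\<^sub>M lborel. (\<lambda>m. ?F m z) \<longlonglongrightarrow> 0"
    proof eventually_elim
      case (elim z)
      show ?case
      proof (cases "0 < snd z \<and> snd z \<le> T")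
        case True
        have c: "max 0 (min T (snd z)) = snd z" using True by auto
        have "fst z \<in> space M" using elim by (auto simp: space_pair_measure)
        then have cont: "continuous_on {0..T} (\<lambda>s. f (b s (fst z)))"
          by (intro continuous_on_compose2[OF f(1)] continuous_on_subset[OF brownian_motionD(4)[OF bm]]) auto
        have "(\<lambda>m. ?S m (snd z) (fst z)) \<longlonglongrightarrow> f (b (snd z) (fst z))"
          unfolding simple_process_def grid_value_def by (rule grid_step_tendsto[OF _ _ cont]) (use True in auto)
        then have "(\<lambda>m. (?S m (snd z) (fst z) - f (b (snd z) (fst z)))\<^sup>2) \<longlonglongrightarrow> (f (b (snd z) (fst z)) - f (b (snd z) (fst z)))\<^sup>2"
          by (intro tendsto_intros)
        then have "(\<lambda>m. ennreal ((?S m (snd z) (fst z) - f (b (snd z) (fst z)))\<^sup>2)) \<longlonglongrightarrow> ennreal 0"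
          by (intro tendsto_ennrealI) simp
        then show ?thesis unfolding c using True by simp
      next
        case False
        then have "snd z \<notin> {0..T}" using elim by auto
        then show ?thesis by simp
      qed
    qed
  qed measurable
  then show ?thesis unfolding dist2_eq(2)[OF jm] by (simp only: nn_integral_const mult_zero_left)
qed

end

lemma emeasure_lborel_Ioc_finite: "emeasure lborel {a<..b} < \<infinity>" for a b :: real
proof -
  have "emeasure lborel {a<..b} \<le> emeasure lborel {a..b}" by (rule emeasure_mono) auto
  also have "\<dots> < \<infinity>" by (simp add: emeasure_lborel_Icc_eq)
  finally show ?thesis .
qed

lemma grid_step_integrable:
  fixes g :: "nat \<Rightarrow> real"
  shows "integrable lborel (\<lambda>s. \<Sum>k<Suc m. g k * indicator {real k * T / Suc m<..real (Suc k) * T / Suc m} s)"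
  by (intro Bochner_Integration.integrable_sum integrable_mult_right integrable_real_indicator emeasure_lborel_Ioc_finite) simp

lemma grid_step_outside:
  fixes g :: "nat \<Rightarrow> real"
  assumes T: "0 < T" and s: "\<not> (0 < s \<and> s \<le> T)"
  shows "(\<Sum>k<Suc m. g k * indicator {real k * T / Suc m<..real (Suc k) * T / Suc m} s) = 0"
proof (intro sum.neutral ballI)
  fix k assume k: "k \<in> {..<Suc m}"
  have "0 \<le> real k * T / Suc m" using T by simp
  moreover have "real (Suc k) * T / Suc m \<le> T"
  proof -
    have "real (Suc k) * T \<le> T * real (Suc m)" using k T by (subst mult.commute, intro mult_left_mono) auto
    then show ?thesis by (simp add: pos_divide_le_eq del: of_nat_Suc)
  qed
  ultimately show "g k * indicator {real k * T / Suc m<..real (Suc k) * T / Suc m} s = 0"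
    using s by (auto simp: indicator_def)
qed

lemma grid_step_sq:
  fixes g :: "nat \<Rightarrow> real"
  assumes T: "0 < T"
  shows "(\<Sum>k<Suc m. g k * indicator {real k * T / Suc m<..real (Suc k) * T / Suc m} s)\<^sup>2
    = (\<Sum>k<Suc m. (g k)\<^sup>2 * indicator {real k * T / Suc m<..real (Suc k) * T / Suc m} s)"
proof (cases "0 < s \<and> s \<le> T")
  case True
  then obtain k where "\<And>g :: nat \<Rightarrow> real. (\<Sum>k<Suc m. g k * indicator {real k * T / Suc m<..real (Suc k) * T / Suc m} s) = g k"
    using grid_step_cases[of s T m] by blast
  then show ?thesis by (simp only:)
next
  case False
  show ?thesis unfolding grid_step_outside[OF T False] by simp
qed

text \<open>The sum on the left is the squared norm of a step function, and it will be the
  conditional variance of a grid integral; convergence in mean square to \<open>H\<close> therefore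
  identifies the limit of these variances along each path.\<close>

lemma grid_step_L2_limit:
  fixes g :: "nat \<Rightarrow> nat \<Rightarrow> real" and H :: "real \<Rightarrow> real"
  assumes T: "0 < T" and H: "continuous_on {0..T} H"
    and lim: "(\<lambda>j. \<integral>\<^sup>+s\<in>{0..T}. ennreal (((\<Sum>k<Suc (m j). g j k * indicator {real k * T / Suc (m j)<..real (Suc k) * T / Suc (m j)} s) - H s)\<^sup>2) \<partial>lborel) \<longlonglongrightarrow> 0"
  shows "(\<lambda>j. T / Suc (m j) * (\<Sum>k<Suc (m j). (g j k)\<^sup>2)) \<longlonglongrightarrow> (\<integral>s\<in>{0..T}. (H s)\<^sup>2 \<partial>lborel)"
proof -
  define S where "S j s = (\<Sum>k<Suc (m j). g j k * indicator {real k * T / Suc (m j)<..real (Suc k) * T / Suc (m j)} s)" for j s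
  \<comment> \<open>\<open>H\<close> is extended by 0 outside \<open>{0..T}\<close>, where the step
    functions vanish as well, so that all integrals run over the whole line.\<close>
  define G where "G s = indicator {0..T} s * H s" for s
  have Sq: "(S j s)\<^sup>2 = (\<Sum>k<Suc (m j). (g j k)\<^sup>2 * indicator {real k * T / Suc (m j)<..real (Suc k) * T / Suc (m j)} s)" for j s
    unfolding S_def by (rule grid_step_sq[OF T])
  have Si: "integrable lborel (\<lambda>s. (S j s)\<^sup>2)" for j unfolding Sq by (rule grid_step_integrable)
  have Sm[measurable]: "S j \<in> borel_measurable lborel" for j
    unfolding S_def[abs_def] using borel_measurable_integrable[OF grid_step_integrable] .
  have Gm[measurable]: "G \<in> borel_measurable lborel"
    using borel_measurable_continuous_on_indicator[OF _ H] by (simp add: G_def[abs_def])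
  have cH: "continuous_on {0..T} (\<lambda>s. (H s)\<^sup>2)" by (intro continuous_intros H)
  have Gsq: "(G s)\<^sup>2 = indicator {0..T} s *\<^sub>R (H s)\<^sup>2" for s by (simp add: G_def indicator_def)
  have Gi: "integrable lborel (\<lambda>s. (G s)\<^sup>2)"
    using borel_integrable_atLeastAtMost'[OF cH] by (simp add: Gsq set_integrable_def)
  have Di: "integrable lborel (\<lambda>s. (S j s - G s)\<^sup>2)" for j
  proof (rule Bochner_Integration.integrable_bound)
    show "integrable lborel (\<lambda>s. 2 * (S j s)\<^sup>2 + 2 * (G s)\<^sup>2)" using Si Gi by auto
    show "AE s in lborel. norm ((S j s - G s)\<^sup>2) \<le> norm (2 * (S j s)\<^sup>2 + 2 * (G s)\<^sup>2)"
      using sq_diff_le[of "S j _" "G _" 0] by (intro AE_I2) (simp add: power2_commute)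
  qed measurable
  have conv: "(\<integral>\<^sup>+s\<in>{0..T}. ennreal ((S j s - H s)\<^sup>2) \<partial>lborel) = ennreal (\<integral>s. (S j s - G s)\<^sup>2 \<partial>lborel)" for j
  proof -
    have "ennreal ((S j s - H s)\<^sup>2) * indicator {0..T} s = ennreal ((S j s - G s)\<^sup>2)" for s
    proof (cases "s \<in> {0..T}")
      case False
      then have "S j s = 0" unfolding S_def by (intro grid_step_outside[OF T]) auto
      then show ?thesis using False by (simp add: G_def)
    qed (simp add: G_def)
    then have "(\<integral>\<^sup>+s\<in>{0..T}. ennreal ((S j s - H s)\<^sup>2) \<partial>lborel) = (\<integral>\<^sup>+s. ennreal ((S j s - G s)\<^sup>2) \<partial>lborel)" by simp
    also have "\<dots> = ennreal (\<integral>s. (S j s - G s)\<^sup>2 \<partial>lborel)" by (rule nn_integral_eq_integral[OF Di]) simp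
    finally show ?thesis .
  qed
  have "(\<lambda>j. ennreal (\<integral>s. (S j s - G s)\<^sup>2 \<partial>lborel)) \<longlonglongrightarrow> ennreal 0"
    using lim unfolding S_def[symmetric] conv by simp
  then have "(\<lambda>j. \<integral>s. (S j s - G s)\<^sup>2 \<partial>lborel) \<longlonglongrightarrow> 0"
    by (subst (asm) tendsto_ennreal_iff) (auto intro!: always_eventually integral_nonneg_AE)
  from L2_norm_tendsto[OF Si Gi Di this]
  have "(\<lambda>j. \<integral>s. (S j s)\<^sup>2 \<partial>lborel) \<longlonglongrightarrow> (\<integral>s. (G s)\<^sup>2 \<partial>lborel)" .
  then show ?thesis unfolding Sq integral_grid_step[OF T] Gsq set_lebesgue_integral_def .
qed

text \<open>The law of the pair is the product of the two laws, and Fubini's theorem is carried back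
  to \<open>M\<close>. Freezing \<open>X\<close> in the inner integral does the work of conditioning
  on it.\<close>

lemma (in prob_space) indep_iterated_integral:
  fixes F :: "'x \<times> 'y \<Rightarrow> 'c::{banach, second_countable_topology}"
  assumes X[measurable]: "X \<in> measurable M S" and Y[measurable]: "Y \<in> measurable M U"
    and indep: "\<And>A B. A \<in> sets S \<Longrightarrow> B \<in> sets U \<Longrightarrow> prob ((X -` A \<inter> space M) \<inter> (Y -` B \<inter> space M)) = prob (X -` A \<inter> space M) * prob (Y -` B \<inter> space M)"
    and F[measurable]: "F \<in> borel_measurable (S \<Otimes>\<^sub>M U)" and bd: "\<And>z. norm (F z) \<le> C"
  shows "(\<integral>\<omega>. F (X \<omega>, Y \<omega>) \<partial>M) = (\<integral>\<omega>. (\<integral>\<omega>'. F (X \<omega>, Y \<omega>') \<partial>M) \<partial>M)"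
proof -
  let ?D = "distr M S X" and ?E = "distr M U Y"
  interpret D: prob_space ?D by (rule prob_space_distr[OF X])
  interpret E: prob_space ?E by (rule prob_space_distr[OF Y])
  interpret DE: pair_prob_space ?D ?E ..
  have eq: "?D \<Otimes>\<^sub>M ?E = distr M (S \<Otimes>\<^sub>M U) (\<lambda>\<omega>. (X \<omega>, Y \<omega>))"
  proof (rule pair_measure_eqI)
    show "sigma_finite_measure ?D" "sigma_finite_measure ?E" by unfold_locales
    fix A B assume "A \<in> sets ?D" "B \<in> sets ?E"
    then have AB: "A \<in> sets S" "B \<in> sets U" by auto
    have "emeasure (distr M (S \<Otimes>\<^sub>M U) (\<lambda>\<omega>. (X \<omega>, Y \<omega>))) (A \<times> B) = emeasure M ((\<lambda>\<omega>. (X \<omega>, Y \<omega>)) -` (A \<times> B) \<inter> space M)"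
      using AB by (subst emeasure_distr) auto
    also have "(\<lambda>\<omega>. (X \<omega>, Y \<omega>)) -` (A \<times> B) \<inter> space M = (X -` A \<inter> space M) \<inter> (Y -` B \<inter> space M)" by auto
    finally show "emeasure ?D A * emeasure ?E B = emeasure (distr M (S \<Otimes>\<^sub>M U) (\<lambda>\<omega>. (X \<omega>, Y \<omega>))) (A \<times> B)"
      using AB indep[OF AB] by (simp add: emeasure_distr emeasure_eq_measure ennreal_mult')
  qed simp
  have Fi: "integrable (?D \<Otimes>\<^sub>M ?E) F"
    by (rule DE.integrable_const_bound[where B=C]) (use bd in auto)
  have "(\<integral>\<omega>. F (X \<omega>, Y \<omega>) \<partial>M) = integral\<^sup>L (?D \<Otimes>\<^sub>M ?E) F"
    unfolding eq by (subst integral_distr) auto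
  also have "\<dots> = (\<integral>x. (\<integral>y. F (x, y) \<partial>?E) \<partial>?D)" by (rule DE.integral_fst'[OF Fi, symmetric])
  also have "\<dots> = (\<integral>x. (\<integral>\<omega>'. F (x, Y \<omega>') \<partial>M) \<partial>?D)"
    by (intro Bochner_Integration.integral_cong refl integral_distr) (auto simp: space_pair_measure)
  also have "\<dots> = (\<integral>\<omega>. (\<integral>\<omega>'. F (X \<omega>, Y \<omega>') \<partial>M) \<partial>M)"
    by (rule integral_distr) measurable
  finally show ?thesis .
qed

text \<open>If \<open>h\<close> exceeds \<open>K\<close>, then \<open>K\<close> is the point of
  \<open>{-K..K}\<close> nearest to \<open>h\<close>, and \<open>P\<close> lies in that
  interval.\<close>

lemma truncation_sq_le:
  fixes h K P :: real
  assumes "0 \<le> h" "\<bar>P\<bar> \<le> K"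
  shows "(min h K - h)\<^sup>2 \<le> (P - h)\<^sup>2"
proof (cases "h \<le> K")
  case False
  then have "\<bar>min h K - h\<bar> \<le> \<bar>P - h\<bar>" using assms by auto
  then show ?thesis by (simp only: abs_le_square_iff)
qed simp

section \<open>Joint characteristic function of the motion and the stochastic integral\<close>

context brownian_pair
begin

definition grid_ito :: "('a \<Rightarrow> real) \<Rightarrow> real \<Rightarrow> nat \<Rightarrow> 'w \<Rightarrow> 'b" where
  "grid_ito f T m = simple_ito_integral (Suc m) (\<lambda>k. real k * T / Suc m) (grid_value f T m) b' T"

lemma grid_ito_eq:
  assumes T: "0 < T"
  shows "grid_ito f T m \<omega> = (\<Sum>k<Suc m. f (b (real k * T / Suc m) \<omega>) *\<^sub>R (b' (real (Suc k) * T / Suc m) \<omega> - b' (real k * T / Suc m) \<omega>))"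
  unfolding grid_ito_def simple_ito_integral_def grid_value_def
proof (intro sum.cong refl)
  fix k assume k: "k \<in> {..<Suc m}"
  have "real j * T / Suc m \<le> T" if "j \<le> Suc m" for j
  proof -
    have "real j * T \<le> T * real (Suc m)" using that T by (subst mult.commute, intro mult_left_mono) auto
    then show ?thesis by (simp add: pos_divide_le_eq del: of_nat_Suc)
  qed
  from this[of k] this[of "Suc k"] k
  have "min T (real k * T / Suc m) = real k * T / Suc m" "min T (real (Suc k) * T / Suc m) = real (Suc k) * T / Suc m"
    by (simp_all add: min.absorb2 del: of_nat_Suc)
  then show "f (b (real k * T / Suc m) \<omega>) *\<^sub>R (b' (min T (real (Suc k) * T / Suc m)) \<omega> - b' (min T (real k * T / Suc m)) \<omega>) = f (b (real k * T / Suc m) \<omega>) *\<^sub>R (b' (real (Suc k) * T / Suc m) \<omega> - b' (real k * T / Suc m) \<omega>)"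
    by (simp only:)
qed

text \<open>With the path of \<open>b\<close> frozen, the grid integral is a linear combination of
  independent Gaussian increments of \<open>b'\<close>, and \<open>brownian_grid_char\<close>
  evaluates it; the coefficients are \<open>u\<close> scaled by the values of \<open>f\<close> along
  the path.\<close>

lemma grid_ito_char:
  assumes T: "0 < T" and f: "continuous_on UNIV f"
  shows "(\<integral>\<omega>. iexp (a \<bullet> b T \<omega>) * iexp (u \<bullet> grid_ito f T m \<omega>) \<partial>M)
    = (\<integral>\<omega>. iexp (a \<bullet> b T \<omega>) * of_real (exp (- ((norm u)\<^sup>2 * (T / Suc m * (\<Sum>k<Suc m. (f (b (real k * T / Suc m) \<omega>))\<^sup>2)) / 2))) \<partial>M)"
proof -
  have fm[measurable]: "f \<in> borel_measurable borel" using f by (rule borel_measurable_continuous_onI)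
  \<comment> \<open>The index \<open>Suc m\<close>, whose time is \<open>T\<close>, is included
    because \<open>b T\<close> occurs in the integrand.\<close>
  define X where "X = (\<lambda>\<omega>. \<lambda>k\<in>{..Suc m}. b (real k * T / Suc m) \<omega>)"
  define Y where "Y = (\<lambda>\<omega>. \<lambda>k\<in>{..<Suc m}. b' (real (Suc k) * T / Suc m) \<omega> - b' (real k * T / Suc m) \<omega>)"
  define F where "F = (\<lambda>(x, y). iexp (a \<bullet> x (Suc m)) * iexp (\<Sum>k<Suc m. f (x k) * (u \<bullet> y k)) :: complex)"
  let ?S = "PiM {..Suc m} (\<lambda>_. borel :: 'a measure)" and ?U = "PiM {..<Suc m} (\<lambda>_. borel :: 'b measure)"
  have t0: "0 \<le> real k * T / Suc m" for k using T by simp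
  have Xg: "X \<in> measurable (generated_algebra M b {0..}) ?S"
    unfolding X_def by (intro measurable_restrict generated_algebra_component) (use t0 in auto)
  have Yg: "Y \<in> measurable (generated_algebra M b' {0..}) ?U"
    unfolding Y_def by (intro measurable_restrict borel_measurable_diff generated_algebra_component) (use t0 in \<open>auto simp del: of_nat_Suc\<close>)
  have gb: "sets (generated_algebra M b {0..}) \<subseteq> events" by (rule generated_algebra_least) auto
  have gb': "sets (generated_algebra M b' {0..}) \<subseteq> events" by (rule generated_algebra_least) auto
  have Xm: "X \<in> measurable M ?S" by (rule measurable_sub_sets[OF Xg _ gb]) simp
  have Ym: "Y \<in> measurable M ?U" by (rule measurable_sub_sets[OF Yg _ gb']) simp
  have TT: "real (Suc m) * T / Suc m = T" by simp
  have FXY: "F (X \<omega>, Y \<omega>') = iexp (a \<bullet> b T \<omega>) * iexp (\<Sum>k<Suc m. (f (b (real k * T / Suc m) \<omega>) *\<^sub>R u) \<bullet> (b' (real (Suc k) * T / Suc m) \<omega>' - b' (real k * T / Suc m) \<omega>'))" for \<omega> \<omega>'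
  proof -
    have "X \<omega> (Suc m) = b T \<omega>" unfolding X_def using TT by (simp del: of_nat_Suc)
    moreover have "(\<Sum>k<Suc m. f (X \<omega> k) * (u \<bullet> Y \<omega>' k)) = (\<Sum>k<Suc m. (f (b (real k * T / Suc m) \<omega>) *\<^sub>R u) \<bullet> (b' (real (Suc k) * T / Suc m) \<omega>' - b' (real k * T / Suc m) \<omega>'))"
      by (intro sum.cong refl) (simp add: X_def Y_def del: of_nat_Suc)
    ultimately show ?thesis by (simp only: F_def prod.case)
  qed
  have "(\<integral>\<omega>. F (X \<omega>, Y \<omega>) \<partial>M) = (\<integral>\<omega>. (\<integral>\<omega>'. F (X \<omega>, Y \<omega>') \<partial>M) \<partial>M)"
  proof (rule indep_iterated_integral[OF Xm Ym, where C=1])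
    fix A B assume A: "A \<in> sets ?S" and B: "B \<in> sets ?U"
    have "X -` A \<inter> space M \<in> sets (generated_algebra M b {0..})" using measurable_sets[OF Xg A] by simp
    moreover have "Y -` B \<inter> space M \<in> sets (generated_algebra M b' {0..})" using measurable_sets[OF Yg B] by simp
    ultimately show "prob ((X -` A \<inter> space M) \<inter> (Y -` B \<inter> space M)) = prob (X -` A \<inter> space M) * prob (Y -` B \<inter> space M)"
      using indep unfolding indep_processes_def indep_sets2_eq by blast
  next
    have "(\<lambda>z. f (fst z k)) \<in> borel_measurable (?S \<Otimes>\<^sub>M ?U)" if "k \<in> {..Suc m}" for k
      using that by (intro measurable_compose[OF _ fm] measurable_compose[OF measurable_fst] measurable_component_singleton)
    moreover have "(\<lambda>z. u \<bullet> snd z k) \<in> borel_measurable (?S \<Otimes>\<^sub>M ?U)" if "k \<in> {..<Suc m}" for k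
      using that by (intro borel_measurable_inner borel_measurable_const measurable_compose[OF measurable_snd] measurable_component_singleton)
    moreover have "(\<lambda>z. a \<bullet> fst z (Suc m)) \<in> borel_measurable (?S \<Otimes>\<^sub>M ?U)"
      by (intro borel_measurable_inner borel_measurable_const measurable_compose[OF measurable_fst] measurable_component_singleton) auto
    ultimately have m: "(\<lambda>z. a \<bullet> fst z (Suc m)) \<in> borel_measurable (?S \<Otimes>\<^sub>M ?U)"
      "(\<lambda>z. \<Sum>k<Suc m. f (fst z k) * (u \<bullet> snd z k)) \<in> borel_measurable (?S \<Otimes>\<^sub>M ?U)"
      by (auto intro!: borel_measurable_sum borel_measurable_times simp del: sum.lessThan_Suc)
    have ie: "(\<lambda>x. iexp x) \<in> borel_measurable borel" by measurable
    show "F \<in> borel_measurable (?S \<Otimes>\<^sub>M ?U)"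
      unfolding F_def case_prod_beta'
      by (intro borel_measurable_times measurable_compose[OF m(1) ie] measurable_compose[OF m(2) ie])
    show "norm (F z) \<le> 1" for z by (simp add: F_def case_prod_beta norm_mult)
  qed
  also have "\<dots> = (\<integral>\<omega>. iexp (a \<bullet> b T \<omega>) * of_real (exp (- ((norm u)\<^sup>2 * (T / Suc m * (\<Sum>k<Suc m. (f (b (real k * T / Suc m) \<omega>))\<^sup>2)) / 2))) \<partial>M)"
  proof (rule Bochner_Integration.integral_cong[OF refl])
    fix \<omega>
    have "(\<Sum>k<Suc m. (norm (f (b (real k * T / Suc m) \<omega>) *\<^sub>R u))\<^sup>2) = (norm u)\<^sup>2 * (\<Sum>k<Suc m. (f (b (real k * T / Suc m) \<omega>))\<^sup>2)"
      unfolding sum_distrib_left by (intro sum.cong refl) (simp add: power_mult_distrib)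
    then have e: "- (T / Suc m * (\<Sum>k<Suc m. (norm (f (b (real k * T / Suc m) \<omega>) *\<^sub>R u))\<^sup>2)) / 2
      = - ((norm u)\<^sup>2 * (T / Suc m * (\<Sum>k<Suc m. (f (b (real k * T / Suc m) \<omega>))\<^sup>2)) / 2)"
      by (simp only: mult.left_commute minus_divide_left)
    show "(\<integral>\<omega>'. F (X \<omega>, Y \<omega>') \<partial>M) = iexp (a \<bullet> b T \<omega>) * of_real (exp (- ((norm u)\<^sup>2 * (T / Suc m * (\<Sum>k<Suc m. (f (b (real k * T / Suc m) \<omega>))\<^sup>2)) / 2)))"
      unfolding FXY integral_mult_right_zero brownian_grid_char[OF bm' T] e ..
  qed
  finally have *: "(\<integral>\<omega>. F (X \<omega>, Y \<omega>) \<partial>M) = (\<integral>\<omega>. iexp (a \<bullet> b T \<omega>) * of_real (exp (- ((norm u)\<^sup>2 * (T / Suc m * (\<Sum>k<Suc m. (f (b (real k * T / Suc m) \<omega>))\<^sup>2)) / 2))) \<partial>M)" .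
  have "iexp (a \<bullet> b T \<omega>) * iexp (u \<bullet> grid_ito f T m \<omega>) = F (X \<omega>, Y \<omega>)" for \<omega>
    unfolding FXY grid_ito_eq[OF T] by (simp only: inner_sum_right inner_scaleR_right inner_scaleR_left)
  then show ?thesis unfolding *[symmetric] by (simp only:)
qed

text \<open>Trades the sequence supplied by \<open>is_ito_integral\<close> for step functions of the
  path of \<open>b\<close> alone. Both are close to the integrand, hence to each other, and the
  isometry transfers this closeness to the integrals.\<close>

lemma grid_approx_exists:
  assumes T: "0 < T" and g: "continuous_on UNIV g" "\<And>z. 0 \<le> g z" and e: "0 < e"
    and ito: "is_ito_integral M filt b' (\<lambda>s \<omega>. g (b s \<omega>)) T J"
  shows "\<exists>K m. 0 \<le> K \<and>
    dist2 T (\<lambda>s \<omega>. simple_process (Suc m) (\<lambda>k. real k * T / Suc m) (grid_value (\<lambda>z. min (g z) K) T m) s \<omega>) (\<lambda>s \<omega>. g (b s \<omega>)) \<le> ennreal e \<and>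
    (\<integral>\<^sup>+\<omega>. ennreal ((norm (grid_ito (\<lambda>z. min (g z) K) T m \<omega> - J \<omega>))\<^sup>2) \<partial>M) \<le> ennreal e"
proof -
  define H where "H s \<omega> = g (b s \<omega>)" for s \<omega>
  from ito obtain n \<tau> \<xi> where simp: "\<And>k::nat. simple_integrand M filt (n k) (\<tau> k) (\<xi> k)"
    and l1: "(\<lambda>k. dist2 T (\<lambda>s \<omega>. simple_process (n k) (\<tau> k) (\<xi> k) s \<omega>) H) \<longlonglongrightarrow> 0"
    and l2: "(\<lambda>k. \<integral>\<^sup>+\<omega>. ennreal ((norm (simple_ito_integral (n k) (\<tau> k) (\<xi> k) b' T \<omega> - J \<omega>))\<^sup>2) \<partial>M) \<longlonglongrightarrow> 0"
    unfolding is_ito_integral_def dist2_def H_def by blast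
  have Jm: "J \<in> borel_measurable M" using ito by (simp add: is_ito_integral_def)
  define P where "P k s \<omega> = simple_process (n k) (\<tau> k) (\<xi> k) s \<omega>" for k s \<omega>
  define I where "I k \<omega> = simple_ito_integral (n k) (\<tau> k) (\<xi> k) b' T \<omega>" for k \<omega>
  define D where "D = real DIM('b)"
  have D: "0 \<le> D" by (simp add: D_def)
  \<comment> \<open>The estimates below end in \<open>4 * \<delta>\<close> and
    \<open>20 * D * \<delta> + 2 * \<delta>\<close>, both at most
    \<open>(20 * D + 4) * \<delta> = e\<close>.\<close>
  define \<delta> where "\<delta> = e / (20 * D + 4)"
  have \<delta>: "0 < \<delta>" using e D by (simp add: \<delta>_def)
  have "eventually (\<lambda>k. dist2 T (P k) H < ennreal \<delta>) sequentially"
    using order_tendstoD(2)[OF l1, of "ennreal \<delta>"] \<delta> by (simp add: P_def[abs_def])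
  moreover have "eventually (\<lambda>k. (\<integral>\<^sup>+\<omega>. ennreal ((norm (I k \<omega> - J \<omega>))\<^sup>2) \<partial>M) < ennreal \<delta>) sequentially"
    using order_tendstoD(2)[OF l2, of "ennreal \<delta>"] \<delta> by (simp add: I_def)
  ultimately have "eventually (\<lambda>k. dist2 T (P k) H < ennreal \<delta> \<and> (\<integral>\<^sup>+\<omega>. ennreal ((norm (I k \<omega> - J \<omega>))\<^sup>2) \<partial>M) < ennreal \<delta>) sequentially"
    by (rule eventually_conj)
  then obtain k where "dist2 T (P k) H < ennreal \<delta> \<and> (\<integral>\<^sup>+\<omega>. ennreal ((norm (I k \<omega> - J \<omega>))\<^sup>2) \<partial>M) < ennreal \<delta>"
    unfolding eventually_sequentially by blast
  then have k: "dist2 T (P k) H \<le> ennreal \<delta>" "(\<integral>\<^sup>+\<omega>. ennreal ((norm (I k \<omega> - J \<omega>))\<^sup>2) \<partial>M) \<le> ennreal \<delta>"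
    by (auto intro: less_imp_le)
  have "\<exists>C. \<forall>\<omega>\<in>space M. \<bar>\<xi> k i \<omega>\<bar> \<le> C" if "i < n k" for i
    using simp[of k] that by (auto simp: simple_integrand_def bounded_iff)
  then obtain C where C: "\<And>i \<omega>. i < n k \<Longrightarrow> \<omega> \<in> space M \<Longrightarrow> \<bar>\<xi> k i \<omega>\<bar> \<le> C i" by metis
  \<comment> \<open>A bound for the simple process \<open>P k\<close>. By
    \<open>truncation_sq_le\<close>, truncating \<open>g\<close> at this level costs no more than
    the distance of \<open>P k\<close> from the integrand.\<close>
  define K where "K = (\<Sum>i<n k. \<bar>C i\<bar>)"
  have K0: "0 \<le> K" by (simp add: K_def sum_nonneg)
  have PK: "\<bar>P k s \<omega>\<bar> \<le> K" if "\<omega> \<in> space M" for s \<omega>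
    unfolding P_def simple_process_def K_def
  proof (rule order_trans[OF sum_abs], rule sum_mono)
    fix i assume "i \<in> {..<n k}"
    then have "\<bar>\<xi> k i \<omega>\<bar> \<le> \<bar>C i\<bar>" using C[of i \<omega>] that by auto
    then show "\<bar>\<xi> k i \<omega> * indicator {\<tau> k i<..\<tau> k (Suc i)} s\<bar> \<le> \<bar>C i\<bar>" by (simp add: indicator_def)
  qed
  define f where "f z = min (g z) K" for z
  have f: "continuous_on UNIV f" "\<And>z. \<bar>f z\<bar> \<le> K"
    using g K0 by (auto simp: f_def[abs_def] intro!: continuous_intros)
  define S where "S m s \<omega> = simple_process (Suc m) (\<lambda>k. real k * T / Suc m) (grid_value f T m) s \<omega>" for m s \<omega>
  have jm: "jointly_measurable T (P k)" "jointly_measurable T (S m)" "jointly_measurable T H" "jointly_measurable T (\<lambda>s \<omega>. f (b s \<omega>))" for m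
    unfolding P_def[abs_def] S_def[abs_def] H_def[abs_def]
    by (rule jointly_measurable_simple[OF simp] jointly_measurable_simple[OF grid_simple_integrand[OF T f]]
       jointly_measurable_b[OF less_imp_le[OF T] g(1)] jointly_measurable_b[OF less_imp_le[OF T] f(1)])+
  have "(\<lambda>m. dist2 T (S m) (\<lambda>s \<omega>. f (b s \<omega>))) \<longlonglongrightarrow> 0"
    using grid_approx_tendsto[OF T f] by (simp add: S_def[abs_def])
  then have "eventually (\<lambda>m. dist2 T (S m) (\<lambda>s \<omega>. f (b s \<omega>)) < ennreal \<delta>) sequentially"
    using \<delta> by (intro order_tendstoD(2)) auto
  then obtain m where "dist2 T (S m) (\<lambda>s \<omega>. f (b s \<omega>)) < ennreal \<delta>" unfolding eventually_sequentially by blast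
  then have m: "dist2 T (S m) (\<lambda>s \<omega>. f (b s \<omega>)) \<le> ennreal \<delta>" by simp
  have "dist2 T (\<lambda>s \<omega>. f (b s \<omega>)) H \<le> dist2 T (P k) H"
    unfolding dist2_def H_def f_def
    by (intro nn_integral_mono mult_right_mono ennreal_leI truncation_sq_le g PK) auto
  then have fH: "dist2 T (\<lambda>s \<omega>. f (b s \<omega>)) H \<le> ennreal \<delta>" using k(1) by simp
  have "dist2 T (S m) H \<le> 2 * dist2 T (S m) (\<lambda>s \<omega>. f (b s \<omega>)) + 2 * dist2 T (\<lambda>s \<omega>. f (b s \<omega>)) H"
    by (rule dist2_triangle[OF jm(2,4,3)])
  also have "\<dots> \<le> 2 * ennreal \<delta> + 2 * ennreal \<delta>" by (intro add_mono mult_left_mono m fH) auto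
  also have "\<dots> = ennreal (4 * \<delta>)" using \<delta> by (simp add: ennreal_mult'[symmetric] ennreal_plus[symmetric] numeral_mult_ennreal del: ennreal_plus)
  finally have SH: "dist2 T (S m) H \<le> ennreal (4 * \<delta>)" .
  have "dist2 T (S m) (P k) \<le> 2 * dist2 T (S m) H + 2 * dist2 T H (P k)"
    by (rule dist2_triangle[OF jm(2,3,1)])
  also have "\<dots> \<le> 2 * ennreal (4 * \<delta>) + 2 * ennreal \<delta>"
    using k(1) by (intro add_mono mult_left_mono SH) (auto simp: dist2_commute[of T H])
  also have "\<dots> = ennreal (10 * \<delta>)" using \<delta> by (simp add: ennreal_plus[symmetric] numeral_mult_ennreal del: ennreal_plus)
  finally have SP: "dist2 T (S m) (P k) \<le> ennreal (10 * \<delta>)" .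
  have iso: "(\<integral>\<^sup>+\<omega>. ennreal ((norm (grid_ito f T m \<omega> - I k \<omega>))\<^sup>2) \<partial>M) = ennreal D * dist2 T (S m) (P k)"
    unfolding grid_ito_def I_def dist2_def S_def P_def D_def
    by (rule ito_isometry_diff[OF less_imp_le[OF T] grid_simple_integrand[OF T f] simp])
  have Gm: "grid_ito f T m \<in> borel_measurable M"
  proof -
    have fm: "f \<in> borel_measurable borel" using f(1) by (rule borel_measurable_continuous_onI)
    show ?thesis unfolding grid_ito_eq[OF T, abs_def] using T
      by (intro borel_measurable_sum borel_measurable_scaleR measurable_compose[OF b_measurable fm] borel_measurable_diff b'_measurable) auto
  qed
  have Im: "I k \<in> borel_measurable M"
    unfolding I_def[abs_def] simple_ito_integral_def
  proof (intro borel_measurable_sum borel_measurable_scaleR borel_measurable_diff b'_measurable)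
    fix i assume i: "i \<in> {..<n k}"
    have pos: "0 \<le> \<tau> k i" if "i \<le> n k" for i
      using that
    proof (induction i)
      case 0 then show ?case using simp[of k] by (simp add: simple_integrand_def)
    next
      case (Suc i)
      then have "\<tau> k i \<le> \<tau> k (Suc i)" using simp[of k] by (auto simp: simple_integrand_def)
      then show ?case using Suc by simp
    qed
    show "0 \<le> min T (\<tau> k (Suc i))" "0 \<le> min T (\<tau> k i)" using pos[of i] pos[of "Suc i"] i T by auto
    show "\<xi> k i \<in> borel_measurable M" using simp[of k] i by (auto simp: simple_integrand_def intro: filt_measurable)
  qed
  have "(\<integral>\<^sup>+\<omega>. ennreal ((norm (grid_ito f T m \<omega> - J \<omega>))\<^sup>2) \<partial>M)
    \<le> (\<integral>\<^sup>+\<omega>. 2 * ennreal ((norm (grid_ito f T m \<omega> - I k \<omega>))\<^sup>2) + 2 * ennreal ((norm (I k \<omega> - J \<omega>))\<^sup>2) \<partial>M)"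
  proof (rule nn_integral_mono)
    fix \<omega>
    have "ennreal ((norm (grid_ito f T m \<omega> - J \<omega>))\<^sup>2) \<le> ennreal (2 * (norm (grid_ito f T m \<omega> - I k \<omega>))\<^sup>2 + 2 * (norm (I k \<omega> - J \<omega>))\<^sup>2)"
      by (intro ennreal_leI norm_sq_diff_le)
    then show "ennreal ((norm (grid_ito f T m \<omega> - J \<omega>))\<^sup>2) \<le> 2 * ennreal ((norm (grid_ito f T m \<omega> - I k \<omega>))\<^sup>2) + 2 * ennreal ((norm (I k \<omega> - J \<omega>))\<^sup>2)"
      by (simp add: ennreal_plus ennreal_mult)
  qed
  also have "\<dots> = 2 * (\<integral>\<^sup>+\<omega>. ennreal ((norm (grid_ito f T m \<omega> - I k \<omega>))\<^sup>2) \<partial>M) + 2 * (\<integral>\<^sup>+\<omega>. ennreal ((norm (I k \<omega> - J \<omega>))\<^sup>2) \<partial>M)"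
    using Gm Im Jm by (subst nn_integral_add) (auto simp: nn_integral_cmult)
  also have "\<dots> \<le> 2 * (ennreal D * ennreal (10 * \<delta>)) + 2 * ennreal \<delta>"
    unfolding iso by (intro add_mono mult_left_mono SP k(2)) auto
  also have "\<dots> = ennreal (20 * D * \<delta> + 2 * \<delta>)"
    using \<delta> D by (simp add: ennreal_mult[symmetric] ennreal_plus[symmetric] numeral_mult_ennreal del: ennreal_plus)
  also have "\<dots> \<le> ennreal e"
  proof (rule ennreal_leI)
    have "(20 * D + 4) * \<delta> = e" using D by (simp add: \<delta>_def)
    then show "20 * D * \<delta> + 2 * \<delta> \<le> e" using \<delta> by (simp add: algebra_simps)
  qed
  finally have r: "(\<integral>\<^sup>+\<omega>. ennreal ((norm (grid_ito f T m \<omega> - J \<omega>))\<^sup>2) \<partial>M) \<le> ennreal e" .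
  have "4 * \<delta> \<le> (20 * D + 4) * \<delta>" using \<delta> D by (intro mult_right_mono) auto
  also have "\<dots> = e" using D by (simp add: \<delta>_def)
  finally have "dist2 T (S m) H \<le> ennreal e" using SH by (meson ennreal_leI order_trans)
  with r K0 show ?thesis unfolding f_def[abs_def] S_def[abs_def] H_def[abs_def] by blast
qed

text \<open>Limit of \<open>grid_ito_char\<close> along approximations with error
  \<open>(1/2)^j\<close>. This rate gives almost sure convergence of the integrals and of their
  conditional variances, and all integrands have modulus at most 1.\<close>

lemma ito_integral_char:
  assumes T: "0 < T" and g: "continuous_on UNIV g" "\<And>z. 0 \<le> g z"
    and ito: "is_ito_integral M filt b' (\<lambda>s \<omega>. g (b s \<omega>)) T J"
  shows "(\<integral>\<omega>. iexp (a \<bullet> b T \<omega>) * iexp (u \<bullet> J \<omega>) \<partial>M)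
    = (\<integral>\<omega>. iexp (a \<bullet> b T \<omega>) * of_real (exp (- ((norm u)\<^sup>2 * (\<integral>s\<in>{0..T}. (g (b s \<omega>))\<^sup>2 \<partial>lborel) / 2))) \<partial>M)"
proof -
  define Q where "Q j K m \<longleftrightarrow> 0 \<le> K \<and>
    dist2 T (\<lambda>s \<omega>. simple_process (Suc m) (\<lambda>k. real k * T / Suc m) (grid_value (\<lambda>z. min (g z) K) T m) s \<omega>) (\<lambda>s \<omega>. g (b s \<omega>)) \<le> ennreal ((1/2)^j) \<and>
    (\<integral>\<^sup>+\<omega>. ennreal ((norm (grid_ito (\<lambda>z. min (g z) K) T m \<omega> - J \<omega>))\<^sup>2) \<partial>M) \<le> ennreal ((1/2)^j)" for j :: nat and K m
  have "\<forall>j. \<exists>K m. Q j K m"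
    unfolding Q_def by (intro allI grid_approx_exists[OF T g _ ito]) simp
  then obtain K m where Q: "\<And>j::nat. Q j (K j) (m j)" by metis
  note K = Q[unfolded Q_def, THEN conjunct1]
    and d1 = Q[unfolded Q_def, THEN conjunct2, THEN conjunct1]
    and d2 = Q[unfolded Q_def, THEN conjunct2, THEN conjunct2]
  define f where "f j z = min (g z) (K j)" for j z
  have f: "continuous_on UNIV (f j)" "\<bar>f j z\<bar> \<le> K j" for j z
    using g K by (auto simp: f_def[abs_def] intro!: continuous_intros)
  have fm: "f j \<in> borel_measurable borel" for j using f(1) by (rule borel_measurable_continuous_onI)
  define S where "S j s \<omega> = simple_process (Suc (m j)) (\<lambda>k. real k * T / Suc (m j)) (grid_value (f j) T (m j)) s \<omega>" for j s \<omega>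
  define I where "I j = grid_ito (f j) T (m j)" for j
  define V where "V \<omega> = (\<integral>s\<in>{0..T}. (g (b s \<omega>))\<^sup>2 \<partial>lborel)" for \<omega>
  \<comment> \<open>By \<open>grid_ito_char\<close>, the conditional variance of each coordinate of
    \<open>I j\<close> given the path of \<open>b\<close>.\<close>
  define R where "R j \<omega> = T / Suc (m j) * (\<Sum>k<Suc (m j). (f j (b (real k * T / Suc (m j)) \<omega>))\<^sup>2)" for j \<omega>
  have Jm[measurable]: "J \<in> borel_measurable M" using ito by (simp add: is_ito_integral_def)
  have Im[measurable]: "I j \<in> borel_measurable M" for j
    unfolding I_def grid_ito_eq[OF T, abs_def] using T
    by (intro borel_measurable_sum borel_measurable_scaleR measurable_compose[OF b_measurable fm] borel_measurable_diff b'_measurable) auto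
  have Rm[measurable]: "R j \<in> borel_measurable M" for j
    unfolding R_def[abs_def] using T
    by (intro borel_measurable_times borel_measurable_const borel_measurable_sum borel_measurable_power measurable_compose[OF b_measurable fm]) auto
  have [measurable]: "b T \<in> borel_measurable M" using T by simp
  have jm: "jointly_measurable T (S j)" "jointly_measurable T (\<lambda>s \<omega>. g (b s \<omega>))" for j
    unfolding S_def[abs_def]
    by (rule jointly_measurable_simple[OF grid_simple_integrand[OF T f]] jointly_measurable_b[OF less_imp_le[OF T] g(1)])+
  have "AE \<omega> in M. (\<lambda>j. \<integral>\<^sup>+s\<in>{0..T}. ennreal ((S j s \<omega> - g (b s \<omega>))\<^sup>2) \<partial>lborel) \<longlonglongrightarrow> 0"
    using d1 by (intro nn_integral_summable_AE_tendsto_0 dist2_eq(3)[OF jm]) (simp add: dist2_def S_def f_def[abs_def])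
  moreover have "AE \<omega> in M. (\<lambda>j. ennreal ((norm (I j \<omega> - J \<omega>))\<^sup>2)) \<longlonglongrightarrow> 0"
  proof (rule nn_integral_summable_AE_tendsto_0)
    show "(\<integral>\<^sup>+\<omega>. ennreal ((norm (I j \<omega> - J \<omega>))\<^sup>2) \<partial>M) \<le> ennreal ((1/2)^j)" for j
      using d2[of j] by (simp only: I_def f_def[abs_def])
  qed measurable
  ultimately have lims: "AE \<omega> in M. (\<lambda>j. R j \<omega>) \<longlonglongrightarrow> V \<omega> \<and> (\<lambda>j. I j \<omega>) \<longlonglongrightarrow> J \<omega>"
    using AE_space
  proof eventually_elim
    case (elim \<omega>)
    have cont: "continuous_on {0..T} (\<lambda>s. g (b s \<omega>))"
      using elim(3) by (intro continuous_on_compose2[OF g(1)] continuous_on_subset[OF brownian_motionD(4)[OF bm]]) auto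
    have "(\<lambda>j. R j \<omega>) \<longlonglongrightarrow> V \<omega>"
      unfolding R_def V_def
      by (rule grid_step_L2_limit[OF T cont]) (use elim(1) in \<open>simp only: S_def simple_process_def grid_value_def\<close>)
    moreover have "(\<lambda>j. (norm (I j \<omega> - J \<omega>))\<^sup>2) \<longlonglongrightarrow> 0"
    proof -
      have "(\<lambda>j. ennreal ((norm (I j \<omega> - J \<omega>))\<^sup>2)) \<longlonglongrightarrow> ennreal 0" using elim(2) by (simp only: ennreal_0)
      then show ?thesis by (subst (asm) tendsto_ennreal_iff) auto
    qed
    then have "(\<lambda>j. norm (I j \<omega> - J \<omega>)) \<longlonglongrightarrow> 0"
      using tendsto_real_sqrt by fastforce
    then have "(\<lambda>j. I j \<omega>) \<longlonglongrightarrow> J \<omega>" by (simp only: tendsto_norm_zero_iff LIM_zero_iff)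
    ultimately show ?case by simp
  qed
  have Vm: "(\<lambda>\<omega>. V \<omega>) \<in> borel_measurable M"
  proof -
    have "(\<lambda>\<omega>. \<integral>s. indicator {0..T} s *\<^sub>R (g (b (max 0 (min T s)) \<omega>))\<^sup>2 \<partial>lborel) \<in> borel_measurable M"
      using jm(2) unfolding jointly_measurable_def
      by (intro lborel.borel_measurable_lebesgue_integral) (simp add: case_prod_beta')
    moreover have "V \<omega> = (\<integral>s. indicator {0..T} s *\<^sub>R (g (b (max 0 (min T s)) \<omega>))\<^sup>2 \<partial>lborel)" for \<omega>
      unfolding V_def set_lebesgue_integral_def
      by (intro Bochner_Integration.integral_cong) (auto simp: indicator_def min_def max_def)
    ultimately show ?thesis by simp
  qed
  have L: "(\<lambda>j. \<integral>\<omega>. iexp (a \<bullet> b T \<omega>) * iexp (u \<bullet> I j \<omega>) \<partial>M) \<longlonglongrightarrow> (\<integral>\<omega>. iexp (a \<bullet> b T \<omega>) * iexp (u \<bullet> J \<omega>) \<partial>M)"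
  proof (rule integral_dominated_convergence[where w="\<lambda>_. 1"])
    show "AE \<omega> in M. (\<lambda>j. iexp (a \<bullet> b T \<omega>) * iexp (u \<bullet> I j \<omega>)) \<longlonglongrightarrow> iexp (a \<bullet> b T \<omega>) * iexp (u \<bullet> J \<omega>)"
      using lims by eventually_elim (intro tendsto_intros, auto)
  qed (auto simp: norm_mult)
  have R: "(\<lambda>j. \<integral>\<omega>. iexp (a \<bullet> b T \<omega>) * of_real (exp (- ((norm u)\<^sup>2 * R j \<omega> / 2))) \<partial>M)
    \<longlonglongrightarrow> (\<integral>\<omega>. iexp (a \<bullet> b T \<omega>) * of_real (exp (- ((norm u)\<^sup>2 * V \<omega> / 2))) \<partial>M)"
  proof (rule integral_dominated_convergence[where w="\<lambda>_. 1"])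
    show "AE \<omega> in M. (\<lambda>j. iexp (a \<bullet> b T \<omega>) * of_real (exp (- ((norm u)\<^sup>2 * R j \<omega> / 2)))) \<longlonglongrightarrow> iexp (a \<bullet> b T \<omega>) * of_real (exp (- ((norm u)\<^sup>2 * V \<omega> / 2)))"
      using lims by eventually_elim (intro tendsto_intros, auto)
    have "0 \<le> R j \<omega>" for j \<omega> unfolding R_def using T by (intro mult_nonneg_nonneg sum_nonneg) auto
    then show "AE \<omega> in M. norm (iexp (a \<bullet> b T \<omega>) * of_real (exp (- ((norm u)\<^sup>2 * R j \<omega> / 2)))) \<le> 1" for j
      by (intro AE_I2) (simp add: norm_mult)
  qed (use Vm in \<open>auto\<close>)
  have "(\<integral>\<omega>. iexp (a \<bullet> b T \<omega>) * iexp (u \<bullet> I j \<omega>) \<partial>M) = (\<integral>\<omega>. iexp (a \<bullet> b T \<omega>) * of_real (exp (- ((norm u)\<^sup>2 * R j \<omega> / 2))) \<partial>M)" for j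
    unfolding I_def R_def by (rule grid_ito_char[OF T f(1)])
  then show ?thesis using L R LIMSEQ_unique unfolding V_def by (simp only:) blast
qed

end

section \<open>Brownian motion built from the bridge\<close>

text \<open>Reduction to \<open>distr_PiM_eqI\<close>: vectors are split into real coordinates
  indexed by \<open>I \<times> Basis\<close>, and \<open>R\<close> reassembles them.\<close>

lemma vector_law_eqI:
  fixes Y :: "'i \<Rightarrow> 'w \<Rightarrow> 'a::euclidean_space" and Y' :: "'i \<Rightarrow> 'v \<Rightarrow> 'a"
    and \<Phi> :: "('i \<Rightarrow> 'a) \<Rightarrow> 'c::{banach, second_countable_topology}"
  assumes P: "prob_space M" "prob_space M'" and I: "finite I"
    and Y[measurable]: "\<And>i. i \<in> I \<Longrightarrow> Y i \<in> borel_measurable M" and Y'[measurable]: "\<And>i. i \<in> I \<Longrightarrow> Y' i \<in> borel_measurable M'"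
    and eq: "\<And>a. (\<integral>\<omega>. iexp (\<Sum>i\<in>I. a i \<bullet> Y i \<omega>) \<partial>M) = (\<integral>\<omega>. iexp (\<Sum>i\<in>I. a i \<bullet> Y' i \<omega>) \<partial>M')"
    and \<Phi>: "\<Phi> \<in> borel_measurable (PiM I (\<lambda>_. borel))"
  shows "(\<integral>\<omega>. \<Phi> (\<lambda>i\<in>I. Y i \<omega>) \<partial>M) = (\<integral>\<omega>. \<Phi> (\<lambda>i\<in>I. Y' i \<omega>) \<partial>M')"
proof -
  let ?K = "I \<times> (Basis :: 'a set)"
  let ?B = "PiM ?K (\<lambda>_. borel :: real measure)"
  define R where "R f = (\<lambda>i\<in>I. \<Sum>e\<in>Basis. f (i, e) *\<^sub>R e)" for f :: "'i \<times> 'a \<Rightarrow> real"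
  have R: "R \<in> measurable ?B (PiM I (\<lambda>_. borel))"
    unfolding R_def by (intro measurable_restrict borel_measurable_sum borel_measurable_scaleR borel_measurable_const measurable_component_singleton) auto
  have Rr: "R (\<lambda>p\<in>?K. Z (fst p) \<omega> \<bullet> snd p) = (\<lambda>i\<in>I. Z i \<omega>)" for Z :: "'i \<Rightarrow> 'z \<Rightarrow> 'a" and \<omega>
    unfolding R_def by (intro restrict_ext) (simp add: euclidean_representation)
  have c: "(\<Sum>p\<in>?K. c p * (z (fst p) \<bullet> snd p)) = (\<Sum>i\<in>I. (\<Sum>e\<in>Basis. c (i, e) *\<^sub>R e) \<bullet> z i)" for c :: "'i \<times> 'a \<Rightarrow> real" and z :: "'i \<Rightarrow> 'a"
    unfolding sum.cartesian_product' inner_sum_left by (intro sum.cong refl) (simp add: inner_commute)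
  have D: "distr M ?B (\<lambda>\<omega>. \<lambda>p\<in>?K. Y (fst p) \<omega> \<bullet> snd p) = distr M' ?B (\<lambda>\<omega>. \<lambda>p\<in>?K. Y' (fst p) \<omega> \<bullet> snd p)"
  proof (rule distr_PiM_eqI[OF P])
    show "(\<integral>\<omega>. iexp (\<Sum>p\<in>?K. c p * (Y (fst p) \<omega> \<bullet> snd p)) \<partial>M) = (\<integral>\<omega>. iexp (\<Sum>p\<in>?K. c p * (Y' (fst p) \<omega> \<bullet> snd p)) \<partial>M')" for c
      unfolding c[of _ "\<lambda>i. Y i \<omega>" for \<omega>] c[of _ "\<lambda>i. Y' i \<omega>" for \<omega>] by (rule eq)
  qed (use I in auto)
  have "(\<integral>\<omega>. \<Phi> (\<lambda>i\<in>I. Z i \<omega>) \<partial>N) = (\<integral>f. \<Phi> (R f) \<partial>distr N ?B (\<lambda>\<omega>. \<lambda>p\<in>?K. Z (fst p) \<omega> \<bullet> snd p))"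
    if "\<And>i. i \<in> I \<Longrightarrow> Z i \<in> borel_measurable N" for N :: "'z measure" and Z
  proof (subst integral_distr)
    show "(\<lambda>\<omega>. \<lambda>p\<in>?K. Z (fst p) \<omega> \<bullet> snd p) \<in> measurable N ?B"
      by (intro measurable_restrict borel_measurable_inner borel_measurable_const that) auto
    show "(\<lambda>f. \<Phi> (R f)) \<in> borel_measurable ?B" by (rule measurable_compose[OF R \<Phi>])
  qed (simp only: Rr)
  from this[of Y M, OF Y] this[of Y' M', OF Y']
  show ?thesis unfolding D by simp
qed

lemma law_eqI:
  fixes Y :: "'w \<Rightarrow> 'a::euclidean_space" and Y' :: "'v \<Rightarrow> 'a" and F :: "'a \<Rightarrow> 'c::{banach, second_countable_topology}"
  assumes P: "prob_space M" "prob_space M'"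
    and Y: "Y \<in> borel_measurable M" "Y' \<in> borel_measurable M'"
    and eq: "\<And>a. (\<integral>\<omega>. iexp (a \<bullet> Y \<omega>) \<partial>M) = (\<integral>\<omega>. iexp (a \<bullet> Y' \<omega>) \<partial>M')"
    and F: "F \<in> borel_measurable borel"
  shows "(\<integral>\<omega>. F (Y \<omega>) \<partial>M) = (\<integral>\<omega>. F (Y' \<omega>) \<partial>M')"
proof -
  have "(\<integral>\<omega>. F ((\<lambda>i\<in>{()}. Y \<omega>) ()) \<partial>M) = (\<integral>\<omega>. F ((\<lambda>i\<in>{()}. Y' \<omega>) ()) \<partial>M')"
    by (rule vector_law_eqI[OF P, where \<Phi>="\<lambda>f. F (f ())"])
       (use Y eq in \<open>auto intro!: measurable_compose[OF _ F] measurable_component_singleton\<close>)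
  then show ?thesis by simp
qed

section \<open>The bridge, its increments, and the path obtained by adding a linear part\<close>

locale bridge = prob_space \<mu> for \<mu> :: "'v measure" +
  fixes X :: "real \<Rightarrow> 'v \<Rightarrow> 'a::euclidean_space"
  assumes bridge: "brownian_bridge \<mu> X"
begin

lemma X_measurable [measurable]: "t \<in> {0..1} \<Longrightarrow> X t \<in> borel_measurable \<mu>"
  and X_zero: "w \<in> space \<mu> \<Longrightarrow> X 0 w = 0" and X_one: "w \<in> space \<mu> \<Longrightarrow> X 1 w = 0"
  and X_cont: "w \<in> space \<mu> \<Longrightarrow> continuous_on {0..1} (\<lambda>t. X t w)"
  and X_gauss: "finite S \<Longrightarrow> S \<subseteq> {0..1} \<Longrightarrow> gaussian_variable \<mu> (\<lambda>w. \<Sum>t\<in>S. a t \<bullet> X t w)"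
  and X_mean: "t \<in> {0..1} \<Longrightarrow> (\<integral>w. u \<bullet> X t w \<partial>\<mu>) = 0"
  and X_cov: "s \<in> {0..1} \<Longrightarrow> t \<in> {0..1} \<Longrightarrow> (\<integral>w. (u \<bullet> X s w) * (v \<bullet> X t w) \<partial>\<mu>) = (min s t - s * t) * (u \<bullet> v)"
  using bridge unfolding brownian_bridge_def by auto

lemma X_inner_gauss: "t \<in> {0..1} \<Longrightarrow> gaussian_variable \<mu> (\<lambda>w. u \<bullet> X t w)"
  using X_gauss[of "{t}" "\<lambda>_. u"] by simp

lemma X_integrable: "t \<in> {0..1} \<Longrightarrow> integrable \<mu> (\<lambda>w. u \<bullet> X t w)"
  using gaussian_variable_integrable[OF X_inner_gauss, of t u 1] by simp

lemma X_prod_integrable: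
  assumes "s \<in> {0..1}" "t \<in> {0..1}"
  shows "integrable \<mu> (\<lambda>w. (u \<bullet> X s w) * (v \<bullet> X t w))"
proof (rule Bochner_Integration.integrable_bound)
  show "integrable \<mu> (\<lambda>w. (u \<bullet> X s w)\<^sup>2 + (v \<bullet> X t w)\<^sup>2)"
    using gaussian_variable_integrable[OF X_inner_gauss] assms by auto
  show "(\<lambda>w. (u \<bullet> X s w) * (v \<bullet> X t w)) \<in> borel_measurable \<mu>" using assms by measurable
  have "\<bar>x * y\<bar> \<le> x\<^sup>2 + y\<^sup>2" for x y :: real
  proof -
    have "0 \<le> \<bar>x\<bar> * \<bar>y\<bar>" by simp
    then show ?thesis using sum_squares_bound[of "\<bar>x\<bar>" "\<bar>y\<bar>"] unfolding abs_mult power2_abs by linarith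
  qed
  then show "AE w in \<mu>. norm ((u \<bullet> X s w) * (v \<bullet> X t w)) \<le> norm ((u \<bullet> X s w)\<^sup>2 + (v \<bullet> X t w)\<^sup>2)"
    by (intro AE_I2) (simp only: real_norm_def abs_of_nonneg[OF add_nonneg_nonneg[OF zero_le_power2 zero_le_power2]])
qed

lemma bridge_increment_cov:
  assumes "s \<in> {0..1}" "s' \<in> {0..1}" "t \<in> {0..1}" "t' \<in> {0..1}"
  shows "integrable \<mu> (\<lambda>w. (u \<bullet> (X s' w - X s w)) * (v \<bullet> (X t' w - X t w)))"
    "(\<integral>w. (u \<bullet> (X s' w - X s w)) * (v \<bullet> (X t' w - X t w)) \<partial>\<mu>)
    = (min s' t' - min s' t - min s t' + min s t - (s' - s) * (t' - t)) * (u \<bullet> v)"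
proof -
  have e: "(u \<bullet> (X s' w - X s w)) * (v \<bullet> (X t' w - X t w)) =
    (u \<bullet> X s' w) * (v \<bullet> X t' w) - (u \<bullet> X s' w) * (v \<bullet> X t w) - (u \<bullet> X s w) * (v \<bullet> X t' w) + (u \<bullet> X s w) * (v \<bullet> X t w)" for w
    by (simp add: inner_diff_right algebra_simps)
  note i = X_prod_integrable[OF assms(2,4), of u v] X_prod_integrable[OF assms(2,3), of u v]
    X_prod_integrable[OF assms(1,4), of u v] X_prod_integrable[OF assms(1,3), of u v]
  note c = X_cov[OF assms(2,4), of u v] X_cov[OF assms(2,3), of u v] X_cov[OF assms(1,4), of u v] X_cov[OF assms(1,3), of u v]
  show "integrable \<mu> (\<lambda>w. (u \<bullet> (X s' w - X s w)) * (v \<bullet> (X t' w - X t w)))"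
    unfolding e by (intro Bochner_Integration.integrable_add Bochner_Integration.integrable_diff i)
  show "(\<integral>w. (u \<bullet> (X s' w - X s w)) * (v \<bullet> (X t' w - X t w)) \<partial>\<mu>)
    = (min s' t' - min s' t - min s t' + min s t - (s' - s) * (t' - t)) * (u \<bullet> v)"
    unfolding e
    by (subst Bochner_Integration.integral_add, (intro Bochner_Integration.integrable_diff i)+,
        subst Bochner_Integration.integral_diff, (intro Bochner_Integration.integrable_diff i)+,
        subst Bochner_Integration.integral_diff, (intro i)+) (simp only: c, simp add: algebra_simps)
qed

text \<open>With \<open>n = Suc m\<close>, grid increments \<open>k\<close> and \<open>l\<close>
  have covariance \<open>(if l = k then 1 / n else 0) - 1 / n\<^sup>2\<close> in each direction. The
  negative part, an effect of the pinning, produces the second term.\<close>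

lemma bridge_grid_char:
  fixes a :: "nat \<Rightarrow> 'a"
  shows "(\<integral>w. iexp (\<Sum>k<Suc m. a k \<bullet> (X (real (Suc k) / Suc m) w - X (real k / Suc m) w)) \<partial>\<mu>)
    = of_real (exp (- ((\<Sum>k<Suc m. (norm (a k))\<^sup>2) / Suc m - (norm (\<Sum>k<Suc m. a k))\<^sup>2 / (real (Suc m))\<^sup>2) / 2))"
proof -
  define t where "t k = real k / Suc m" for k
  define Z where "Z w = (\<Sum>k<Suc m. a k \<bullet> (X (t (Suc k)) w - X (t k) w))" for w
  have t01: "t k \<in> {0..1}" if "k \<le> Suc m" for k using that by (simp add: t_def)
  have tS: "t (Suc k) - t k = 1 / Suc m" for k by (simp add: t_def diff_divide_distrib[symmetric])
  have inj: "inj_on t {..Suc m}" by (auto simp: inj_on_def t_def)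
  \<comment> \<open>Coefficients after summation by parts: the Gaussian property is stated for
    combinations of values of the bridge, not of its increments.\<close>
  define c where "c k = (if 0 < k then a (k - 1) else 0) - (if k < Suc m then a k else 0)" for k
  have Zc: "Z w = (\<Sum>k\<le>Suc m. c k \<bullet> X (t k) w)" for w
  proof -
    have 1: "(\<Sum>k\<le>Suc m. (if 0 < k then a (k - 1) else 0) \<bullet> X (t k) w) = (\<Sum>k<Suc m. a k \<bullet> X (t (Suc k)) w)"
      by (simp only: sum.atMost_Suc_shift lessThan_Suc_atMost) simp
    have "(\<Sum>k\<le>Suc m. (if k < Suc m then a k else 0) \<bullet> X (t k) w) = (\<Sum>k<Suc m. (if k < Suc m then a k else 0) \<bullet> X (t k) w)"
      by (simp only: lessThan_Suc_atMost[symmetric] sum.lessThan_Suc) simp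
    also have "\<dots> = (\<Sum>k<Suc m. a k \<bullet> X (t k) w)" by (intro sum.cong) auto
    finally have 2: "(\<Sum>k\<le>Suc m. (if k < Suc m then a k else 0) \<bullet> X (t k) w) = (\<Sum>k<Suc m. a k \<bullet> X (t k) w)" .
    show ?thesis unfolding Z_def c_def inner_diff_left inner_diff_right sum_subtractf 1 2 ..
  qed
  \<comment> \<open>\<open>X_gauss\<close> sums over a set of times, so the sum over indices is
    carried over along the injection \<open>t\<close>.\<close>
  have "gaussian_variable \<mu> (\<lambda>w. \<Sum>r\<in>t ` {..Suc m}. c (inv_into {..Suc m} t r) \<bullet> X r w)"
    using t01 by (intro X_gauss) auto
  also have "(\<lambda>w. \<Sum>r\<in>t ` {..Suc m}. c (inv_into {..Suc m} t r) \<bullet> X r w) = Z"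
    unfolding Zc[abs_def] sum.reindex[OF inj] comp_def using inj by (intro ext sum.cong refl) (simp add: inv_into_f_f)
  finally have G: "gaussian_variable \<mu> Z" .
  have ti: "t k \<in> {0..1}" "t (Suc k) \<in> {0..1}" if "k \<in> {..<Suc m}" for k using that t01 by auto
  have m0: "expectation Z = 0"
  proof -
    have "integrable \<mu> (\<lambda>w. a k \<bullet> (X (t (Suc k)) w - X (t k) w))" "(\<integral>w. a k \<bullet> (X (t (Suc k)) w - X (t k) w) \<partial>\<mu>) = 0" if "k \<in> {..<Suc m}" for k
      using ti[OF that] X_integrable X_mean by (simp_all add: inner_diff_right)
    then show ?thesis unfolding Z_def[abs_def] by (subst Bochner_Integration.integral_sum) auto
  qed
  have var: "expectation (\<lambda>w. (Z w)\<^sup>2) = (\<Sum>k<Suc m. (norm (a k))\<^sup>2) / Suc m - (norm (\<Sum>k<Suc m. a k))\<^sup>2 / (real (Suc m))\<^sup>2"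
  proof -
    have cov: "(\<integral>w. (a k \<bullet> (X (t (Suc k)) w - X (t k) w)) * (a l \<bullet> (X (t (Suc l)) w - X (t l) w)) \<partial>\<mu>)
      = (if l = k then (norm (a k))\<^sup>2 / Suc m else 0) - (a k \<bullet> a l) / (real (Suc m))\<^sup>2" if "k \<in> {..<Suc m}" "l \<in> {..<Suc m}" for k l
    proof -
      have mn: "min (t i) (t j) = real (min i j) / Suc m" for i j
        by (simp add: t_def min_def divide_le_cancel)
      have "min (t (Suc k)) (t (Suc l)) - min (t (Suc k)) (t l) - min (t k) (t (Suc l)) + min (t k) (t l)
        = (real (min (Suc k) (Suc l)) - real (min (Suc k) l) - real (min k (Suc l)) + real (min k l)) / Suc m"
        unfolding mn by (simp only: add_divide_distrib diff_divide_distrib)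
      also have "real (min (Suc k) (Suc l)) - real (min (Suc k) l) - real (min k (Suc l)) + real (min k l) = (if l = k then 1 else 0)"
        by (cases k l rule: linorder_cases) (auto simp: min_def)
      finally have mm: "min (t (Suc k)) (t (Suc l)) - min (t (Suc k)) (t l) - min (t k) (t (Suc l)) + min (t k) (t l)
        = (if l = k then 1 else 0) / Suc m" .
      show ?thesis
        unfolding bridge_increment_cov(2)[OF ti(1)[OF that(1)] ti(2)[OF that(1)] ti(1)[OF that(2)] ti(2)[OF that(2)]] mm tS
        by (cases "l = k") (auto simp: dot_square_norm power2_eq_square algebra_simps simp del: of_nat_Suc)
    qed
    have "(Z w)\<^sup>2 = (\<Sum>k<Suc m. \<Sum>l<Suc m. (a k \<bullet> (X (t (Suc k)) w - X (t k) w)) * (a l \<bullet> (X (t (Suc l)) w - X (t l) w)))" for w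
      unfolding Z_def power2_eq_square by (rule sum_product)
    then have "expectation (\<lambda>w. (Z w)\<^sup>2) = (\<Sum>k<Suc m. \<Sum>l<Suc m. expectation (\<lambda>w. (a k \<bullet> (X (t (Suc k)) w - X (t k) w)) * (a l \<bullet> (X (t (Suc l)) w - X (t l) w))))"
      using ti by (simp only:) (intro integral_double_sum bridge_increment_cov(1))
    also have "\<dots> = (\<Sum>k<Suc m. \<Sum>l<Suc m. (if l = k then (norm (a k))\<^sup>2 / Suc m else 0) - (a k \<bullet> a l) / (real (Suc m))\<^sup>2)"
      by (intro sum.cong refl cov)
    also have "\<dots> = (\<Sum>k<Suc m. (norm (a k))\<^sup>2 / Suc m) - (\<Sum>k<Suc m. \<Sum>l<Suc m. a k \<bullet> a l) / (real (Suc m))\<^sup>2"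
      by (simp only: sum_subtractf sum_divide_distrib) (simp del: sum.lessThan_Suc of_nat_Suc)
    also have "(\<Sum>k<Suc m. \<Sum>l<Suc m. a k \<bullet> a l) = (norm (\<Sum>k<Suc m. a k))\<^sup>2"
      unfolding power2_norm_eq_inner inner_sum_left inner_sum_right by (rule sum.swap)
    finally show ?thesis by (simp only: sum_divide_distrib)
  qed
  show ?thesis using gaussian_variable_iexp[OF G m0, unfolded var] unfolding Z_def t_def .
qed

definition N1 :: "'a measure" where "N1 = gauss_measure 1"

lemma prob_N1: "prob_space N1" unfolding N1_def by (rule prob_space_gauss_measure) simp

lemma space_N1 [simp]: "space N1 = UNIV" and sets_N1 [simp, measurable_cong]: "sets N1 = sets borel"
  by (simp_all add: N1_def)

definition joint :: "('a \<times> 'v) measure" where "joint = N1 \<Otimes>\<^sub>M \<mu>"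

lemma prob_joint: "prob_space joint"
proof -
  interpret N: prob_space N1 by (rule prob_N1)
  interpret P: pair_prob_space N1 \<mu> ..
  show ?thesis unfolding joint_def by (rule P.prob_space_axioms)
qed

lemma space_joint: "z \<in> space joint \<longleftrightarrow> snd z \<in> space \<mu>"
  by (cases z) (simp add: joint_def space_pair_measure)

text \<open>On the product of \<open>\<mu>\<close> with an independent normal vector, \<open>path T\<close> is a Brownian motion on
  \<open>{0..T}\<close>, reparametrised by the unit interval.\<close>

definition path :: "real \<Rightarrow> real \<Rightarrow> 'a \<times> 'v \<Rightarrow> 'a" where
  "path T s z = sqrt T *\<^sub>R X s (snd z) + (s * sqrt T) *\<^sub>R fst z"

lemma path_measurable: "t \<in> {0..1} \<Longrightarrow> path T t \<in> borel_measurable joint"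
  unfolding path_def[abs_def] joint_def
  by (intro borel_measurable_add borel_measurable_scaleR borel_measurable_const measurable_compose[OF measurable_snd X_measurable])
     (auto intro: measurable_fst'')

lemma path_cont: "z \<in> space joint \<Longrightarrow> continuous_on {0..1} (\<lambda>s. path T s z)"
  unfolding path_def by (intro continuous_intros X_cont) (simp add: space_joint)

lemma path_zero: "z \<in> space joint \<Longrightarrow> path T 0 z = 0"
  and path_one: "z \<in> space joint \<Longrightarrow> path T 1 z = sqrt T *\<^sub>R fst z"
  by (simp_all add: path_def space_joint X_zero X_one)

lemma path_jointly_measurable:
  "(\<lambda>p. path T (max 0 (min 1 (snd p))) (fst p)) \<in> borel_measurable (joint \<Otimes>\<^sub>M borel)"
proof -
  have "(\<lambda>p. path T (max 0 (min 1 (fst p))) (snd p)) \<in> borel_measurable (borel \<Otimes>\<^sub>M joint)"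
    by (rule clipped_process_measurable) (auto intro: path_measurable path_cont)
  from measurable_compose[OF measurable_Pair[OF measurable_snd measurable_fst] this]
  show ?thesis by simp
qed

lemma path_integral_measurable:
  assumes h: "continuous_on UNIV (h :: 'a \<Rightarrow> real)"
  shows "(\<lambda>z. \<integral>s\<in>{0..1}. h (path T s z) \<partial>lborel) \<in> borel_measurable joint"
proof -
  have hm: "h \<in> borel_measurable borel" using h by (rule borel_measurable_continuous_onI)
  have "(\<lambda>p. h (path T (max 0 (min 1 (snd p))) (fst p))) \<in> borel_measurable (joint \<Otimes>\<^sub>M borel)"
    by (rule measurable_compose[OF path_jointly_measurable hm])
  then have [measurable]: "(\<lambda>p. h (path T (max 0 (min 1 (snd p))) (fst p))) \<in> borel_measurable (joint \<Otimes>\<^sub>M lborel)"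
    by (simp cong: measurable_cong_sets)
  have "(\<lambda>z. \<integral>s. indicator {0..1} s *\<^sub>R h (path T (max 0 (min 1 s)) z) \<partial>lborel) \<in> borel_measurable joint"
    by (intro lborel.borel_measurable_lebesgue_integral) (simp add: case_prod_beta')
  moreover have "(\<integral>s\<in>{0..1}. h (path T s z) \<partial>lborel) = (\<integral>s. indicator {0..1} s *\<^sub>R h (path T (max 0 (min 1 s)) z) \<partial>lborel)" for z
    unfolding set_lebesgue_integral_def
    by (intro Bochner_Integration.integral_cong) (auto simp: indicator_def min_def max_def)
  ultimately show ?thesis by simp
qed

text \<open>The variance that the bridge lacks because of its pinning is exactly restored by the
  independent linear part, so that the right side is that of
  \<open>brownian_grid_char\<close>.\<close>

lemma path_grid_char:
  fixes a :: "nat \<Rightarrow> 'a"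
  assumes T: "0 < T"
  shows "(\<integral>z. iexp (\<Sum>k<Suc m. a k \<bullet> (path T (real (Suc k) / Suc m) z - path T (real k / Suc m) z)) \<partial>joint)
    = of_real (exp (- (T / Suc m * (\<Sum>k<Suc m. (norm (a k))\<^sup>2)) / 2))"
proof -
  interpret N: prob_space N1 by (rule prob_N1)
  interpret P: pair_prob_space N1 \<mu> ..
  let ?A = "\<Sum>k<Suc m. a k"
  let ?f = "\<lambda>n. iexp (((sqrt T / Suc m) *\<^sub>R ?A) \<bullet> n)"
  let ?g = "\<lambda>w. iexp (\<Sum>k<Suc m. (sqrt T *\<^sub>R a k) \<bullet> (X (real (Suc k) / Suc m) w - X (real k / Suc m) w))"
  have e: "iexp (\<Sum>k<Suc m. a k \<bullet> (path T (real (Suc k) / Suc m) z - path T (real k / Suc m) z)) = ?f (fst z) * ?g (snd z)" for z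
  proof -
    have "path T (real (Suc k) / Suc m) z - path T (real k / Suc m) z
      = sqrt T *\<^sub>R (X (real (Suc k) / Suc m) (snd z) - X (real k / Suc m) (snd z)) + (sqrt T / Suc m) *\<^sub>R fst z" for k
    proof -
      have "(real (Suc k) / Suc m) * sqrt T = (real k / Suc m) * sqrt T + sqrt T / Suc m"
        by (simp add: add_divide_distrib distrib_right)
      then show ?thesis unfolding path_def by (simp add: scaleR_diff_right scaleR_add_left del: of_nat_Suc)
    qed
    then have "(\<Sum>k<Suc m. a k \<bullet> (path T (real (Suc k) / Suc m) z - path T (real k / Suc m) z))
      = (\<Sum>k<Suc m. (sqrt T *\<^sub>R a k) \<bullet> (X (real (Suc k) / Suc m) (snd z) - X (real k / Suc m) (snd z))) + ((sqrt T / Suc m) *\<^sub>R ?A) \<bullet> fst z"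
      by (simp only: inner_add_right inner_scaleR_right inner_scaleR_left sum.distrib inner_sum_left scaleR_sum_right)
    then show ?thesis by (simp only: of_real_add distrib_left exp_add mult.commute)
  qed
  have tm: "real k / Suc m \<in> {0..1}" if "k \<le> Suc m" for k using that by simp
  have gm: "?g \<in> borel_measurable \<mu>"
  proof -
    have "(\<lambda>w. \<Sum>k<Suc m. (sqrt T *\<^sub>R a k) \<bullet> (X (real (Suc k) / Suc m) w - X (real k / Suc m) w)) \<in> borel_measurable \<mu>"
      by (intro borel_measurable_sum borel_measurable_inner borel_measurable_const borel_measurable_diff X_measurable tm) auto
    then show ?thesis by measurable
  qed
  have fm: "?f \<in> borel_measurable N1" by measurable
  have int: "integrable (N1 \<Otimes>\<^sub>M \<mu>) (\<lambda>z. ?f (fst z) * ?g (snd z))"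
    by (rule P.integrable_const_bound[where B=1])
       (auto simp: norm_mult simp del: sum.lessThan_Suc of_nat_Suc intro!: borel_measurable_times measurable_compose[OF measurable_fst fm] measurable_compose[OF measurable_snd gm])
  have "(\<integral>z. ?f (fst z) * ?g (snd z) \<partial>joint) = (\<integral>n. (\<integral>w. ?f n * ?g w \<partial>\<mu>) \<partial>N1)"
    unfolding joint_def by (subst P.integral_fst'[OF int, symmetric]) simp
  also have "\<dots> = (\<integral>n. ?f n \<partial>N1) * (\<integral>w. ?g w \<partial>\<mu>)" by (simp only: integral_mult_right_zero integral_mult_left_zero)
  also have "(\<integral>n. ?f n \<partial>N1) = of_real (exp (- 1 * (norm ((sqrt T / Suc m) *\<^sub>R ?A))\<^sup>2 / 2))"
    unfolding N1_def by (rule gauss_measure_iexp) simp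
  also have "(norm ((sqrt T / Suc m) *\<^sub>R ?A))\<^sup>2 = T / (real (Suc m))\<^sup>2 * (norm ?A)\<^sup>2"
    using T by (simp add: power_mult_distrib power_divide del: of_nat_Suc sum.lessThan_Suc)
  also have "(\<integral>w. ?g w \<partial>\<mu>) = of_real (exp (- ((\<Sum>k<Suc m. (norm (sqrt T *\<^sub>R a k))\<^sup>2) / Suc m - (norm (\<Sum>k<Suc m. sqrt T *\<^sub>R a k))\<^sup>2 / (real (Suc m))\<^sup>2) / 2))"
    by (rule bridge_grid_char)
  also have "(\<Sum>k<Suc m. (norm (sqrt T *\<^sub>R a k))\<^sup>2) = T * (\<Sum>k<Suc m. (norm (a k))\<^sup>2)"
    using T unfolding sum_distrib_left by (intro sum.cong) (auto simp: power_mult_distrib)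
  also have "(norm (\<Sum>k<Suc m. sqrt T *\<^sub>R a k))\<^sup>2 = T * (norm ?A)\<^sup>2"
    unfolding scaleR_sum_right[symmetric] using T by (simp add: power_mult_distrib del: sum.lessThan_Suc)
  finally have "(\<integral>z. ?f (fst z) * ?g (snd z) \<partial>joint) = of_real (exp (- 1 * (T / (real (Suc m))\<^sup>2 * (norm ?A)\<^sup>2) / 2 +
     - (T * (\<Sum>k<Suc m. (norm (a k))\<^sup>2) / Suc m - T * (norm ?A)\<^sup>2 / (real (Suc m))\<^sup>2) / 2))"
    by (simp only: exp_add of_real_mult)
  also have "- 1 * (T / (real (Suc m))\<^sup>2 * (norm ?A)\<^sup>2) / 2 +
     - (T * (\<Sum>k<Suc m. (norm (a k))\<^sup>2) / Suc m - T * (norm ?A)\<^sup>2 / (real (Suc m))\<^sup>2) / 2 = - (T / Suc m * (\<Sum>k<Suc m. (norm (a k))\<^sup>2)) / 2"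
    by (simp add: algebra_simps diff_divide_distrib add_divide_distrib del: of_nat_Suc sum.lessThan_Suc)
  finally show ?thesis unfolding e .
qed

end

section \<open>The law of the Grushin diffusion\<close>

locale grushin = brownian_pair M b b' + br: bridge \<mu> X
  for M :: "'w measure" and b :: "real \<Rightarrow> 'w \<Rightarrow> 'a::euclidean_space" and b' :: "real \<Rightarrow> 'w \<Rightarrow> 'b::euclidean_space"
    and \<mu> :: "'v measure" and X :: "real \<Rightarrow> 'v \<Rightarrow> 'a"
begin

lemma increments_law:
  fixes \<Phi> :: "(nat \<Rightarrow> 'a) \<Rightarrow> 'c::{banach, second_countable_topology}"
  assumes T: "0 < T" and \<Phi>: "\<Phi> \<in> borel_measurable (PiM {..<Suc m} (\<lambda>_. borel))"
  shows "(\<integral>\<omega>. \<Phi> (\<lambda>k\<in>{..<Suc m}. b (real (Suc k) * T / Suc m) \<omega> - b (real k * T / Suc m) \<omega>) \<partial>M)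
    = (\<integral>z. \<Phi> (\<lambda>k\<in>{..<Suc m}. br.path T (real (Suc k) / Suc m) z - br.path T (real k / Suc m) z) \<partial>br.joint)"
proof (rule vector_law_eqI[OF prob_space_axioms br.prob_joint _ _ _ _ \<Phi>])
  fix k assume k: "k \<in> {..<Suc m}"
  have "real (Suc k) / Suc m \<in> {0..1}" "real k / Suc m \<in> {0..1}" using k by auto
  then show "(\<lambda>z. br.path T (real (Suc k) / Suc m) z - br.path T (real k / Suc m) z) \<in> borel_measurable br.joint"
    by (intro borel_measurable_diff br.path_measurable)
  show "(\<lambda>\<omega>. b (real (Suc k) * T / Suc m) \<omega> - b (real k * T / Suc m) \<omega>) \<in> borel_measurable M"
    using T by (intro borel_measurable_diff b_measurable) auto
next
  fix a
  show "(\<integral>\<omega>. iexp (\<Sum>k<Suc m. a k \<bullet> (b (real (Suc k) * T / Suc m) \<omega> - b (real k * T / Suc m) \<omega>)) \<partial>M)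
    = (\<integral>z. iexp (\<Sum>k<Suc m. a k \<bullet> (br.path T (real (Suc k) / Suc m) z - br.path T (real k / Suc m) z)) \<partial>br.joint)"
    unfolding brownian_grid_char[OF bm T] br.path_grid_char[OF T] ..
qed simp

text \<open>Riemann sums of the functional depend only on grid increments, whose laws agree by
  \<open>increments_law\<close>; bounded convergence passes to the integrals. The endpoint is kept
  in the statement because the density lives there, and the factor \<open>T\<close> comes from
  rescaling time to the unit interval.\<close>

lemma path_functional_law:
  fixes h :: "'a \<Rightarrow> real"
  assumes T: "0 < T" and h: "continuous_on UNIV h" "\<And>z. 0 \<le> h z" and c: "0 \<le> c"
  shows "(\<integral>\<omega>. iexp (a \<bullet> b T \<omega>) * of_real (exp (- (c * (\<integral>s\<in>{0..T}. h (b s \<omega>) \<partial>lborel)))) \<partial>M)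
    = (\<integral>z. iexp (a \<bullet> (sqrt T *\<^sub>R fst z)) * of_real (exp (- (c * (T * (\<integral>s\<in>{0..1}. h (br.path T s z) \<partial>lborel))))) \<partial>br.joint)"
proof -
  interpret J: prob_space br.joint by (rule br.prob_joint)
  have hm: "h \<in> borel_measurable borel" using h(1) by (rule borel_measurable_continuous_onI)
  define R where "R m \<omega> = T / Suc m * (\<Sum>k<Suc m. h (b (real k * T / Suc m) \<omega>))" for m \<omega>
  define R' where "R' m z = T * (1 / Suc m * (\<Sum>k<Suc m. h (br.path T (real k * 1 / Suc m) z)))" for m z
  define V where "V \<omega> = (\<integral>s\<in>{0..T}. h (b s \<omega>) \<partial>lborel)" for \<omega>
  define V' where "V' z = T * (\<integral>s\<in>{0..1}. h (br.path T s z) \<partial>lborel)" for z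
  \<comment> \<open>The functional in terms of increments: \<open>y j\<close> is the increment over
    cell \<open>j\<close>, and values of the path are partial sums.\<close>
  define \<Phi> where "\<Phi> m y = iexp (a \<bullet> (\<Sum>j<Suc m. y j)) * of_real (exp (- (c * (T / Suc m * (\<Sum>k<Suc m. h (\<Sum>j<k. y j))))))" for m and y :: "nat \<Rightarrow> 'a"
  have \<Phi>m: "\<Phi> m \<in> borel_measurable (PiM {..<Suc m} (\<lambda>_. borel))" for m
  proof -
    have s: "(\<lambda>y. \<Sum>j<k. y j) \<in> borel_measurable (PiM {..<Suc m} (\<lambda>_. borel :: 'a measure))" if "k \<le> Suc m" for k
      using that by (intro borel_measurable_sum measurable_component_singleton) auto
    have 1: "(\<lambda>y. a \<bullet> (\<Sum>j<Suc m. y j)) \<in> borel_measurable (PiM {..<Suc m} (\<lambda>_. borel :: 'a measure))"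
      by (intro borel_measurable_inner borel_measurable_const s) simp
    have 2: "(\<lambda>y. T / Suc m * (\<Sum>k<Suc m. h (\<Sum>j<k. y j))) \<in> borel_measurable (PiM {..<Suc m} (\<lambda>_. borel :: 'a measure))"
      by (intro borel_measurable_times borel_measurable_const borel_measurable_sum measurable_compose[OF s hm]) auto
    have e1: "(\<lambda>x. iexp x) \<in> borel_measurable borel" by measurable
    have e2: "(\<lambda>x. complex_of_real (exp (- (c * x)))) \<in> borel_measurable borel" by measurable
    show ?thesis unfolding \<Phi>_def
      by (intro borel_measurable_times measurable_compose[OF 1 e1] measurable_compose[OF 2 e2])
  qed
  have tel: "(\<Sum>j<k. (\<lambda>j\<in>{..<Suc m}. f (Suc j) - f j) j) = f k - f 0" if "k \<le> Suc m" for f :: "nat \<Rightarrow> 'a" and k m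
  proof -
    have "(\<Sum>j<k. (\<lambda>j\<in>{..<Suc m}. f (Suc j) - f j) j) = (\<Sum>j<k. f (Suc j) - f j)"
      using that by (intro sum.cong) auto
    then show ?thesis by (simp only: sum_lessThan_telescope)
  qed
  have telh: "(\<Sum>k<Suc m. h (\<Sum>j<k. (\<lambda>j\<in>{..<Suc m}. f (Suc j) - f j) j)) = (\<Sum>k<Suc m. h (f k))" if "f 0 = 0" for f :: "nat \<Rightarrow> 'a" and m
    using that by (intro sum.cong refl) (subst tel, auto)
  have eqM: "\<Phi> m (\<lambda>k\<in>{..<Suc m}. b (real (Suc k) * T / Suc m) \<omega> - b (real k * T / Suc m) \<omega>) = iexp (a \<bullet> b T \<omega>) * of_real (exp (- (c * R m \<omega>)))"
    if "\<omega> \<in> space M" for m \<omega>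
  proof -
    have z: "b (real 0 * T / Suc m) \<omega> = 0" using brownian_motionD(3)[OF bm that] by simp
    have o: "b (real (Suc m) * T / Suc m) \<omega> = b T \<omega>" by simp
    show ?thesis
      unfolding \<Phi>_def R_def tel[of "Suc m" m "\<lambda>k. b (real k * T / Suc m) \<omega>", OF order_refl]
        telh[of "\<lambda>k. b (real k * T / Suc m) \<omega>" m, OF z] z o by simp
  qed
  have eqJ: "\<Phi> m (\<lambda>k\<in>{..<Suc m}. br.path T (real (Suc k) / Suc m) z - br.path T (real k / Suc m) z) = iexp (a \<bullet> (sqrt T *\<^sub>R fst z)) * of_real (exp (- (c * R' m z)))"
    if "z \<in> space br.joint" for m z
  proof -
    have z: "br.path T (real 0 / Suc m) z = 0" using br.path_zero[OF that] by simp
    have o: "br.path T (real (Suc m) / Suc m) z = sqrt T *\<^sub>R fst z" using br.path_one[OF that] by simp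
    show ?thesis
      unfolding \<Phi>_def R'_def tel[of "Suc m" m "\<lambda>k. br.path T (real k / Suc m) z", OF order_refl]
        telh[of "\<lambda>k. br.path T (real k / Suc m) z" m, OF z] z o by simp
  qed
  have "(\<integral>\<omega>. iexp (a \<bullet> b T \<omega>) * of_real (exp (- (c * R m \<omega>))) \<partial>M) = (\<integral>z. iexp (a \<bullet> (sqrt T *\<^sub>R fst z)) * of_real (exp (- (c * R' m z))) \<partial>br.joint)" for m
  proof -
    have "(\<integral>\<omega>. iexp (a \<bullet> b T \<omega>) * of_real (exp (- (c * R m \<omega>))) \<partial>M)
      = (\<integral>\<omega>. \<Phi> m (\<lambda>k\<in>{..<Suc m}. b (real (Suc k) * T / Suc m) \<omega> - b (real k * T / Suc m) \<omega>) \<partial>M)"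
      by (intro Bochner_Integration.integral_cong refl eqM[symmetric])
    also have "\<dots> = (\<integral>z. \<Phi> m (\<lambda>k\<in>{..<Suc m}. br.path T (real (Suc k) / Suc m) z - br.path T (real k / Suc m) z) \<partial>br.joint)"
      by (rule increments_law[OF T \<Phi>m])
    also have "\<dots> = (\<integral>z. iexp (a \<bullet> (sqrt T *\<^sub>R fst z)) * of_real (exp (- (c * R' m z))) \<partial>br.joint)"
      by (intro Bochner_Integration.integral_cong refl eqJ)
    finally show ?thesis .
  qed
  moreover have "(\<lambda>m. \<integral>\<omega>. iexp (a \<bullet> b T \<omega>) * of_real (exp (- (c * R m \<omega>))) \<partial>M) \<longlonglongrightarrow> (\<integral>\<omega>. iexp (a \<bullet> b T \<omega>) * of_real (exp (- (c * V \<omega>))) \<partial>M)"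
  proof (rule integral_dominated_convergence[where w="\<lambda>_. 1"])
    have lim: "(\<lambda>m. R m \<omega>) \<longlonglongrightarrow> V \<omega>" if "\<omega> \<in> space M" for \<omega>
      unfolding R_def V_def using that
      by (intro riemann_sum_tendsto[OF T] continuous_on_compose2[OF h(1)] continuous_on_subset[OF brownian_motionD(4)[OF bm]]) auto
    have Rm: "R m \<in> borel_measurable M" for m
      unfolding R_def[abs_def] using T
      by (intro borel_measurable_times borel_measurable_const borel_measurable_sum measurable_compose[OF b_measurable hm]) auto
    have Vm: "V \<in> borel_measurable M" by (rule borel_measurable_LIMSEQ_metric[OF Rm lim])
    have [measurable]: "b T \<in> borel_measurable M" using T by (intro b_measurable) simp
    have bT: "(\<lambda>\<omega>. iexp (a \<bullet> b T \<omega>)) \<in> borel_measurable M" by measurable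
    have ex: "(\<lambda>x. complex_of_real (exp (- (c * x)))) \<in> borel_measurable borel" by measurable
    show "(\<lambda>\<omega>. iexp (a \<bullet> b T \<omega>) * of_real (exp (- (c * V \<omega>)))) \<in> borel_measurable M"
      by (intro borel_measurable_times bT measurable_compose[OF Vm ex])
    show "(\<lambda>\<omega>. iexp (a \<bullet> b T \<omega>) * of_real (exp (- (c * R m \<omega>)))) \<in> borel_measurable M" for m
      by (intro borel_measurable_times bT measurable_compose[OF Rm ex])
    show "AE \<omega> in M. (\<lambda>m. iexp (a \<bullet> b T \<omega>) * of_real (exp (- (c * R m \<omega>)))) \<longlonglongrightarrow> iexp (a \<bullet> b T \<omega>) * of_real (exp (- (c * V \<omega>)))"
      by (intro AE_I2 tendsto_intros lim)
    have "0 \<le> R m \<omega>" for m \<omega> unfolding R_def using T h(2) by (intro mult_nonneg_nonneg sum_nonneg) auto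
    then show "AE \<omega> in M. norm (iexp (a \<bullet> b T \<omega>) * of_real (exp (- (c * R m \<omega>)))) \<le> 1" for m
      using c by (intro AE_I2) (simp add: norm_mult)
  qed simp
  moreover have "(\<lambda>m. \<integral>z. iexp (a \<bullet> (sqrt T *\<^sub>R fst z)) * of_real (exp (- (c * R' m z))) \<partial>br.joint) \<longlonglongrightarrow> (\<integral>z. iexp (a \<bullet> (sqrt T *\<^sub>R fst z)) * of_real (exp (- (c * V' z))) \<partial>br.joint)"
  proof (rule integral_dominated_convergence[where w="\<lambda>_. 1"])
    have lim: "(\<lambda>m. R' m z) \<longlonglongrightarrow> V' z" if "z \<in> space br.joint" for z
      unfolding R'_def V'_def using that
      by (intro tendsto_mult tendsto_const riemann_sum_tendsto continuous_on_compose2[OF h(1)] br.path_cont) auto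
    have Rm: "R' m \<in> borel_measurable br.joint" for m
      unfolding R'_def[abs_def]
      by (intro borel_measurable_times borel_measurable_const borel_measurable_sum measurable_compose[OF br.path_measurable hm]) auto
    have Vm: "V' \<in> borel_measurable br.joint" by (rule borel_measurable_LIMSEQ_metric[OF Rm lim])
    have "fst \<in> borel_measurable br.joint" unfolding br.joint_def using measurable_fst[of br.N1 \<mu>] by (simp cong: measurable_cong_sets)
    then have bT: "(\<lambda>z. iexp (a \<bullet> (sqrt T *\<^sub>R fst z))) \<in> borel_measurable br.joint" by measurable
    have ex: "(\<lambda>x. complex_of_real (exp (- (c * x)))) \<in> borel_measurable borel" by measurable
    show "(\<lambda>z. iexp (a \<bullet> (sqrt T *\<^sub>R fst z)) * of_real (exp (- (c * V' z)))) \<in> borel_measurable br.joint"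
      by (intro borel_measurable_times bT measurable_compose[OF Vm ex])
    show "(\<lambda>z. iexp (a \<bullet> (sqrt T *\<^sub>R fst z)) * of_real (exp (- (c * R' m z)))) \<in> borel_measurable br.joint" for m
      by (intro borel_measurable_times bT measurable_compose[OF Rm ex])
    show "AE z in br.joint. (\<lambda>m. iexp (a \<bullet> (sqrt T *\<^sub>R fst z)) * of_real (exp (- (c * R' m z)))) \<longlonglongrightarrow> iexp (a \<bullet> (sqrt T *\<^sub>R fst z)) * of_real (exp (- (c * V' z)))"
      by (intro AE_I2 tendsto_intros lim)
    have "0 \<le> R' m z" for m z unfolding R'_def using T h(2) by (intro mult_nonneg_nonneg sum_nonneg) auto
    then show "AE z in br.joint. norm (iexp (a \<bullet> (sqrt T *\<^sub>R fst z)) * of_real (exp (- (c * R' m z)))) \<le> 1" for m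
      using c by (intro AE_I2) (simp add: norm_mult)
  qed simp
  ultimately show ?thesis unfolding V_def V'_def using LIMSEQ_unique by (simp only:) blast
qed

text \<open>The variance of the stochastic integral once the path is fixed. The first component of
  \<open>z\<close> is the normal vector that determines the endpoint, the second the bridge.\<close>

definition variance_of :: "('a \<Rightarrow> real) \<Rightarrow> real \<Rightarrow> 'a \<times> 'v \<Rightarrow> real" where
  "variance_of g T z = T * (\<integral>s\<in>{0..1}. (g (br.path T s z))\<^sup>2 \<partial>lborel)"

lemma variance_of_nonneg: "0 \<le> T \<Longrightarrow> 0 \<le> variance_of g T z"
  unfolding variance_of_def set_lebesgue_integral_def
  by (intro mult_nonneg_nonneg integral_nonneg_AE AE_I2) auto

lemma variance_of_measurable:
  "continuous_on UNIV g \<Longrightarrow> variance_of g T \<in> borel_measurable br.joint"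
  unfolding variance_of_def[abs_def]
  by (intro borel_measurable_times borel_measurable_const br.path_integral_measurable[of "\<lambda>z. (g z)\<^sup>2"] continuous_intros)

definition N2 :: "'b measure" where "N2 = gauss_measure 1"

lemma prob_N2: "prob_space N2" unfolding N2_def by (rule prob_space_gauss_measure) simp

lemma space_N2 [simp]: "space N2 = UNIV" and sets_N2 [simp, measurable_cong]: "sets N2 = sets borel"
  by (simp_all add: N2_def)

lemma endpoint_measurable:
  assumes g: "continuous_on UNIV g"
  shows "(\<lambda>q. (sqrt T *\<^sub>R fst (fst q), sqrt (variance_of g T (fst q)) *\<^sub>R snd q)) \<in> borel_measurable (br.joint \<Otimes>\<^sub>M N2)"
proof -
  have "fst \<in> borel_measurable br.joint" unfolding br.joint_def using measurable_fst[of br.N1 \<mu>] by (simp cong: measurable_cong_sets)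
  then have 1: "(\<lambda>q. fst (fst q)) \<in> borel_measurable (br.joint \<Otimes>\<^sub>M N2)" by (rule measurable_compose[OF measurable_fst])
  have 2: "(\<lambda>q. variance_of g T (fst q)) \<in> borel_measurable (br.joint \<Otimes>\<^sub>M N2)"
    by (rule measurable_compose[OF measurable_fst variance_of_measurable[OF g]])
  have 3: "snd \<in> borel_measurable (br.joint \<Otimes>\<^sub>M N2)" using measurable_snd[of br.joint N2] by (simp cong: measurable_cong_sets)
  show ?thesis
    by (intro borel_measurable_Pair borel_measurable_scaleR borel_measurable_const 1 3 measurable_compose[OF 2 borel_measurable_sqrt])
qed

text \<open>Both sides have the same characteristic function: averaging over the normal vector
  \<open>snd q\<close> produces the exponential of the variance, as found in
  \<open>ito_integral_char\<close> and rewritten by \<open>path_functional_law\<close>.\<close>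

lemma endpoint_law:
  fixes F :: "'a \<times> 'b \<Rightarrow> 'c::{banach, second_countable_topology}"
  assumes T: "0 < T" and g: "continuous_on UNIV g" "\<And>z. 0 \<le> g z"
    and ito: "is_ito_integral M filt b' (\<lambda>s \<omega>. g (b s \<omega>)) T J"
    and F: "F \<in> borel_measurable borel"
  shows "(\<integral>\<omega>. F (b T \<omega>, J \<omega>) \<partial>M) = (\<integral>q. F (sqrt T *\<^sub>R fst (fst q), sqrt (variance_of g T (fst q)) *\<^sub>R snd q) \<partial>(br.joint \<Otimes>\<^sub>M N2))"
proof -
  interpret J: prob_space br.joint by (rule br.prob_joint)
  interpret N: prob_space N2 by (rule prob_N2)
  interpret JN: pair_prob_space br.joint N2 ..
  show ?thesis
  proof (rule law_eqI[OF prob_space_axioms JN.prob_space_axioms _ endpoint_measurable[OF g(1)] _ F])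
    show "(\<lambda>\<omega>. (b T \<omega>, J \<omega>)) \<in> borel_measurable M"
      using ito T by (intro borel_measurable_Pair b_measurable) (auto simp: is_ito_integral_def)
    fix c :: "'a \<times> 'b"
    obtain a u where c: "c = (a, u)" by (cases c)
    let ?V = "variance_of g T"
    have "(\<integral>\<omega>. iexp (c \<bullet> (b T \<omega>, J \<omega>)) \<partial>M) = (\<integral>\<omega>. iexp (a \<bullet> b T \<omega>) * iexp (u \<bullet> J \<omega>) \<partial>M)"
      unfolding c by (simp add: inner_prod_def distrib_left exp_add)
    also have "\<dots> = (\<integral>\<omega>. iexp (a \<bullet> b T \<omega>) * of_real (exp (- ((norm u)\<^sup>2 / 2 * (\<integral>s\<in>{0..T}. (g (b s \<omega>))\<^sup>2 \<partial>lborel)))) \<partial>M)"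
      unfolding ito_integral_char[OF T g ito] by simp
    also have "\<dots> = (\<integral>z. iexp (a \<bullet> (sqrt T *\<^sub>R fst z)) * of_real (exp (- ((norm u)\<^sup>2 / 2 * ?V z))) \<partial>br.joint)"
      unfolding variance_of_def by (rule path_functional_law[OF T]) (auto intro!: continuous_intros g)
    also have "\<dots> = (\<integral>z. (\<integral>n. iexp (a \<bullet> (sqrt T *\<^sub>R fst z)) * iexp (u \<bullet> (sqrt (?V z) *\<^sub>R n)) \<partial>N2) \<partial>br.joint)"
    proof (rule Bochner_Integration.integral_cong[OF refl])
      fix z
      have "(\<integral>n. iexp (u \<bullet> (sqrt (?V z) *\<^sub>R n)) \<partial>N2) = (\<integral>n. iexp ((sqrt (?V z) *\<^sub>R u) \<bullet> n) \<partial>N2)" by simp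
      also have "\<dots> = of_real (exp (- 1 * (norm (sqrt (?V z) *\<^sub>R u))\<^sup>2 / 2))"
        unfolding N2_def by (rule gauss_measure_iexp) simp
      also have "(norm (sqrt (?V z) *\<^sub>R u))\<^sup>2 = ?V z * (norm u)\<^sup>2"
        using variance_of_nonneg[of T g z] T by (simp add: power_mult_distrib)
      finally have "(\<integral>n. iexp (u \<bullet> (sqrt (?V z) *\<^sub>R n)) \<partial>N2) = of_real (exp (- ((norm u)\<^sup>2 / 2 * ?V z)))"
        by (simp add: mult.commute)
      then show "iexp (a \<bullet> (sqrt T *\<^sub>R fst z)) * of_real (exp (- ((norm u)\<^sup>2 / 2 * ?V z))) = (\<integral>n. iexp (a \<bullet> (sqrt T *\<^sub>R fst z)) * iexp (u \<bullet> (sqrt (?V z) *\<^sub>R n)) \<partial>N2)"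
        by (simp only: integral_mult_right_zero)
    qed
    also have "\<dots> = (\<integral>z. (\<integral>n. iexp (c \<bullet> (sqrt T *\<^sub>R fst z, sqrt (?V z) *\<^sub>R n)) \<partial>N2) \<partial>br.joint)"
      unfolding c by (simp add: inner_prod_def distrib_left exp_add)
    also have "\<dots> = (\<integral>q. iexp (c \<bullet> (sqrt T *\<^sub>R fst (fst q), sqrt (?V (fst q)) *\<^sub>R snd q)) \<partial>(br.joint \<Otimes>\<^sub>M N2))"
    proof -
      have m: "(\<lambda>q. c \<bullet> (sqrt T *\<^sub>R fst (fst q), sqrt (?V (fst q)) *\<^sub>R snd q)) \<in> borel_measurable (br.joint \<Otimes>\<^sub>M N2)"
        by (intro borel_measurable_inner borel_measurable_const endpoint_measurable g)
      have "integrable (br.joint \<Otimes>\<^sub>M N2) (\<lambda>q. iexp (c \<bullet> (sqrt T *\<^sub>R fst (fst q), sqrt (?V (fst q)) *\<^sub>R snd q)))"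
      proof (rule JN.integrable_const_bound[where B=1])
        have "(\<lambda>x. iexp x) \<in> borel_measurable borel" by measurable
        from measurable_compose[OF m this]
        show "(\<lambda>q. iexp (c \<bullet> (sqrt T *\<^sub>R fst (fst q), sqrt (?V (fst q)) *\<^sub>R snd q))) \<in> borel_measurable (br.joint \<Otimes>\<^sub>M N2)" .
      qed simp
      from JN.integral_fst'[OF this] show ?thesis by simp
    qed
    finally show "(\<integral>\<omega>. iexp (c \<bullet> (b T \<omega>, J \<omega>)) \<partial>M) = (\<integral>q. iexp (c \<bullet> (sqrt T *\<^sub>R fst (fst q), sqrt (?V (fst q)) *\<^sub>R snd q)) \<partial>(br.joint \<Otimes>\<^sub>M N2))" .
  qed
qed

end

section \<open>The density on the diagonal\<close>

lemma compact_support_integrable: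
  fixes f :: "'a::euclidean_space \<Rightarrow> real"
  assumes f: "continuous_on UNIV f" and s: "\<And>z. z \<notin> cball c r \<Longrightarrow> f z = 0"
  shows "integrable lborel f"
proof -
  have "integrable lborel (\<lambda>z. indicator (cball c r) z *\<^sub>R f z)"
    by (rule borel_integrable_compact) (auto intro: continuous_on_subset[OF f])
  moreover have "(\<lambda>z. indicator (cball c r) z *\<^sub>R f z) = f"
    using s by (intro ext) (auto simp: indicator_def)
  ultimately show ?thesis by simp
qed

lemma compact_support_bounded:
  fixes f :: "'a::euclidean_space \<Rightarrow> real"
  assumes f: "continuous_on UNIV f" and s: "\<And>z. z \<notin> cball c r \<Longrightarrow> f z = 0"
  shows "\<exists>B\<ge>0. \<forall>z. \<bar>f z\<bar> \<le> B"
proof -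
  have "bounded (f ` cball c r)"
    by (intro compact_imp_bounded compact_continuous_image continuous_on_subset[OF f]) auto
  then obtain B where B: "\<forall>y\<in>f ` cball c r. norm y \<le> B" unfolding bounded_iff by blast
  have "\<bar>f z\<bar> \<le> \<bar>B\<bar>" for z
  proof (cases "z \<in> cball c r")
    case True
    then have "norm (f z) \<le> B" using B by blast
    then show ?thesis by simp
  next
    case False then show ?thesis using s[of z] by simp
  qed
  then show ?thesis by (intro exI[of _ "\<bar>B\<bar>"]) auto
qed

text \<open>A continuous bump, positive at 0 and of compact support, whose scaled copies shrink to a
  point.\<close>

definition tent :: "'a::euclidean_space \<Rightarrow> real" where
  "tent v = max 0 (1 - norm v)"

lemma tent_continuous: "continuous_on S tent"
  unfolding tent_def[abs_def] by (intro continuous_intros)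

lemma tent_bounds: "0 \<le> tent v" "tent v \<le> 1"
  by (auto simp: tent_def)

lemma tent_support: "1 < norm v \<Longrightarrow> tent v = 0"
  by (simp add: tent_def)

lemma tent_integrable: "integrable lborel (tent :: 'a::euclidean_space \<Rightarrow> real)"
  by (rule compact_support_integrable[OF tent_continuous, of 0 1]) (auto intro: tent_support)

lemma AE_lborel_ball:
  assumes "AE z in lborel. z \<notin> ball (x::'a::euclidean_space) r"
  shows "r \<le> 0"
proof (rule ccontr)
  assume "\<not> r \<le> 0"
  then have "0 < measure lborel (ball x r)" by (intro content_ball_pos) simp
  moreover have "emeasure lborel (ball x r) = 0"
    using assms by (subst (asm) AE_iff_measurable[of "ball x r"]) auto
  ultimately show False by (simp add: measure_def)
qed

lemma continuous_nonneg_AE_zero: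
  fixes f :: "'a::euclidean_space \<Rightarrow> real"
  assumes f: "continuous_on UNIV f" and AE: "AE z in lborel. f z = 0"
  shows "f x = 0"
proof (rule ccontr)
  assume "f x \<noteq> 0"
  moreover have "open {z. f z \<noteq> 0}"
    using f by (intro open_Collect_neq) (auto intro: continuous_on_const)
  ultimately obtain r where r: "0 < r" "ball x r \<subseteq> {z. f z \<noteq> 0}"
    by (metis (mono_tags, lifting) mem_Collect_eq openE)
  have "AE z in lborel. z \<notin> ball x r" using AE by eventually_elim (use r(2) in auto)
  from AE_lborel_ball[OF this] r(1) show False by simp
qed

lemma tent_integral_pos: "0 < (\<integral>v. tent (v::'a::euclidean_space) \<partial>lborel)"
proof -
  have "0 \<le> (\<integral>v. tent (v::'a) \<partial>lborel)" by (intro integral_nonneg_AE) (auto simp: tent_bounds)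
  moreover have "(\<integral>v. tent (v::'a) \<partial>lborel) \<noteq> 0"
  proof
    assume "(\<integral>v. tent (v::'a) \<partial>lborel) = 0"
    then have "AE v in lborel. tent (v::'a) = 0"
      by (subst (asm) integral_nonneg_eq_0_iff_AE[OF tent_integrable]) (auto simp: tent_bounds)
    from continuous_nonneg_AE_zero[OF tent_continuous this, of 0] show False by (simp add: tent_def)
  qed
  ultimately show ?thesis by simp
qed

text \<open>The difference of \<open>D\<close> and \<open>E\<close>, cut off by a tent around
  \<open>x\<close>, is itself an admissible test function; it makes the integral of the squared
  difference times the tent vanish.\<close>

lemma continuous_eq_of_integrals:
  fixes D E :: "'a::euclidean_space \<Rightarrow> real"
  assumes D: "continuous_on UNIV D" and E: "continuous_on UNIV E"
    and eq: "\<And>f. continuous_on UNIV f \<Longrightarrow> (\<And>z. z \<notin> cball x 1 \<Longrightarrow> f z = 0) \<Longrightarrow> (\<integral>z. f z * D z \<partial>lborel) = (\<integral>z. f z * E z \<partial>lborel)"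
  shows "D x = E x"
proof -
  define f where "f z = (D z - E z) * tent (z - x)" for z
  have tc: "continuous_on UNIV (\<lambda>z. tent (z - x))"
    by (rule continuous_on_compose2[OF tent_continuous[of UNIV]]) (auto intro!: continuous_intros)
  have f: "continuous_on UNIV f" unfolding f_def[abs_def] by (intro continuous_intros D E tc)
  have s: "z \<notin> cball x 1 \<Longrightarrow> f z = 0" for z
    by (simp add: f_def tent_support dist_norm norm_minus_commute)
  have iD: "integrable lborel (\<lambda>z. f z * D z)" "integrable lborel (\<lambda>z. f z * E z)"
    by (rule compact_support_integrable[of _ x 1]; use s f D E in \<open>auto intro!: continuous_intros\<close>)+
  have e: "f z * D z - f z * E z = (D z - E z)\<^sup>2 * tent (z - x)" for z
    by (simp add: f_def power2_eq_square algebra_simps)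
  have i: "integrable lborel (\<lambda>z. (D z - E z)\<^sup>2 * tent (z - x))"
    unfolding e[symmetric] using iD by (rule Bochner_Integration.integrable_diff)
  have "(\<integral>z. (D z - E z)\<^sup>2 * tent (z - x) \<partial>lborel) = 0"
    unfolding e[symmetric] using iD eq[OF f s] by (subst Bochner_Integration.integral_diff) auto
  then have "AE z in lborel. (D z - E z)\<^sup>2 * tent (z - x) = 0"
    by (subst (asm) integral_nonneg_eq_0_iff_AE[OF i]) (auto simp: tent_bounds)
  from continuous_nonneg_AE_zero[OF _ this, of x] D E tc
  show ?thesis by (simp add: tent_def continuous_intros)
qed

text \<open>Provides the continuity with which an identity integrated over \<xi> is brought to a
  single \<xi>. A convergent sequence is bounded, so \<open>q\<close> is bounded on the compact
  product that matters.\<close>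

lemma param_integral_continuous:
  fixes \<phi> :: "'b::euclidean_space \<Rightarrow> real" and q :: "'a::euclidean_space \<times> 'b \<Rightarrow> real"
  assumes \<phi>: "continuous_on UNIV \<phi>" "\<And>\<eta>. \<eta> \<notin> cball c r \<Longrightarrow> \<phi> \<eta> = 0" and q: "continuous_on UNIV q"
  shows "continuous_on UNIV (\<lambda>\<xi>. \<integral>\<eta>. \<phi> \<eta> * q (\<xi>, \<eta>) \<partial>lborel)"
proof (rule continuous_on_sequentiallyI)
  fix u :: "nat \<Rightarrow> 'a" and a assume u: "u \<longlonglongrightarrow> a"
  have "bounded (range u)" using u by (rule convergent_imp_bounded)
  then obtain R where R: "\<And>n. norm (u n) \<le> R" unfolding bounded_iff by auto
  have "bounded (q ` (cball 0 R \<times> cball c r))"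
    by (intro compact_imp_bounded compact_continuous_image compact_Times continuous_on_subset[OF q]) auto
  then obtain B where B: "\<forall>y\<in>q ` (cball 0 R \<times> cball c r). norm y \<le> B" unfolding bounded_iff by blast
  have qm: "q \<in> borel_measurable borel" using q by (rule borel_measurable_continuous_onI)
  have qs: "(\<lambda>\<eta>. q (\<xi>, \<eta>)) \<in> borel_measurable borel" for \<xi>
    by (intro measurable_compose[OF _ qm] borel_measurable_Pair) auto
  have \<phi>m: "\<phi> \<in> borel_measurable borel" using \<phi>(1) by (rule borel_measurable_continuous_onI)
  show "(\<lambda>n. \<integral>\<eta>. \<phi> \<eta> * q (u n, \<eta>) \<partial>lborel) \<longlonglongrightarrow> (\<integral>\<eta>. \<phi> \<eta> * q (a, \<eta>) \<partial>lborel)"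
  proof (rule integral_dominated_convergence[where w="\<lambda>\<eta>. \<bar>\<phi> \<eta>\<bar> * B"])
    show "integrable lborel (\<lambda>\<eta>. \<bar>\<phi> \<eta>\<bar> * B)"
      using compact_support_integrable[OF \<phi>] by simp
    show "AE \<eta> in lborel. (\<lambda>n. \<phi> \<eta> * q (u n, \<eta>)) \<longlonglongrightarrow> \<phi> \<eta> * q (a, \<eta>)"
      using u by (intro AE_I2 tendsto_mult tendsto_const continuous_on_tendsto_compose[OF q] tendsto_Pair) auto
    show "AE \<eta> in lborel. norm (\<phi> \<eta> * q (u n, \<eta>)) \<le> \<bar>\<phi> \<eta>\<bar> * B" for n
    proof (rule AE_I2)
      fix \<eta>
      show "norm (\<phi> \<eta> * q (u n, \<eta>)) \<le> \<bar>\<phi> \<eta>\<bar> * B"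
      proof (cases "\<eta> \<in> cball c r")
        case True
        then have "q (u n, \<eta>) \<in> q ` (cball 0 R \<times> cball c r)" using R[of n] by (intro imageI) simp
        then have "\<bar>q (u n, \<eta>)\<bar> \<le> B" using B by fastforce
        then show ?thesis by (simp add: abs_mult mult_left_mono)
      qed (simp add: \<phi>(2))
    qed
  qed (use qs \<phi>m in \<open>auto intro!: borel_measurable_times\<close>)
qed

lemma lborel_integral_scale:
  fixes F :: "'a::euclidean_space \<Rightarrow> real"
  assumes s: "0 < s" and [measurable]: "F \<in> borel_measurable borel"
  shows "(\<integral>\<eta>. F \<eta> \<partial>lborel) = s ^ DIM('a) * (\<integral>v. F (y + s *\<^sub>R v) \<partial>lborel)"
proof -
  have "s \<noteq> 0" using s by simp
  show ?thesis
    by (subst lborel_affine[OF \<open>s \<noteq> 0\<close>, of y], subst integral_density)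
       (use s in \<open>auto simp: integral_distr\<close>)
qed

text \<open>Unimodality along rays, the source of monotonicity in
  \<open>density_diagonal\<close>.\<close>

lemma gauss_kernel_mono_scale:
  assumes "0 < v" "0 \<le> r" "r \<le> s"
  shows "gauss_kernel v (s *\<^sub>R z) \<le> gauss_kernel v (r *\<^sub>R z)"
proof -
  have "(norm (r *\<^sub>R z))\<^sup>2 \<le> (norm (s *\<^sub>R z))\<^sup>2"
    using assms by (intro power_mono) (auto simp: mult_right_mono)
  then show ?thesis unfolding gauss_kernel_def using assms
    by (intro divide_right_mono) (auto simp: divide_right_mono)
qed

lemma gauss_kernel_le_zero: "0 < v \<Longrightarrow> gauss_kernel v (z::'a::euclidean_space) \<le> gauss_kernel v (0::'a)"
  using gauss_kernel_mono_scale[of v 0 1 z] by simp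

lemma gauss_kernel_continuous: "continuous_on S (gauss_kernel v)"
  unfolding gauss_kernel_def[abs_def] divide_inverse by (intro continuous_intros)

lemma gauss_kernel_variance_measurable: "(\<lambda>v. gauss_kernel v z) \<in> borel_measurable borel"
  unfolding gauss_kernel_def by measurable

section \<open>From the law of the endpoint to the value of its density\<close>

context grushin
begin

lemma variance_section_measurable:
  "continuous_on UNIV g \<Longrightarrow> (\<lambda>w. variance_of g T (n, w)) \<in> borel_measurable \<mu>"
  by (rule measurable_compose[OF measurable_Pair1'[of n br.N1 \<mu>] variance_of_measurable[unfolded br.joint_def]]) simp_all

text \<open>The vector \<open>n\<close> enters through the linear part of the path; along a
  convergent sequence of such vectors the paths stay in one ball, on which \<open>g\<close> is
  bounded.\<close>

lemma variance_continuous: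
  assumes g: "continuous_on UNIV g" and w: "w \<in> space \<mu>"
  shows "continuous_on UNIV (\<lambda>n. variance_of g T (n, w))"
proof (rule continuous_on_sequentiallyI)
  fix u :: "nat \<Rightarrow> 'a" and a assume u: "u \<longlonglongrightarrow> a"
  have "bounded (range u)" using u by (rule convergent_imp_bounded)
  then obtain R where R: "\<And>n. norm (u n) \<le> R" unfolding bounded_iff by auto
  have R0: "0 \<le> R" using R[of 0] norm_ge_zero order_trans by blast
  have "bounded ((\<lambda>s. X s w) ` {0..1})"
    by (intro compact_imp_bounded compact_continuous_image br.X_cont w) auto
  then obtain C where C: "\<forall>y\<in>(\<lambda>s. X s w) ` {0..1}. norm y \<le> C" unfolding bounded_iff by blast
  define K where "K = \<bar>sqrt T\<bar> * C + \<bar>sqrt T\<bar> * R"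
  have pK: "br.path T s (u n, w) \<in> cball 0 K" if "s \<in> {0..1}" for s n
  proof -
    have "norm (br.path T s (u n, w)) \<le> \<bar>sqrt T\<bar> * norm (X s w) + \<bar>s * sqrt T\<bar> * norm (u n)"
      unfolding br.path_def by (rule order_trans[OF norm_triangle_ineq]) simp
    also have "\<dots> \<le> \<bar>sqrt T\<bar> * C + \<bar>sqrt T\<bar> * R"
    proof (intro add_mono mult_mono R)
      show "norm (X s w) \<le> C" using C that by blast
      show "\<bar>s * sqrt T\<bar> \<le> \<bar>sqrt T\<bar>" using that by (simp add: abs_mult mult_left_le_one_le)
    qed auto
    finally show ?thesis by (simp add: K_def)
  qed
  have "bounded (g ` cball 0 K)"
    by (intro compact_imp_bounded compact_continuous_image continuous_on_subset[OF g]) auto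
  then obtain B where B: "\<forall>y\<in>g ` cball 0 K. norm y \<le> B" unfolding bounded_iff by blast
  have m: "(\<lambda>s. indicator {0..1} s *\<^sub>R (g (br.path T s (n, w)))\<^sup>2) \<in> borel_measurable lborel" for n
  proof -
    have "continuous_on {0..1} (\<lambda>s. (g (br.path T s (n, w)))\<^sup>2)"
      using w by (intro continuous_on_power continuous_on_compose2[OF g] br.path_cont) (auto simp: br.space_joint)
    from borel_measurable_continuous_on_indicator[OF _ this] show ?thesis by simp
  qed
  have "(\<lambda>n. \<integral>s. indicator {0..1} s *\<^sub>R (g (br.path T s (u n, w)))\<^sup>2 \<partial>lborel) \<longlonglongrightarrow> (\<integral>s. indicator {0..1} s *\<^sub>R (g (br.path T s (a, w)))\<^sup>2 \<partial>lborel)"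
  proof (rule integral_dominated_convergence[where w="\<lambda>s. B\<^sup>2 * indicator {0..1} s"])
    show "integrable lborel (\<lambda>s. B\<^sup>2 * indicator {0..1::real} s)" by (simp add: emeasure_lborel_Icc_eq)
    have "(\<lambda>n. br.path T s (u n, w)) \<longlonglongrightarrow> br.path T s (a, w)" for s
      unfolding br.path_def using u by (auto intro!: tendsto_intros)
    then show "AE s in lborel. (\<lambda>n. indicator {0..1} s *\<^sub>R (g (br.path T s (u n, w)))\<^sup>2) \<longlonglongrightarrow> indicator {0..1} s *\<^sub>R (g (br.path T s (a, w)))\<^sup>2"
      by (intro AE_I2 tendsto_scaleR tendsto_const tendsto_power continuous_on_tendsto_compose[OF g]) auto
    show "AE s in lborel. norm (indicator {0..1} s *\<^sub>R (g (br.path T s (u n, w)))\<^sup>2) \<le> B\<^sup>2 * indicator {0..1} s" for n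
    proof (rule AE_I2)
      fix s :: real
      show "norm (indicator {0..1} s *\<^sub>R (g (br.path T s (u n, w)))\<^sup>2) \<le> B\<^sup>2 * indicator {0..1} s"
      proof (cases "s \<in> {0..1}")
        case True
        have "norm (g (br.path T s (u n, w))) \<le> B" using B pK[OF True, of n] by blast
        then have "\<bar>g (br.path T s (u n, w))\<bar> \<le> \<bar>B\<bar>" by simp
        then have "(g (br.path T s (u n, w)))\<^sup>2 \<le> B\<^sup>2" by (simp only: abs_le_square_iff)
        then show ?thesis using True by simp
      qed simp
    qed
  qed (rule m)+
  then show "(\<lambda>n. variance_of g T (u n, w)) \<longlonglongrightarrow> variance_of g T (a, w)"
    unfolding variance_of_def set_lebesgue_integral_def by (intro tendsto_intros)
qed

text \<open>For \<open>0 < v\<close>, the heat semigroup applied to \<phi>. Written with a standard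
  normal vector, it stays meaningful and continuous at \<open>v = 0\<close>, where the kernel
  degenerates.\<close>

definition smear :: "('b \<Rightarrow> real) \<Rightarrow> 'b \<Rightarrow> real \<Rightarrow> real" where
  "smear \<phi> y v = (\<integral>n. \<phi> (y + sqrt v *\<^sub>R n) \<partial>N2)"

lemma
  assumes \<phi>: "continuous_on UNIV \<phi>" "\<And>\<eta>. \<bar>\<phi> \<eta>\<bar> \<le> B"
  shows smear_continuous: "continuous_on UNIV (smear \<phi> y)" and smear_bound: "\<bar>smear \<phi> y v\<bar> \<le> B"
proof -
  interpret N: prob_space N2 by (rule prob_N2)
  have \<phi>m: "\<phi> \<in> borel_measurable borel" using \<phi>(1) by (rule borel_measurable_continuous_onI)
  have m: "(\<lambda>n. \<phi> (y + sqrt v *\<^sub>R n)) \<in> borel_measurable N2" for v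
    by (intro measurable_compose[OF _ \<phi>m]) measurable
  show "continuous_on UNIV (smear \<phi> y)"
  proof (rule continuous_on_sequentiallyI)
    fix u :: "nat \<Rightarrow> real" and a assume u: "u \<longlonglongrightarrow> a"
    show "(\<lambda>n. smear \<phi> y (u n)) \<longlonglongrightarrow> smear \<phi> y a"
      unfolding smear_def
    proof (rule integral_dominated_convergence[where w="\<lambda>_. B"])
      show "AE n in N2. (\<lambda>i. \<phi> (y + sqrt (u i) *\<^sub>R n)) \<longlonglongrightarrow> \<phi> (y + sqrt a *\<^sub>R n)"
        using u by (intro AE_I2 continuous_on_tendsto_compose[OF \<phi>(1)]) (auto intro!: tendsto_intros)
    qed (use m \<phi>(2) in auto)
  qed
  have "\<bar>smear \<phi> y v\<bar> \<le> (\<integral>n. \<bar>\<phi> (y + sqrt v *\<^sub>R n)\<bar> \<partial>N2)" unfolding smear_def by (rule integral_abs_bound)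
  also have "\<dots> \<le> (\<integral>n. B \<partial>N2)"
  proof (rule integral_mono)
    show "integrable N2 (\<lambda>n. \<bar>\<phi> (y + sqrt v *\<^sub>R n)\<bar>)"
      by (rule N.integrable_const_bound[where B=B]) (use m \<phi>(2) in auto)
  qed (use \<phi>(2) in auto)
  also have "\<dots> = B" by (simp add: N.prob_space[simplified])
  finally show "\<bar>smear \<phi> y v\<bar> \<le> B" .
qed

lemma section_measurable:
  assumes \<phi>: "continuous_on UNIV \<phi>" "\<And>\<eta>. \<bar>\<phi> \<eta>\<bar> \<le> B" and g: "continuous_on UNIV g"
  shows "(\<lambda>z. smear \<phi> y (variance_of g T z)) \<in> borel_measurable br.joint"
  by (rule measurable_compose[OF variance_of_measurable[OF g] borel_measurable_continuous_onI[OF smear_continuous[OF \<phi>]]])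

lemma
  assumes \<phi>: "continuous_on UNIV \<phi>" "\<And>\<eta>. \<bar>\<phi> \<eta>\<bar> \<le> B" and g: "continuous_on UNIV g"
  shows smear_variance_continuous: "continuous_on UNIV (\<lambda>n. \<integral>w. smear \<phi> y (variance_of g T (n, w)) \<partial>\<mu>)"
    and smear_variance_measurable: "(\<lambda>w. smear \<phi> y (variance_of g T (n, w))) \<in> borel_measurable \<mu>"
proof -
  have m: "(\<lambda>w. smear \<phi> y (variance_of g T (n, w))) \<in> borel_measurable \<mu>" for n
    by (rule measurable_compose[OF variance_section_measurable[OF g] borel_measurable_continuous_onI[OF smear_continuous[OF \<phi>]]])
  then show "(\<lambda>w. smear \<phi> y (variance_of g T (n, w))) \<in> borel_measurable \<mu>" .
  show "continuous_on UNIV (\<lambda>n. \<integral>w. smear \<phi> y (variance_of g T (n, w)) \<partial>\<mu>)"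
  proof (rule continuous_on_sequentiallyI)
    fix u :: "nat \<Rightarrow> 'a" and a assume u: "u \<longlonglongrightarrow> a"
    show "(\<lambda>n. \<integral>w. smear \<phi> y (variance_of g T (u n, w)) \<partial>\<mu>) \<longlonglongrightarrow> (\<integral>w. smear \<phi> y (variance_of g T (a, w)) \<partial>\<mu>)"
    proof (rule integral_dominated_convergence[where w="\<lambda>_. B"])
      show "AE w in \<mu>. (\<lambda>n. smear \<phi> y (variance_of g T (u n, w))) \<longlonglongrightarrow> smear \<phi> y (variance_of g T (a, w))"
        using u by (intro AE_I2 continuous_on_tendsto_compose[OF smear_continuous[OF \<phi>]]
            continuous_on_tendsto_compose[OF variance_continuous[OF g]]) auto
    qed (use m smear_bound[OF \<phi>] in auto)
  qed
qed

text \<open>Disintegration over the value \<xi> of the first component: the normal vector is then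
  \<open>(1 / sqrt T) *\<^sub>R (\<xi> - x)\<close>, and the change of variables brings in the
  kernel \<open>gauss_kernel T\<close>.\<close>

lemma endpoint_product_expectation:
  assumes T: "0 < T" and g: "continuous_on UNIV g" "\<And>z. 0 \<le> g z"
    and ito: "is_ito_integral M filt b' (\<lambda>s \<omega>. g (b s \<omega>)) T J"
    and f: "continuous_on UNIV f" "\<And>z. \<bar>f z\<bar> \<le> A" and \<phi>: "continuous_on UNIV \<phi>" "\<And>\<eta>. \<bar>\<phi> \<eta>\<bar> \<le> B"
  shows "(\<integral>\<omega>. f (x + b T \<omega>) * \<phi> (y + J \<omega>) \<partial>M)
    = (\<integral>\<xi>. f \<xi> * (gauss_kernel T (\<xi> - x) * (\<integral>w. smear \<phi> y (variance_of g T ((1 / sqrt T) *\<^sub>R (\<xi> - x), w)) \<partial>\<mu>)) \<partial>lborel)"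
proof -
  interpret J: prob_space br.joint by (rule br.prob_joint)
  interpret N: prob_space N2 by (rule prob_N2)
  interpret N1: prob_space br.N1 by (rule br.prob_N1)
  interpret JN: pair_prob_space br.joint N2 ..
  interpret P: pair_prob_space br.N1 \<mu> ..
  have fm: "f \<in> borel_measurable borel" using f(1) by (rule borel_measurable_continuous_onI)
  have \<phi>m: "\<phi> \<in> borel_measurable borel" using \<phi>(1) by (rule borel_measurable_continuous_onI)
  define F where "F p = f (x + fst p) * \<phi> (y + snd p)" for p :: "'a \<times> 'b"
  have Fm: "F \<in> borel_measurable borel"
    unfolding F_def[abs_def]
    by (intro borel_measurable_continuous_onI continuous_on_mult continuous_on_compose2[OF f(1)] continuous_on_compose2[OF \<phi>(1)])
       (auto intro!: continuous_intros)
  have A: "0 \<le> A" using f(2)[of 0] by linarith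
  have Fb: "\<bar>F p\<bar> \<le> A * B" for p unfolding F_def abs_mult using f(2) \<phi>(2) A by (intro mult_mono) auto
  let ?V = "variance_of g T"
  let ?\<Theta> = "\<lambda>n. \<integral>w. smear \<phi> y (?V (n, w)) \<partial>\<mu>"
  have "(\<integral>\<omega>. f (x + b T \<omega>) * \<phi> (y + J \<omega>) \<partial>M) = (\<integral>\<omega>. F (b T \<omega>, J \<omega>) \<partial>M)" by (simp add: F_def)
  also have "\<dots> = (\<integral>q. F (sqrt T *\<^sub>R fst (fst q), sqrt (?V (fst q)) *\<^sub>R snd q) \<partial>(br.joint \<Otimes>\<^sub>M N2))"
    by (rule endpoint_law[OF T g ito Fm])
  also have "\<dots> = (\<integral>z. (\<integral>n. F (sqrt T *\<^sub>R fst z, sqrt (?V z) *\<^sub>R n) \<partial>N2) \<partial>br.joint)"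
  proof -
    have "integrable (br.joint \<Otimes>\<^sub>M N2) (\<lambda>q. F (sqrt T *\<^sub>R fst (fst q), sqrt (?V (fst q)) *\<^sub>R snd q))"
      by (rule JN.integrable_const_bound[where B="A * B"])
         (use Fb measurable_compose[OF endpoint_measurable[OF g(1)] Fm] in auto)
    from JN.integral_fst'[OF this] show ?thesis by simp
  qed
  also have "\<dots> = (\<integral>z. f (x + sqrt T *\<^sub>R fst z) * smear \<phi> y (?V z) \<partial>br.joint)"
    by (simp add: F_def smear_def)
  also have "\<dots> = (\<integral>n. (\<integral>w. f (x + sqrt T *\<^sub>R n) * smear \<phi> y (?V (n, w)) \<partial>\<mu>) \<partial>br.N1)"
  proof -
    have 1: "(\<lambda>z. f (x + sqrt T *\<^sub>R fst z)) \<in> borel_measurable (br.N1 \<Otimes>\<^sub>M \<mu>)"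
    proof -
      have "(\<lambda>n. f (x + sqrt T *\<^sub>R n)) \<in> borel_measurable br.N1"
        by (intro measurable_compose[OF _ fm]) measurable
      then show ?thesis by (rule measurable_compose[OF measurable_fst])
    qed
    have "integrable (br.N1 \<Otimes>\<^sub>M \<mu>) (\<lambda>z. f (x + sqrt T *\<^sub>R fst z) * smear \<phi> y (?V z))"
    proof (rule P.integrable_const_bound[where B="A * B"])
      show "AE z in br.N1 \<Otimes>\<^sub>M \<mu>. norm (f (x + sqrt T *\<^sub>R fst z) * smear \<phi> y (?V z)) \<le> A * B"
        unfolding real_norm_def abs_mult using f(2) A by (intro AE_I2 mult_mono smear_bound[OF \<phi>]) auto
      show "(\<lambda>z. f (x + sqrt T *\<^sub>R fst z) * smear \<phi> y (?V z)) \<in> borel_measurable (br.N1 \<Otimes>\<^sub>M \<mu>)"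
        using section_measurable[OF \<phi> g(1)] by (intro borel_measurable_times 1) (simp add: br.joint_def)
    qed
    from P.integral_fst'[OF this] show ?thesis by (simp add: br.joint_def)
  qed
  also have "\<dots> = (\<integral>n. f (x + sqrt T *\<^sub>R n) * ?\<Theta> n \<partial>br.N1)" by simp
  also have "\<dots> = (\<integral>n. (\<lambda>\<xi>. f \<xi> * ?\<Theta> ((1 / sqrt T) *\<^sub>R (\<xi> - x))) (x + sqrt T *\<^sub>R n) \<partial>br.N1)"
    using T by simp
  also have "\<dots> = (\<integral>\<xi>. gauss_kernel T (\<xi> - x) *\<^sub>R (f \<xi> * ?\<Theta> ((1 / sqrt T) *\<^sub>R (\<xi> - x))) \<partial>lborel)"
    unfolding br.N1_def
  proof (rule integral_gauss_affine[OF T])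
    have "(\<lambda>\<xi>. ?\<Theta> ((1 / sqrt T) *\<^sub>R (\<xi> - x))) \<in> borel_measurable borel"
      by (intro borel_measurable_continuous_onI continuous_on_compose2[OF smear_variance_continuous[OF \<phi> g(1)]]) (auto intro!: continuous_intros)
    then show "(\<lambda>\<xi>. f \<xi> * ?\<Theta> ((1 / sqrt T) *\<^sub>R (\<xi> - x))) \<in> borel_measurable borel"
      using fm by (rule borel_measurable_times[rotated])
  qed
  finally show ?thesis by (simp add: mult_ac)
qed

text \<open>Testing against products \<open>f \<xi> * \<phi> \<eta>\<close> identifies two
  continuous functions of \<xi>, so that \<xi> may be set to \<open>x\<close>. There the normal
  vector is 0 and the path reduces to the scaled bridge.\<close>

lemma density_section:
  assumes T: "0 < T" and g: "continuous_on UNIV g" "\<And>z. 0 \<le> g z"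
    and ito: "is_ito_integral M filt b' (\<lambda>s \<omega>. g (b s \<omega>)) T J"
    and q: "continuous_on UNIV q"
    and law: "\<And>f::'a \<times> 'b \<Rightarrow> real. continuous_on UNIV f \<Longrightarrow> bounded (range f) \<Longrightarrow>
      has_bochner_integral lborel (\<lambda>w. f w * q w) (\<integral>\<omega>. f (x + b T \<omega>, y + J \<omega>) \<partial>M)"
    and \<phi>: "continuous_on UNIV \<phi>" "\<And>\<eta>. \<eta> \<notin> cball c r \<Longrightarrow> \<phi> \<eta> = 0"
  shows "(\<integral>\<eta>. \<phi> \<eta> * q (x, \<eta>) \<partial>lborel) = gauss_kernel T (0::'a) * (\<integral>w. smear \<phi> y (variance_of g T (0, w)) \<partial>\<mu>)"
proof -
  obtain B where B: "\<And>\<eta>. \<bar>\<phi> \<eta>\<bar> \<le> B" using compact_support_bounded[OF \<phi>] by blast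
  define E where "E \<xi> = gauss_kernel T (\<xi> - x) * (\<integral>w. smear \<phi> y (variance_of g T ((1 / sqrt T) *\<^sub>R (\<xi> - x), w)) \<partial>\<mu>)" for \<xi>
  have "(\<integral>\<eta>. \<phi> \<eta> * q (x, \<eta>) \<partial>lborel) = E x"
  proof (rule continuous_eq_of_integrals[where D="\<lambda>\<xi>. \<integral>\<eta>. \<phi> \<eta> * q (\<xi>, \<eta>) \<partial>lborel" and E=E and x=x])
    show "continuous_on UNIV (\<lambda>\<xi>. \<integral>\<eta>. \<phi> \<eta> * q (\<xi>, \<eta>) \<partial>lborel)" by (rule param_integral_continuous[OF \<phi> q])
    show "continuous_on UNIV E"
      unfolding E_def
      by (intro continuous_on_mult continuous_on_compose2[OF gauss_kernel_continuous[of UNIV]]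
          continuous_on_compose2[OF smear_variance_continuous[OF \<phi>(1) B g(1)]]) (auto intro!: continuous_intros)
    fix f :: "'a \<Rightarrow> real" assume f: "continuous_on UNIV f" "\<And>z. z \<notin> cball x 1 \<Longrightarrow> f z = 0"
    obtain A where A: "0 \<le> A" "\<And>\<xi>. \<bar>f \<xi>\<bar> \<le> A" using compact_support_bounded[OF f] by blast
    let ?F = "\<lambda>p :: 'a \<times> 'b. f (fst p) * \<phi> (snd p)"
    have Fc: "continuous_on UNIV ?F"
      by (intro continuous_on_mult continuous_on_compose2[OF f(1)] continuous_on_compose2[OF \<phi>(1)]) (auto intro!: continuous_intros)
    have "\<bar>?F p\<bar> \<le> A * B" for p unfolding abs_mult using A B by (intro mult_mono) auto
    then have Fb: "bounded (range ?F)" by (intro boundedI[of _ "A * B"]) auto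
    note hb = law[OF Fc Fb]
    have i: "integrable (lborel \<Otimes>\<^sub>M lborel) (\<lambda>p. ?F p * q p)"
      using hb by (simp add: lborel_prod has_bochner_integral_iff)
    have "(\<integral>\<xi>. f \<xi> * (\<integral>\<eta>. \<phi> \<eta> * q (\<xi>, \<eta>) \<partial>lborel) \<partial>lborel) = (\<integral>\<xi>. (\<integral>\<eta>. ?F (\<xi>, \<eta>) * q (\<xi>, \<eta>) \<partial>lborel) \<partial>lborel)"
      by (simp add: mult.assoc)
    also have "\<dots> = (\<integral>p. ?F p * q p \<partial>(lborel \<Otimes>\<^sub>M lborel))" by (rule lborel_pair.integral_fst'[OF i])
    also have "\<dots> = (\<integral>\<omega>. f (x + b T \<omega>) * \<phi> (y + J \<omega>) \<partial>M)"
      using hb by (simp add: lborel_prod has_bochner_integral_iff)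
    also have "\<dots> = (\<integral>\<xi>. f \<xi> * E \<xi> \<partial>lborel)"
      unfolding E_def by (rule endpoint_product_expectation[OF T g ito f(1) A(2) \<phi>(1) B])
    finally show "(\<integral>\<xi>. f \<xi> * (\<integral>\<eta>. \<phi> \<eta> * q (\<xi>, \<eta>) \<partial>lborel) \<partial>lborel) = (\<integral>\<xi>. f \<xi> * E \<xi> \<partial>lborel)" .
  qed
  then show ?thesis by (simp add: E_def)
qed

lemma smear_tent:
  assumes v: "0 < v" and s: "0 < s"
  shows "smear (\<lambda>\<eta>. tent ((1 / s) *\<^sub>R (\<eta> - y))) y v = s ^ DIM('b) * (\<integral>\<eta>. gauss_kernel v (s *\<^sub>R (\<eta>::'b)) * tent \<eta> \<partial>lborel)"
proof -
  have tm[measurable]: "tent \<in> borel_measurable (borel :: 'b measure)"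
    by (rule borel_measurable_continuous_onI[OF tent_continuous])
  have "smear (\<lambda>\<eta>. tent ((1 / s) *\<^sub>R (\<eta> - y))) y v = (\<integral>\<eta>. gauss_kernel v (\<eta> - y) *\<^sub>R tent ((1 / s) *\<^sub>R (\<eta> - y)) \<partial>lborel)"
    unfolding smear_def N2_def by (rule integral_gauss_affine[OF v]) measurable
  also have "\<dots> = s ^ DIM('b) * (\<integral>\<eta>. gauss_kernel v (y + s *\<^sub>R \<eta> - y) *\<^sub>R tent ((1 / s) *\<^sub>R (y + s *\<^sub>R \<eta> - y)) \<partial>lborel)"
    by (rule lborel_integral_scale[OF s]) measurable
  finally show ?thesis using s by simp
qed

text \<open>Testing the density against shrinking tents in the second variable: by unimodality of the Gaussian
  kernel the averages increase to its value at the centre, so monotone convergence also yields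
  integrability without any bound on negative moments.\<close>

lemma density_diagonal:
  assumes T: "0 < T" and g: "continuous_on UNIV g" "\<And>z. 0 \<le> g z"
    and ito: "is_ito_integral M filt b' (\<lambda>s \<omega>. g (b s \<omega>)) T J"
    and q: "continuous_on UNIV q"
    and law: "\<And>f::'a \<times> 'b \<Rightarrow> real. continuous_on UNIV f \<Longrightarrow> bounded (range f) \<Longrightarrow>
      has_bochner_integral lborel (\<lambda>w. f w * q w) (\<integral>\<omega>. f (x + b T \<omega>, y + J \<omega>) \<partial>M)"
    and pos: "AE w in \<mu>. 0 < variance_of g T (0, w)"
  shows "integrable \<mu> (\<lambda>w. gauss_kernel (variance_of g T (0, w)) (0::'b))"
    and "q (x, y) = gauss_kernel T (0::'a) * (\<integral>w. gauss_kernel (variance_of g T (0, w)) (0::'b) \<partial>\<mu>)"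
proof -
  define t where "t = (\<integral>\<eta>. tent (\<eta>::'b) \<partial>lborel)"
  have t: "0 < t" unfolding t_def by (rule tent_integral_pos)
  define G where "G = gauss_kernel T (0::'a)"
  have G: "0 < G" unfolding G_def by (rule gauss_kernel_pos[OF T])
  define s where "s k = 1 / real (Suc k)" for k
  have s: "0 < s k" "s k \<le> 1" for k by (auto simp: s_def)
  have s0: "s \<longlonglongrightarrow> 0" unfolding s_def using LIMSEQ_inverse_real_of_nat by (simp add: inverse_eq_divide)
  define \<phi> where "\<phi> k \<eta> = tent ((1 / s k) *\<^sub>R (\<eta> - y))" for k \<eta>
  have \<phi>: "continuous_on UNIV (\<phi> k)" "\<bar>\<phi> k \<eta>\<bar> \<le> 1" for k \<eta>
    unfolding \<phi>_def
    by (auto simp: tent_bounds abs_of_nonneg intro!: continuous_on_compose2[OF tent_continuous[of UNIV]] continuous_intros)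
  have \<phi>s: "\<phi> k \<eta> = 0" if "\<eta> \<notin> cball y 1" for k \<eta>
    unfolding \<phi>_def
  proof (rule tent_support)
    have "1 < norm (\<eta> - y)" using that by (simp add: dist_norm norm_minus_commute)
    also have "\<dots> \<le> (1 / s k) * norm (\<eta> - y)" by (simp add: s_def distrib_right)
    also have "\<dots> = norm ((1 / s k) *\<^sub>R (\<eta> - y))" using s(1)[of k] by simp
    finally show "1 < norm ((1 / s k) *\<^sub>R (\<eta> - y))" .
  qed
  have qm: "(\<lambda>\<eta>. q (x, \<eta>)) \<in> borel_measurable borel"
    by (intro borel_measurable_continuous_onI continuous_on_compose2[OF q]) (auto intro!: continuous_intros)
  have tm[measurable]: "tent \<in> borel_measurable (borel :: 'b measure)"
    by (rule borel_measurable_continuous_onI[OF tent_continuous])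
  \<comment> \<open>Scaled so that, for positive variance, it becomes an average of the kernel
    against a tent that no longer depends on \<open>k\<close>.\<close>
  define A where "A k w = (1 / s k) ^ DIM('b) * smear (\<phi> k) y (variance_of g T (0, w))" for k w
  have Am: "A k \<in> borel_measurable \<mu>" for k
    unfolding A_def[abs_def] by (intro borel_measurable_times borel_measurable_const smear_variance_measurable[OF \<phi> g(1)])
  have Ai: "integrable \<mu> (A k)" for k
  proof (rule br.integrable_const_bound[OF _ Am])
    show "AE w in \<mu>. norm (A k w) \<le> (1 / s k) ^ DIM('b) * 1"
      unfolding A_def real_norm_def abs_mult
      using s(1)[of k] by (intro AE_I2 mult_mono smear_bound[OF \<phi>]) auto
  qed
  have Aeq: "A k w = (\<integral>\<eta>. gauss_kernel (variance_of g T (0, w)) (s k *\<^sub>R (\<eta>::'b)) * tent \<eta> \<partial>lborel)" if "0 < variance_of g T (0, w)" for k w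
    unfolding A_def \<phi>_def smear_tent[OF that s(1)] using s(1)[of k] by (simp add: power_divide)
  have gi: "integrable lborel (\<lambda>\<eta>::'b. gauss_kernel v (r *\<^sub>R \<eta>) * tent \<eta>)" for v r
    by (rule compact_support_integrable[of _ 0 1])
       (auto intro!: continuous_on_mult tent_continuous continuous_on_compose2[OF gauss_kernel_continuous[of UNIV]] continuous_intros simp: tent_support)
  have mono: "AE w in \<mu>. mono (\<lambda>k. A k w)"
    using pos
  proof eventually_elim
    case (elim w)
    show ?case
    proof (rule monoI)
      fix i j :: nat assume "i \<le> j"
      then have "s j \<le> s i" by (simp add: s_def frac_le)
      then show "A i w \<le> A j w"
        unfolding Aeq[OF elim] using s elim
        by (intro integral_mono gi mult_right_mono gauss_kernel_mono_scale) (auto simp: tent_bounds less_imp_le)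
    qed
  qed
  have lim: "AE w in \<mu>. (\<lambda>k. A k w) \<longlonglongrightarrow> gauss_kernel (variance_of g T (0, w)) (0::'b) * t"
    using pos
  proof eventually_elim
    case (elim w)
    let ?v = "variance_of g T (0, w)"
    have "(\<lambda>k. \<integral>\<eta>. gauss_kernel ?v (s k *\<^sub>R (\<eta>::'b)) * tent \<eta> \<partial>lborel) \<longlonglongrightarrow> (\<integral>\<eta>. gauss_kernel ?v (0::'b) * tent (\<eta>::'b) \<partial>lborel)"
    proof (rule integral_dominated_convergence[where w="\<lambda>\<eta>. gauss_kernel ?v (0::'b) * tent \<eta>"])
      show "integrable lborel (\<lambda>\<eta>::'b. gauss_kernel ?v (0::'b) * tent \<eta>)" by (intro integrable_mult_right tent_integrable)
      have "(\<lambda>k. s k *\<^sub>R \<eta>) \<longlonglongrightarrow> 0 *\<^sub>R \<eta>" for \<eta> :: 'b by (intro tendsto_intros s0)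
      then have gl: "(\<lambda>k. gauss_kernel ?v (s k *\<^sub>R \<eta>)) \<longlonglongrightarrow> gauss_kernel ?v (0 *\<^sub>R \<eta>)" for \<eta> :: 'b
        by (intro continuous_on_tendsto_compose[OF gauss_kernel_continuous[of UNIV]]) simp_all
      show "AE \<eta> in (lborel :: 'b measure). (\<lambda>k. gauss_kernel ?v (s k *\<^sub>R \<eta>) * tent \<eta>) \<longlonglongrightarrow> gauss_kernel ?v (0::'b) * tent \<eta>"
        using gl by (intro AE_I2 tendsto_mult tendsto_const) simp
      show "AE \<eta> in (lborel :: 'b measure). norm (gauss_kernel ?v (s k *\<^sub>R \<eta>) * tent \<eta>) \<le> gauss_kernel ?v (0::'b) * tent \<eta>" for k
        using gauss_kernel_le_zero[OF elim] elim
        by (intro AE_I2) (auto simp: abs_mult tent_bounds abs_of_nonneg[OF gauss_kernel_nonneg] intro!: mult_right_mono)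
    qed measurable
    then show ?case unfolding Aeq[OF elim] t_def by simp
  qed
  \<comment> \<open>Substituting \<open>y + s k *\<^sub>R \<eta>\<close> turns the left side of
    \<open>density_section\<close> into an average of \<open>q\<close> near \<open>(x, y)\<close>;
    the Jacobian \<open>s k ^ DIM('b)\<close> cancels against the scaling in
    \<open>A k\<close>.\<close>
  have int: "(\<integral>\<eta>. tent \<eta> * q (x, y + s k *\<^sub>R \<eta>) \<partial>lborel) = G * (\<integral>w. A k w \<partial>\<mu>)" for k
  proof -
    have "s k ^ DIM('b) * (\<integral>\<eta>. tent \<eta> * q (x, y + s k *\<^sub>R \<eta>) \<partial>lborel)
      = s k ^ DIM('b) * (\<integral>\<eta>. \<phi> k (y + s k *\<^sub>R \<eta>) * q (x, y + s k *\<^sub>R \<eta>) \<partial>lborel)"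
      using s(1)[of k] by (simp add: \<phi>_def)
    also have "\<dots> = (\<integral>\<eta>. \<phi> k \<eta> * q (x, \<eta>) \<partial>lborel)"
      by (rule lborel_integral_scale[OF s(1), symmetric])
         (intro borel_measurable_times qm borel_measurable_continuous_onI[OF \<phi>(1)])
    also have "\<dots> = G * (\<integral>w. smear (\<phi> k) y (variance_of g T (0, w)) \<partial>\<mu>)"
      unfolding G_def by (rule density_section[OF T g ito q law \<phi>(1) \<phi>s])
    finally show ?thesis unfolding A_def using s(1)[of k] by (simp add: power_divide field_simps)
  qed
  have "(\<lambda>k. \<integral>\<eta>. tent \<eta> * q (x, y + s k *\<^sub>R \<eta>) \<partial>lborel) \<longlonglongrightarrow> (\<integral>\<eta>. tent (\<eta>::'b) * q (x, y) \<partial>lborel)"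
  proof -
    have "bounded (q ` ({x} \<times> cball y 1))"
      by (intro compact_imp_bounded compact_continuous_image compact_Times continuous_on_subset[OF q]) auto
    then obtain B where B: "\<forall>r\<in>q ` ({x} \<times> cball y 1). norm r \<le> B" unfolding bounded_iff by blast
    show ?thesis
    proof (rule integral_dominated_convergence[where w="\<lambda>\<eta>. tent \<eta> * B"])
      show "integrable lborel (\<lambda>\<eta>::'b. tent \<eta> * B)" by (intro integrable_mult_left tent_integrable)
      have "(\<lambda>k. (x, y + s k *\<^sub>R \<eta>)) \<longlonglongrightarrow> (x, y + 0 *\<^sub>R \<eta>)" for \<eta> :: 'b by (intro tendsto_intros s0)
      then show "AE \<eta> in lborel. (\<lambda>k. tent \<eta> * q (x, y + s k *\<^sub>R \<eta>)) \<longlonglongrightarrow> tent \<eta> * q (x, y)"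
        by (intro AE_I2 tendsto_mult tendsto_const continuous_on_tendsto_compose[OF q]) auto
      show "AE \<eta> in lborel. norm (tent \<eta> * q (x, y + s k *\<^sub>R \<eta>)) \<le> tent \<eta> * B" for k
      proof (rule AE_I2)
        fix \<eta> :: 'b
        show "norm (tent \<eta> * q (x, y + s k *\<^sub>R \<eta>)) \<le> tent \<eta> * B"
        proof (cases "norm \<eta> \<le> 1")
          case True
          have "s k * norm \<eta> \<le> 1 * 1" using s[of k] True by (intro mult_mono) auto
          then have "(x, y + s k *\<^sub>R \<eta>) \<in> {x} \<times> cball y 1" using s(1)[of k] by (simp add: dist_norm)
          then have "\<bar>q (x, y + s k *\<^sub>R \<eta>)\<bar> \<le> B" using B by fastforce
          then show ?thesis using tent_bounds(1)[of \<eta>] by (simp add: abs_mult mult_left_mono)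
        qed (simp add: tent_support)
      qed
      show "(\<lambda>\<eta>. tent \<eta> * q (x, y + s k *\<^sub>R \<eta>)) \<in> borel_measurable lborel" for k
        using measurable_compose[OF _ qm, of "\<lambda>\<eta>. y + s k *\<^sub>R \<eta>" borel] by (intro borel_measurable_times) auto
    qed measurable
  qed
  \<comment> \<open>Continuity of \<open>q\<close> forces the integrals of \<open>A k\<close> to a
    finite limit; this is the input that lets monotone convergence deliver integrability.\<close>
  then have "(\<lambda>k. G * (\<integral>w. A k w \<partial>\<mu>)) \<longlonglongrightarrow> t * q (x, y)" unfolding int t_def by simp
  then have "(\<lambda>k. (G * (\<integral>w. A k w \<partial>\<mu>)) / G) \<longlonglongrightarrow> t * q (x, y) / G" by (rule tendsto_divide[OF _ tendsto_const]) (use G in simp)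
  then have ilim: "(\<lambda>k. \<integral>w. A k w \<partial>\<mu>) \<longlonglongrightarrow> t * q (x, y) / G" using G by simp
  have um: "(\<lambda>w. gauss_kernel (variance_of g T (0, w)) (0::'b) * t) \<in> borel_measurable \<mu>"
    by (intro borel_measurable_times borel_measurable_const measurable_compose[OF variance_section_measurable[OF g(1)] gauss_kernel_variance_measurable])
  from integrable_monotone_convergence[OF Ai mono lim ilim um] t
  show "integrable \<mu> (\<lambda>w. gauss_kernel (variance_of g T (0, w)) (0::'b))" by simp
  from integral_monotone_convergence[OF Ai mono lim ilim um]
  have "(\<integral>w. gauss_kernel (variance_of g T (0, w)) (0::'b) \<partial>\<mu>) * t = t * q (x, y) / G" by simp
  then show "q (x, y) = gauss_kernel T (0::'a) * (\<integral>w. gauss_kernel (variance_of g T (0, w)) (0::'b) \<partial>\<mu>)"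
    using t G unfolding G_def[symmetric] by (simp add: field_simps)
qed

end

section \<open>Occupation of the bridge and small times\<close>

lemma set_integral_pos_continuous:
  fixes f :: "real \<Rightarrow> real"
  assumes f: "continuous_on {0..1} f" "\<And>s. s \<in> {0..1} \<Longrightarrow> 0 \<le> f s" and r: "r \<in> {0..1}" "f r \<noteq> 0"
  shows "0 < (\<integral>s\<in>{0..1}. f s \<partial>lborel)"
proof -
  have si: "set_integrable lborel {0..1} f" by (rule borel_integrable_atLeastAtMost'[OF f(1)])
  have eq: "(\<integral>s\<in>{0..1}. f s \<partial>lborel) = integral {0..1} f" by (rule set_borel_integral_eq_integral(2)[OF si])
  have "0 \<le> (\<integral>s\<in>{0..1}. f s \<partial>lborel)"
    unfolding set_lebesgue_integral_def using f(2) by (intro integral_nonneg_AE AE_I2) (auto simp: indicator_def)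
  moreover have "integral {0..1} f \<noteq> 0" using integral_eq_0_iff[OF f(1) _ f(2)] r by auto
  ultimately show ?thesis unfolding eq by simp
qed

text \<open>The sum is at most \<open>card I\<close> times its largest term, whose power occurs on
  the right.\<close>

lemma power_sum_le:
  fixes a :: "'i \<Rightarrow> real"
  assumes "finite I" "I \<noteq> {}" "\<And>i. i \<in> I \<Longrightarrow> 0 \<le> a i"
  shows "(\<Sum>i\<in>I. a i) ^ q \<le> real (card I) ^ q * (\<Sum>i\<in>I. a i ^ q)"
proof -
  define m where "m = Max (a ` I)"
  have "m \<in> a ` I" unfolding m_def using assms by (intro Max_in) auto
  then obtain j where j: "j \<in> I" "m = a j" by blast
  have le: "a i \<le> m" if "i \<in> I" for i unfolding m_def using assms(1) that by (intro Max_ge) auto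
  have "(\<Sum>i\<in>I. a i) \<le> real (card I) * m" using le by (intro sum_bounded_above) auto
  then have "(\<Sum>i\<in>I. a i) ^ q \<le> (real (card I) * m) ^ q" using assms(3) by (intro power_mono sum_nonneg)
  also have "\<dots> = real (card I) ^ q * a j ^ q" by (simp add: power_mult_distrib j)
  also have "\<dots> \<le> real (card I) ^ q * (\<Sum>i\<in>I. a i ^ q)"
    using assms j by (intro mult_left_mono member_le_sum) auto
  finally show ?thesis .
qed

text \<open>If the time \<open>A\<close> spent by \<open>F\<close> below the level \<open>\<rho>\<close> is small, then \<open>F\<close> exceeds \<open>\<rho>\<close> for a time at least
  \<open>A\<close> before \<open>2 A\<close>, where the weight \<open>s\<close> to the power \<open>-(e + 1)\<close> is large.\<close>

lemma occupation_time_bound: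
  fixes F :: "real \<Rightarrow> real"
  assumes F: "continuous_on UNIV F" "F 0 = 0" "\<And>s. 0 \<le> F s" and \<rho>: "0 < \<rho>"
  defines "A \<equiv> measure lborel ({0..1} \<inter> {s. F s < \<rho>})"
  shows "0 < A" "A \<le> 1"
    "ennreal ((1 / A) ^ e) \<le> ennreal (2 ^ e) + ennreal (2 ^ Suc e / \<rho> ^ k) * (\<integral>\<^sup>+s\<in>{0<..1}. ennreal (F s ^ k / s ^ Suc e) \<partial>lborel)"
proof -
  define U where "U = {0..1} \<inter> {s. F s < \<rho>}"
  have op: "open {s. F s < \<rho>}" using F(1) by (intro open_Collect_less) (auto intro: continuous_on_const)
  have Um: "U \<in> sets lborel" unfolding U_def using op by auto
  have "emeasure lborel U \<le> emeasure lborel {0..1::real}" unfolding U_def by (intro emeasure_mono) auto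
  then have Ule: "emeasure lborel U \<le> 1" by simp
  then have Ufin: "emeasure lborel U < \<infinity>" by (simp add: order_le_less_trans ennreal_one_less_top)
  have UA: "emeasure lborel U = ennreal A"
    unfolding A_def U_def[symmetric] using Ufin by (intro emeasure_eq_ennreal_measure) auto
  show A1: "A \<le> 1" using Ule unfolding UA by simp
  \<comment> \<open>By continuity \<open>F\<close> stays below \<rho> on an initial interval, which
    makes \<open>A\<close> positive.\<close>
  obtain d where d: "0 < d" "ball 0 d \<subseteq> {s. F s < \<rho>}"
    using openE[OF op, of 0] F(2) \<rho> by auto
  define d' where "d' = min (d / 2) 1"
  have d': "0 < d'" "d' \<le> 1" "d' < d" using d by (auto simp: d'_def)
  have "{0..d'} \<subseteq> U" unfolding U_def using d(2) d' by (auto simp: subset_iff dist_real_def)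
  then have "emeasure lborel {0..d'} \<le> emeasure lborel U" by (intro emeasure_mono Um)
  then show A0: "0 < A" unfolding UA using d' by (simp add: ennreal_le_iff2)
  show "ennreal ((1 / A) ^ e) \<le> ennreal (2 ^ e) + ennreal (2 ^ Suc e / \<rho> ^ k) * (\<integral>\<^sup>+s\<in>{0<..1}. ennreal (F s ^ k / s ^ Suc e) \<partial>lborel)"
  proof (cases "1 \<le> 2 * A")
    case True
    then have "(1 / A) ^ e \<le> 2 ^ e" using A0 by (intro power_mono) (auto simp: field_simps)
    then have "ennreal ((1 / A) ^ e) \<le> ennreal (2 ^ e)" by (rule ennreal_leI)
    also have "\<dots> \<le> ennreal (2 ^ e) + ennreal (2 ^ Suc e / \<rho> ^ k) * (\<integral>\<^sup>+s\<in>{0<..1}. ennreal (F s ^ k / s ^ Suc e) \<partial>lborel)" by simp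
    finally show ?thesis .
  next
    case False
    \<comment> \<open>Here \<open>2 * A < 1\<close>, so \<open>{0<..2 * A}\<close> stays within the
      range of integration.\<close>
    define S where "S = {0<..2 * A} - {s. F s < \<rho>}"
    have Sm: "S \<in> sets lborel" unfolding S_def using op by auto
    have "ennreal (2 * A) = emeasure lborel {0<..2 * A}" using A0 by simp
    also have "\<dots> \<le> emeasure lborel (U \<union> S)"
      using False Um Sm by (intro emeasure_mono) (auto simp: U_def S_def)
    also have "\<dots> \<le> emeasure lborel U + emeasure lborel S" using Um Sm by (rule emeasure_subadditive)
    finally have "ennreal A + ennreal A \<le> ennreal A + emeasure lborel S"
      unfolding UA using A0 by (simp add: ennreal_plus[symmetric] del: ennreal_plus)
    then have SA: "ennreal A \<le> emeasure lborel S" by (simp add: ennreal_add_left_cancel_le)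
    \<comment> \<open>Lower bound of the integrand on \<open>S\<close>, where
      \<open>\<rho> \<le> F s\<close> and \<open>s \<le> 2 * A\<close>. The weight has one power
      more than \<open>e\<close> so that, after multiplication by the length \<open>A\<close>, the
      power \<open>e\<close> of \<open>1 / A\<close> remains.\<close>
    define c where "c = \<rho> ^ k / (2 * A) ^ Suc e"
    have c0: "0 \<le> c" using \<rho> A0 by (simp add: c_def)
    have "ennreal (c * A) \<le> ennreal c * emeasure lborel S"
      using SA c0 A0 by (simp add: ennreal_mult mult_left_mono)
    also have "\<dots> = (\<integral>\<^sup>+s. ennreal c * indicator S s \<partial>lborel)" using Sm by (simp add: nn_integral_cmult_indicator)
    also have "\<dots> \<le> (\<integral>\<^sup>+s\<in>{0<..1}. ennreal (F s ^ k / s ^ Suc e) \<partial>lborel)"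
    proof (rule nn_integral_mono)
      fix s
      show "ennreal c * indicator S s \<le> ennreal (F s ^ k / s ^ Suc e) * indicator {0<..1} s"
      proof (cases "s \<in> S")
        case True
        then have s: "0 < s" "s \<le> 2 * A" "s \<le> 1" "\<rho> \<le> F s" using False by (auto simp: S_def)
        have "c \<le> F s ^ k / s ^ Suc e"
          unfolding c_def using s \<rho> by (intro frac_le power_mono) auto
        then show ?thesis using True s by (simp add: ennreal_leI)
      qed simp
    qed
    finally have K: "ennreal (c * A) \<le> (\<integral>\<^sup>+s\<in>{0<..1}. ennreal (F s ^ k / s ^ Suc e) \<partial>lborel)" .
    have "(1 / A) ^ e = 2 ^ Suc e / \<rho> ^ k * (c * A)"
      using A0 \<rho> by (simp add: c_def power_mult_distrib power_divide field_simps)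
    then have "ennreal ((1 / A) ^ e) = ennreal (2 ^ Suc e / \<rho> ^ k) * ennreal (c * A)"
      using \<rho> c0 A0 by (simp only:) (intro ennreal_mult; simp)
    also have "\<dots> \<le> ennreal (2 ^ Suc e / \<rho> ^ k) * (\<integral>\<^sup>+s\<in>{0<..1}. ennreal (F s ^ k / s ^ Suc e) \<partial>lborel)"
      by (intro mult_left_mono K) simp
    finally show ?thesis by (rule order_trans) simp
  qed
qed

section \<open>Moments of the bridge and the majorant for small times\<close>

context bridge
begin

text \<open>Each coordinate is centred Gaussian with variance \<open>s - s * s\<close>, at most
  \<open>s\<close>, so its moment of order \<open>2 * q\<close> is at most a constant times
  \<open>s ^ q\<close>; \<open>power_sum_le\<close> combines the coordinates.\<close>

lemma bridge_moment:
  "\<exists>C\<ge>0. \<forall>s\<in>{0..1}. (\<integral>\<^sup>+w. ennreal (norm (X s w) ^ (2 * q)) \<partial>\<mu>) \<le> ennreal (C * s ^ q)"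
proof -
  define c where "c = fact (2 * q) / (2 ^ q * fact q :: real)"
  have c: "0 \<le> c" by (simp add: c_def)
  define D where "D = real DIM('a)"
  show ?thesis
  proof (intro exI[of _ "D ^ q * (D * c)"] conjI ballI)
    show "0 \<le> D ^ q * (D * c)" using c by (simp add: D_def)
    fix s :: real assume s: "s \<in> {0..1}"
    have g: "gaussian_variable \<mu> (\<lambda>w. e \<bullet> X s w)" for e by (rule X_inner_gauss[OF s])
    have v: "expectation (\<lambda>w. (e \<bullet> X s w)\<^sup>2) = s - s * s" if "e \<in> Basis" for e
      using X_cov[OF s s, of e e] that by (simp add: power2_eq_square inner_Basis)
    have m: "expectation (\<lambda>w. (e \<bullet> X s w) ^ (2 * q)) \<le> c * s ^ q" if "e \<in> Basis" for e
    proof -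
      have "expectation (\<lambda>w. (e \<bullet> X s w) ^ (2 * q)) = c * (s - s * s) ^ q"
        using gaussian_variable_moment[OF g X_mean[OF s]] v[OF that] by (simp add: c_def)
      also have "\<dots> \<le> c * s ^ q" using s c by (intro mult_left_mono power_mono) (auto simp: mult_left_le)
      finally show ?thesis .
    qed
    have i: "integrable \<mu> (\<lambda>w. (e \<bullet> X s w) ^ (2 * q))" for e by (rule gaussian_variable_integrable[OF g])
    have le: "norm (X s w) ^ (2 * q) \<le> D ^ q * (\<Sum>e\<in>Basis. (e \<bullet> X s w) ^ (2 * q))" for w
    proof -
      have "norm (X s w) ^ (2 * q) = (\<Sum>e\<in>Basis. (e \<bullet> X s w)\<^sup>2) ^ q"
        unfolding power_mult power2_norm_eq_inner euclidean_inner[of "X s w" "X s w"]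
        by (simp add: power2_eq_square inner_commute)
      also have "\<dots> \<le> D ^ q * (\<Sum>e\<in>Basis. ((e \<bullet> X s w)\<^sup>2) ^ q)"
        unfolding D_def by (rule power_sum_le) auto
      finally show ?thesis by (simp only: power_mult)
    qed
    have "(\<integral>\<^sup>+w. ennreal (norm (X s w) ^ (2 * q)) \<partial>\<mu>) \<le> (\<integral>\<^sup>+w. ennreal (D ^ q * (\<Sum>e\<in>Basis. (e \<bullet> X s w) ^ (2 * q))) \<partial>\<mu>)"
      by (intro nn_integral_mono ennreal_leI le)
    also have "\<dots> = ennreal (expectation (\<lambda>w. D ^ q * (\<Sum>e\<in>Basis. (e \<bullet> X s w) ^ (2 * q))))"
      using i by (intro nn_integral_eq_integral) (auto simp: D_def power_mult intro!: AE_I2 mult_nonneg_nonneg sum_nonneg)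
    also have "expectation (\<lambda>w. D ^ q * (\<Sum>e\<in>Basis. (e \<bullet> X s w) ^ (2 * q))) = D ^ q * (\<Sum>e\<in>Basis. expectation (\<lambda>w. (e \<bullet> X s w) ^ (2 * q)))"
      using i by (simp add: Bochner_Integration.integral_sum)
    also have "\<dots> \<le> D ^ q * (\<Sum>e\<in>(Basis::'a set). c * s ^ q)"
      by (intro mult_left_mono sum_mono m) (auto simp: D_def)
    also have "\<dots> = D ^ q * (D * c) * s ^ q" by (simp add: D_def)
    finally show "(\<integral>\<^sup>+w. ennreal (norm (X s w) ^ (2 * q)) \<partial>\<mu>) \<le> ennreal (D ^ q * (D * c) * s ^ q)"
      using ennreal_leI order_trans by blast
  qed
qed

lemma clipped_X_measurable:
  "(\<lambda>p. X (max 0 (min 1 (snd p))) (fst p)) \<in> borel_measurable (\<mu> \<Otimes>\<^sub>M borel)"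
proof -
  have "(\<lambda>p. X (max 0 (min 1 (fst p))) (snd p)) \<in> borel_measurable (borel \<Otimes>\<^sub>M \<mu>)"
    by (rule clipped_process_measurable) (auto intro: X_cont)
  from measurable_compose[OF measurable_Pair[OF measurable_snd measurable_fst] this]
  show ?thesis by simp
qed

text \<open>The integral of \<open>occupation_time_bound\<close> for the norm of the bridge, with
  \<open>k = 2 * Suc e\<close>; time is clipped for joint measurability.\<close>

definition singular_moment :: "nat \<Rightarrow> 'v \<Rightarrow> ennreal" where
  "singular_moment e w = (\<integral>\<^sup>+s\<in>{0<..1}. ennreal (norm (X (max 0 (min 1 s)) w) ^ (2 * Suc e) / s ^ Suc e) \<partial>lborel)"

text \<open>After exchange of the integrals, \<open>bridge_moment\<close> bounds the mean of the
  numerator by \<open>C * s ^ Suc e\<close>; the singular weight cancels, and the constant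
  \<open>C\<close> remains on the unit interval.\<close>

lemma singular_moment:
  shows singular_moment_measurable: "singular_moment e \<in> borel_measurable \<mu>"
    and singular_moment_finite: "(\<integral>\<^sup>+w. singular_moment e w \<partial>\<mu>) < \<infinity>"
proof -
  interpret P: pair_sigma_finite \<mu> "lborel :: real measure" ..
  have [measurable]: "(\<lambda>p. X (max 0 (min 1 (snd p))) (fst p)) \<in> borel_measurable (\<mu> \<Otimes>\<^sub>M lborel)"
    using clipped_X_measurable by (simp cong: measurable_cong_sets)
  define h where "h p = ennreal (norm (X (max 0 (min 1 (snd p))) (fst p)) ^ (2 * Suc e) / snd p ^ Suc e) * indicator {0<..1} (snd p)" for p
  have hm[measurable]: "h \<in> borel_measurable (\<mu> \<Otimes>\<^sub>M lborel)"
    unfolding h_def[abs_def] by measurable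
  have e: "singular_moment e w = (\<integral>\<^sup>+s. h (w, s) \<partial>lborel)" for w
    by (simp add: singular_moment_def h_def)
  show "singular_moment e \<in> borel_measurable \<mu>"
    unfolding e[abs_def] by (rule lborel.borel_measurable_nn_integral_fst[OF hm])
  obtain C where C: "0 \<le> C" "\<And>s. s \<in> {0..1} \<Longrightarrow> (\<integral>\<^sup>+w. ennreal (norm (X s w) ^ (2 * Suc e)) \<partial>\<mu>) \<le> ennreal (C * s ^ Suc e)"
    using bridge_moment[of "Suc e"] by blast
  have "(\<integral>\<^sup>+w. singular_moment e w \<partial>\<mu>) = (\<integral>\<^sup>+s. (\<integral>\<^sup>+w. h (w, s) \<partial>\<mu>) \<partial>lborel)"
    unfolding e using P.Fubini[of h] hm P.nn_integral_snd[of h] lborel.nn_integral_fst[OF hm] by simp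
  also have "\<dots> \<le> (\<integral>\<^sup>+s. ennreal C * indicator {0..1::real} s \<partial>lborel)"
  proof (rule nn_integral_mono)
    fix s :: real
    show "(\<integral>\<^sup>+w. h (w, s) \<partial>\<mu>) \<le> ennreal C * indicator {0..1} s"
    proof (cases "s \<in> {0<..1}")
      case True
      then have s: "0 < s" "s \<in> {0..1}" and mx: "max 0 (min 1 s) = s" by auto
      have "(\<integral>\<^sup>+w. h (w, s) \<partial>\<mu>) = (\<integral>\<^sup>+w. ennreal (1 / s ^ Suc e) * ennreal (norm (X s w) ^ (2 * Suc e)) \<partial>\<mu>)"
        unfolding h_def using True s by (intro nn_integral_cong) (simp add: mx ennreal_mult[symmetric])
      also have "\<dots> = ennreal (1 / s ^ Suc e) * (\<integral>\<^sup>+w. ennreal (norm (X s w) ^ (2 * Suc e)) \<partial>\<mu>)"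
        using s by (intro nn_integral_cmult) simp
      also have "\<dots> \<le> ennreal (1 / s ^ Suc e) * ennreal (C * s ^ Suc e)" by (intro mult_left_mono C s) simp
      also have "\<dots> = ennreal C" using s C by (simp add: ennreal_mult[symmetric])
      finally show ?thesis using s by simp
    next
      case False
      then show ?thesis by (simp add: h_def)
    qed
  qed
  also have "\<dots> < \<infinity>" by (simp add: nn_integral_cmult_indicator ennreal_mult_less_top)
  finally show "(\<integral>\<^sup>+w. singular_moment e w \<partial>\<mu>) < \<infinity>" .
qed

text \<open>Inside the interval the variance \<open>s - s * s\<close> is positive, which rules out
  an almost surely constant coordinate; a coordinate with a density avoids 0 almost surely.\<close>

lemma X_nonzero_AE:
  assumes s: "s \<in> {0<..<1}"
  shows "AE w in \<mu>. X s w \<noteq> 0"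
proof -
  have s': "s \<in> {0..1}" using s by auto
  obtain e :: 'a where e: "e \<in> Basis" using nonempty_Basis by blast
  let ?Y = "\<lambda>w. e \<bullet> X s w"
  have v: "expectation (\<lambda>w. (?Y w)\<^sup>2) = s - s * s"
    using X_cov[OF s' s', of e e] e by (simp add: power2_eq_square inner_Basis)
  have "s * s < s * 1" using s by (intro mult_strict_left_mono) auto
  then have v0: "expectation (\<lambda>w. (?Y w)\<^sup>2) \<noteq> 0" unfolding v by linarith
  have G: "gaussian_variable \<mu> ?Y" by (rule X_inner_gauss[OF s'])
  have Ym: "?Y \<in> borel_measurable \<mu>" using G by (rule gaussian_variable_measurable)
  from G obtain m where m: "(AE w in \<mu>. ?Y w = m) \<or> (\<exists>\<sigma>>0. distributed \<mu> lborel ?Y (\<lambda>u. ennreal (normal_density m \<sigma> u)))"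
    by (auto simp: gaussian_variable_def)
  have "AE w in \<mu>. ?Y w \<noteq> 0"
  proof (cases "AE w in \<mu>. ?Y w = m")
    case True
    have "expectation ?Y = expectation (\<lambda>_. m)" using True Ym by (intro integral_cong_AE) auto
    then have m0: "m = 0" using X_mean[OF s'] by (simp add: prob_space)
    have "expectation (\<lambda>w. (?Y w)\<^sup>2) = expectation (\<lambda>_. 0)" using True Ym m0 by (intro integral_cong_AE) auto
    then show ?thesis using v0 by simp
  next
    case False
    then obtain \<sigma> where D: "distributed \<mu> lborel ?Y (\<lambda>u. ennreal (normal_density m \<sigma> u))" using m by blast
    have "AE u in lborel. u \<noteq> (0::real)" by (rule AE_lborel_singleton)
    then have "AE u in density lborel (\<lambda>u. ennreal (normal_density m \<sigma> u)). u \<noteq> 0"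
      by (subst AE_density) auto
    then have "AE u in distr \<mu> lborel ?Y. u \<noteq> 0" unfolding distributed_distr_eq_density[OF D] .
    then show ?thesis using Ym by (subst (asm) AE_distr_iff) auto
  qed
  then show ?thesis by eventually_elim auto
qed

text \<open>\<open>T\<close> times this quantity is the variance of the integral along a path that
  returns to \<open>x\<close> at time \<open>T\<close>.\<close>

definition occupation :: "real \<Rightarrow> real \<Rightarrow> 'a \<Rightarrow> 'v \<Rightarrow> real" where
  "occupation \<gamma> T x w = (\<integral>s\<in>{0..1}. norm (x + sqrt T *\<^sub>R X s w) powr (2 * \<gamma>) \<partial>lborel)"

lemma norm_powr_continuous: "0 < \<gamma> \<Longrightarrow> continuous_on UNIV (\<lambda>z::'a. norm (x + z) powr \<gamma>)"
  by (intro continuous_on_powr' continuous_intros) auto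

lemma occupation_integrand_continuous:
  assumes "0 < \<gamma>" "w \<in> space \<mu>"
  shows "continuous_on {0..1} (\<lambda>s. norm (x + sqrt T *\<^sub>R X s w) powr (2 * \<gamma>))"
  by (rule continuous_on_compose2[OF norm_powr_continuous[of "2 * \<gamma>" x]])
     (use assms in \<open>auto intro!: continuous_intros X_cont\<close>)

lemma occupation_measurable:
  assumes "0 < \<gamma>"
  shows "occupation \<gamma> T x \<in> borel_measurable \<mu>"
proof -
  have nm: "(\<lambda>z::'a. norm (x + sqrt T *\<^sub>R z) powr (2 * \<gamma>)) \<in> borel_measurable borel" by measurable
  have cm: "(\<lambda>p. X (max 0 (min 1 (snd p))) (fst p)) \<in> borel_measurable (\<mu> \<Otimes>\<^sub>M lborel)"
    using clipped_X_measurable by (simp cong: measurable_cong_sets)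
  have [measurable]: "(\<lambda>p. norm (x + sqrt T *\<^sub>R X (max 0 (min 1 (snd p))) (fst p)) powr (2 * \<gamma>)) \<in> borel_measurable (\<mu> \<Otimes>\<^sub>M lborel)"
    by (rule measurable_compose[OF cm nm])
  have eq: "occupation \<gamma> T x = (\<lambda>w. \<integral>s. indicator {0..1} s *\<^sub>R norm (x + sqrt T *\<^sub>R X (max 0 (min 1 s)) w) powr (2 * \<gamma>) \<partial>lborel)"
    unfolding occupation_def[abs_def] set_lebesgue_integral_def
    by (intro ext Bochner_Integration.integral_cong) (auto simp: indicator_def min_def max_def)
  show ?thesis
    unfolding eq by (intro lborel.borel_measurable_lebesgue_integral) (simp add: case_prod_beta')
qed

text \<open>The integrand is continuous and nonnegative, so it suffices that it is nonzero at one
  time: at time 0 if \<open>x\<close> is nonzero, and almost surely at time 1/2 if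
  \<open>x = 0\<close>.\<close>

lemma occupation_pos_AE:
  assumes \<gamma>: "0 < \<gamma>" and T: "0 < T"
  shows "AE w in \<mu>. 0 < occupation \<gamma> T x w"
proof -
  have "AE w in \<mu>. X (1/2) w \<noteq> 0" by (rule X_nonzero_AE) auto
  with AE_space show ?thesis
  proof eventually_elim
    case (elim w)
    have "\<exists>r\<in>{0..1}. x + sqrt T *\<^sub>R X r w \<noteq> 0"
    proof (cases "x = 0")
      case True
      then show ?thesis using elim T by (intro bexI[of _ "1/2"]) auto
    next
      case False
      then show ?thesis using X_zero[OF elim(1)] by (intro bexI[of _ 0]) auto
    qed
    then obtain r where "r \<in> {0..1}" "norm (x + sqrt T *\<^sub>R X r w) powr (2 * \<gamma>) \<noteq> 0" by auto
    then show ?case unfolding occupation_def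
      by (intro set_integral_pos_continuous[OF occupation_integrand_continuous[OF \<gamma> elim(1)]]) auto
  qed
qed

text \<open>While the bridge is within \<open>norm x / 2\<close> of the origin, the path started at
  \<open>x\<close> keeps at least that distance from the origin, for every \<open>T \<le> 1\<close>.
  Hence the bound is uniform in \<open>T\<close>, and the length of such times is controlled by
  \<open>occupation_time_bound\<close>.\<close>

lemma occupation_lower_bound:
  assumes \<gamma>: "0 < \<gamma>" and x: "x \<noteq> 0" and T: "0 < T" "T \<le> 1" and w: "w \<in> space \<mu>"
  shows "ennreal (occupation \<gamma> T x w powr (- real e / 2)) \<le> ennreal (((norm x / 2) powr (2 * \<gamma>)) powr (- real e / 2)) *
    (ennreal (2 ^ e) + ennreal (2 ^ Suc e / (norm x / 2) ^ (2 * Suc e)) * singular_moment e w)"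
proof -
  define \<rho> where "\<rho> = norm x / 2"
  have \<rho>: "0 < \<rho>" using x by (simp add: \<rho>_def)
  define F where "F s = norm (X (max 0 (min 1 s)) w)" for s
  have F: "continuous_on UNIV F"
    unfolding F_def by (intro continuous_on_norm continuous_on_compose2[OF X_cont[OF w]] continuous_intros) auto
  define A where "A = measure lborel ({0..1} \<inter> {s. F s < \<rho>})"
  have F0: "F 0 = 0" using X_zero[OF w] by (simp add: F_def)
  have Fn: "0 \<le> F s" for s by (simp add: F_def)
  note A = occupation_time_bound[OF F F0 Fn \<rho>, folded A_def]
  have op: "open {s. F s < \<rho>}" using F by (intro open_Collect_less) (auto intro: continuous_on_const)
  let ?f = "\<lambda>s. norm (x + sqrt T *\<^sub>R X s w) powr (2 * \<gamma>)"
  have Um: "{0..1} \<inter> {s. F s < \<rho>} \<in> sets lborel" using op by auto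
  have Uf: "emeasure lborel ({0..1} \<inter> {s. F s < \<rho>}) < \<infinity>"
  proof -
    have "emeasure lborel ({0..1} \<inter> {s. F s < \<rho>}) \<le> emeasure lborel {0..1::real}" by (intro emeasure_mono) auto
    also have "\<dots> < \<infinity>" by simp
    finally show ?thesis .
  qed
  have "\<rho> powr (2 * \<gamma>) * A = (\<integral>s. \<rho> powr (2 * \<gamma>) * indicator ({0..1} \<inter> {s. F s < \<rho>}) s \<partial>lborel)"
    unfolding A_def by simp
  also have "\<dots> \<le> (\<integral>s. indicator {0..1} s *\<^sub>R ?f s \<partial>lborel)"
  proof (rule integral_mono)
    show "integrable lborel (\<lambda>s. \<rho> powr (2 * \<gamma>) * indicator ({0..1} \<inter> {s. F s < \<rho>}) s)"
      by (intro integrable_mult_right integrable_real_indicator Um Uf)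
    show "integrable lborel (\<lambda>s. indicator {0..1} s *\<^sub>R ?f s)"
      using borel_integrable_atLeastAtMost'[OF occupation_integrand_continuous[OF \<gamma> w, of x T]] by (simp add: set_integrable_def)
    fix s :: real
    show "\<rho> powr (2 * \<gamma>) * indicator ({0..1} \<inter> {s. F s < \<rho>}) s \<le> indicator {0..1} s *\<^sub>R ?f s"
    proof (cases "s \<in> {0..1} \<inter> {s. F s < \<rho>}")
      case True
      then have "F s = norm (X s w)" by (simp add: F_def)
      then have "norm (X s w) < \<rho>" using True by simp
      then have "sqrt T * norm (X s w) \<le> 1 * \<rho>" using T by (intro mult_mono) auto
      moreover have "norm x - norm (sqrt T *\<^sub>R X s w) \<le> norm (x + sqrt T *\<^sub>R X s w)" by (rule norm_diff_ineq)
      ultimately have "\<rho> \<le> norm (x + sqrt T *\<^sub>R X s w)" using T by (simp add: \<rho>_def)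
      then have "\<rho> powr (2 * \<gamma>) \<le> ?f s" using \<gamma> \<rho> by (intro powr_mono2) auto
      then show ?thesis using True by simp
    next
      case False
      then show ?thesis by (auto simp: indicator_def)
    qed
  qed
  finally have low: "\<rho> powr (2 * \<gamma>) * A \<le> occupation \<gamma> T x w" by (simp add: occupation_def set_lebesgue_integral_def)
  have "occupation \<gamma> T x w powr (- real e / 2) \<le> (\<rho> powr (2 * \<gamma>) * A) powr (- real e / 2)"
    using low A(1) \<rho> by (intro powr_mono2') auto
  also have "\<dots> = (\<rho> powr (2 * \<gamma>)) powr (- real e / 2) * A powr (- real e / 2)" by (rule powr_mult)
  also have "\<dots> \<le> (\<rho> powr (2 * \<gamma>)) powr (- real e / 2) * (1 / A) ^ e"
  proof (rule mult_left_mono)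
    \<comment> \<open>As \<open>A \<le> 1\<close>, doubling the negative exponent only enlarges the
      power, and it becomes an integer.\<close>
    have "A powr (- real e / 2) \<le> A powr (- real e)" using A(1,2) by (intro powr_mono') auto
    also have "\<dots> = (1 / A) ^ e" using A(1) by (simp add: powr_minus powr_realpow power_one_over inverse_eq_divide)
    finally show "A powr (- real e / 2) \<le> (1 / A) ^ e" .
  qed simp
  finally have "ennreal (occupation \<gamma> T x w powr (- real e / 2)) \<le> ennreal ((\<rho> powr (2 * \<gamma>)) powr (- real e / 2) * (1 / A) ^ e)"
    by (rule ennreal_leI)
  also have "\<dots> = ennreal ((\<rho> powr (2 * \<gamma>)) powr (- real e / 2)) * ennreal ((1 / A) ^ e)"
    using A(1) by (intro ennreal_mult) auto
  also have "\<dots> \<le> ennreal ((\<rho> powr (2 * \<gamma>)) powr (- real e / 2)) *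
    (ennreal (2 ^ e) + ennreal (2 ^ Suc e / \<rho> ^ (2 * Suc e)) * singular_moment e w)"
    unfolding singular_moment_def F_def[symmetric] by (intro mult_left_mono A(3)) simp
  finally show ?thesis unfolding \<rho>_def .
qed

lemma occupation_tendsto:
  assumes \<gamma>: "0 < \<gamma>" and T: "\<And>n. 0 < T n" "\<And>n. T n < 1" "T \<longlonglongrightarrow> 0" and w: "w \<in> space \<mu>"
  shows "(\<lambda>n. occupation \<gamma> (T n) x w) \<longlonglongrightarrow> norm x powr (2 * \<gamma>)"
proof -
  have "bounded ((\<lambda>s. X s w) ` {0..1})"
    by (intro compact_imp_bounded compact_continuous_image X_cont w) auto
  then obtain C where C: "\<forall>y\<in>(\<lambda>s. X s w) ` {0..1}. norm y \<le> C" unfolding bounded_iff by blast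
  have le: "norm (x + sqrt (T n) *\<^sub>R X s w) \<le> norm x + C" if "s \<in> {0..1}" for s n
  proof -
    have "norm (x + sqrt (T n) *\<^sub>R X s w) \<le> norm x + sqrt (T n) * norm (X s w)"
      using norm_triangle_ineq[of x "sqrt (T n) *\<^sub>R X s w"] T(1)[of n] by simp
    also have "sqrt (T n) * norm (X s w) \<le> 1 * C"
      using C that T(1)[of n] T(2)[of n] by (intro mult_mono) auto
    finally show ?thesis by simp
  qed
  have "(\<lambda>n. sqrt (T n)) \<longlonglongrightarrow> sqrt 0" by (intro tendsto_intros T(3))
  then have sT: "(\<lambda>n. sqrt (T n)) \<longlonglongrightarrow> 0" by (simp only: real_sqrt_zero)
  have m: "(\<lambda>s. indicator {0..1} s *\<^sub>R norm (x + sqrt (T n) *\<^sub>R X s w) powr (2 * \<gamma>)) \<in> borel_measurable lborel" for n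
    unfolding measurable_lborel2
    by (rule borel_measurable_continuous_on_indicator[OF _ occupation_integrand_continuous[OF \<gamma> w]]) simp
  have "(\<lambda>n. \<integral>s. indicator {0..1} s *\<^sub>R norm (x + sqrt (T n) *\<^sub>R X s w) powr (2 * \<gamma>) \<partial>lborel) \<longlonglongrightarrow> (\<integral>s. indicator {0..1::real} s *\<^sub>R norm x powr (2 * \<gamma>) \<partial>lborel)"
  proof (rule integral_dominated_convergence[where w="\<lambda>s. (norm x + C) powr (2 * \<gamma>) * indicator {0..1} s"])
    show "integrable lborel (\<lambda>s. (norm x + C) powr (2 * \<gamma>) * indicator {0..1::real} s)" by (simp add: emeasure_lborel_Icc_eq)
    have "(\<lambda>n. norm (x + sqrt (T n) *\<^sub>R X s w) powr (2 * \<gamma>)) \<longlonglongrightarrow> norm (x + 0 *\<^sub>R X s w) powr (2 * \<gamma>)" for s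
      using \<gamma> by (intro continuous_on_tendsto_compose[OF norm_powr_continuous] tendsto_intros sT) auto
    then show "AE s in lborel. (\<lambda>n. indicator {0..1} s *\<^sub>R norm (x + sqrt (T n) *\<^sub>R X s w) powr (2 * \<gamma>)) \<longlonglongrightarrow> indicator {0..1} s *\<^sub>R norm x powr (2 * \<gamma>)"
      by (intro AE_I2 tendsto_scaleR tendsto_const) simp
    show "AE s in lborel. norm (indicator {0..1} s *\<^sub>R norm (x + sqrt (T n) *\<^sub>R X s w) powr (2 * \<gamma>)) \<le> (norm x + C) powr (2 * \<gamma>) * indicator {0..1} s" for n
      using le[of _ n] \<gamma> by (intro AE_I2) (auto simp: indicator_def intro!: powr_mono2)
    show "(\<lambda>s. indicator {0..1::real} s *\<^sub>R norm x powr (2 * \<gamma>)) \<in> borel_measurable lborel" by measurable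
  qed (rule m)
  then show ?thesis by (simp add: occupation_def set_lebesgue_integral_def)
qed

text \<open>Dominated convergence along sequences of times below 1, with the majorant of
  \<open>occupation_lower_bound\<close>, which does not depend on the time.\<close>

lemma occupation_expectation_tendsto:
  assumes \<gamma>: "0 < \<gamma>" and x: "x \<noteq> 0"
  shows "((\<lambda>T. \<integral>w. occupation \<gamma> T x w powr (- real e / 2) \<partial>\<mu>) \<longlongrightarrow> (norm x powr (2 * \<gamma>)) powr (- real e / 2)) (at_right 0)"
proof (rule tendsto_at_right_sequentially[where b=1])
  fix S :: "nat \<Rightarrow> real" assume S: "\<And>n. 0 < S n" "\<And>n. S n < 1" "S \<longlonglongrightarrow> 0"
  define a where "a = ((norm x / 2) powr (2 * \<gamma>)) powr (- real e / 2)"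
  define c where "c = 2 ^ Suc e / (norm x / 2) ^ (2 * Suc e)"
  have a: "0 \<le> a" and c: "0 \<le> c" by (auto simp: a_def c_def)
  \<comment> \<open>\<open>enn2real\<close> sends infinity to 0; this concerns only a null set, by
    \<open>singular_moment_finite\<close>.\<close>
  define D where "D w = a * (2 ^ e + c * enn2real (singular_moment e w))" for w
  have fin: "AE w in \<mu>. singular_moment e w \<noteq> \<infinity>"
    using singular_moment_finite[of e] by (intro nn_integral_noteq_infinite singular_moment_measurable) auto
  note singular_moment_measurable[measurable]
  have "integrable \<mu> (\<lambda>w. enn2real (singular_moment e w))"
  proof (rule integrableI_bounded)
    have "(\<integral>\<^sup>+w. ennreal (norm (enn2real (singular_moment e w))) \<partial>\<mu>) \<le> (\<integral>\<^sup>+w. singular_moment e w \<partial>\<mu>)"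
      by (intro nn_integral_mono) (simp add: ennreal_enn2real_if)
    then show "(\<integral>\<^sup>+w. ennreal (norm (enn2real (singular_moment e w))) \<partial>\<mu>) < \<infinity>"
      using singular_moment_finite[of e] by (rule order_le_less_trans)
  qed measurable
  then have Di: "integrable \<mu> D" unfolding D_def[abs_def] by auto
  have "(\<lambda>n. \<integral>w. occupation \<gamma> (S n) x w powr (- real e / 2) \<partial>\<mu>) \<longlonglongrightarrow> (\<integral>w. (norm x powr (2 * \<gamma>)) powr (- real e / 2) \<partial>\<mu>)"
  proof (rule integral_dominated_convergence[OF _ _ Di])
    show "(\<lambda>w. occupation \<gamma> (S n) x w powr (- real e / 2)) \<in> borel_measurable \<mu>" for n
      using occupation_measurable[OF \<gamma>] by measurable
    show "AE w in \<mu>. (\<lambda>n. occupation \<gamma> (S n) x w powr (- real e / 2)) \<longlonglongrightarrow> (norm x powr (2 * \<gamma>)) powr (- real e / 2)"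
      using x by (intro AE_I2 tendsto_powr occupation_tendsto[OF \<gamma> S] tendsto_const) auto
    fix n
    from fin AE_space show "AE w in \<mu>. norm (occupation \<gamma> (S n) x w powr (- real e / 2)) \<le> D w"
    proof eventually_elim
      case (elim w)
      define r where "r = enn2real (singular_moment e w)"
      have r: "0 \<le> r" "singular_moment e w = ennreal r" using elim(1) by (simp_all add: r_def less_top)
      have "ennreal (occupation \<gamma> (S n) x w powr (- real e / 2)) \<le> ennreal a * (ennreal (2 ^ e) + ennreal c * singular_moment e w)"
        unfolding a_def c_def by (rule occupation_lower_bound[OF \<gamma> x S(1) less_imp_le[OF S(2)] elim(2)])
      also have "\<dots> = ennreal (D w)"
        unfolding D_def r_def[symmetric] r(2) using a c r(1)
        by (simp add: ennreal_mult[symmetric] ennreal_plus[symmetric] del: ennreal_plus)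
      finally show ?case
        using a c r(1) by (subst (asm) ennreal_le_iff) (auto simp: D_def r_def[symmetric])
    qed
  qed simp
  then show "(\<lambda>n. \<integral>w. occupation \<gamma> (S n) x w powr (- real e / 2) \<partial>\<mu>) \<longlonglongrightarrow> (norm x powr (2 * \<gamma>)) powr (- real e / 2)"
    by (simp add: prob_space)
qed simp

text \<open>For \<open>x = 0\<close> the integrand is homogeneous of degree
  \<open>2 * \<gamma>\<close> in the bridge, so the dependence on \<open>T\<close> separates
  exactly; this makes the claim at the origin an identity instead of a limit.\<close>

lemma occupation_origin:
  assumes T: "0 < T"
  shows "occupation \<gamma> T 0 w = T powr \<gamma> * (\<integral>s\<in>{0..1}. norm (X s w) powr (2 * \<gamma>) \<partial>lborel)"
proof -
  have "norm (0 + sqrt T *\<^sub>R X s w) powr (2 * \<gamma>) = T powr \<gamma> * norm (X s w) powr (2 * \<gamma>)" for s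
    using T by (simp add: powr_mult powr_powr powr_half_sqrt[symmetric])
  then show ?thesis by (simp add: occupation_def)
qed

end

lemma gauss_kernel_zero_powr:
  assumes "0 \<le> v"
  shows "gauss_kernel v (0::'a::euclidean_space) = 1 / sqrt (2 * pi) ^ DIM('a) * v powr (- real DIM('a) / 2)"
proof (cases "v = 0")
  \<comment> \<open>By convention both sides are 0 here: division by \<open>sqrt 0\<close> to the
    positive power \<open>DIM('a)\<close> gives 0, and so does any power
    \<open>0 powr a\<close>.\<close>
  case True
  then show ?thesis by (simp add: gauss_kernel_def)
next
  case False
  with assms have v: "0 < v" by simp
  have "v powr (- real DIM('a) / 2) = 1 / (v powr (1/2)) ^ DIM('a)"
    using v by (simp add: powr_power powr_minus inverse_eq_divide)
  then show ?thesis using v by (simp add: gauss_kernel_def real_sqrt_mult power_mult_distrib powr_half_sqrt)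
qed

section \<open>The formula for the diagonal in terms of the bridge\<close>

context grushin
begin

text \<open>\<open>density_diagonal\<close> for \<open>g z = norm (x + z) powr \<gamma>\<close>.
  With normal vector 0 the path is the bridge scaled by \<open>sqrt T\<close>, so the variance is
  \<open>T\<close> times \<open>br.occupation\<close>, and the powers of \<open>T\<close> from the
  two Gaussian kernels combine.\<close>

lemma grushin_density_diagonal:
  assumes \<gamma>: "0 < \<gamma>" and T: "0 < T"
    and ito: "is_ito_integral M filt b' (\<lambda>s \<omega>. norm (x + b s \<omega>) powr \<gamma>) T J"
    and q: "continuous_on UNIV q"
    and law: "\<And>f::'a \<times> 'b \<Rightarrow> real. continuous_on UNIV f \<Longrightarrow> bounded (range f) \<Longrightarrow>
      has_bochner_integral lborel (\<lambda>w. f w * q w) (\<integral>\<omega>. f (x + b T \<omega>, y + J \<omega>) \<partial>M)"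
  shows "integrable \<mu> (\<lambda>w. br.occupation \<gamma> T x w powr (- real DIM('b) / 2))"
    and "q (x, y) = 1 / sqrt (2 * pi) ^ (DIM('a) + DIM('b)) * T powr (- real (DIM('a) + DIM('b)) / 2)
      * (\<integral>w. br.occupation \<gamma> T x w powr (- real DIM('b) / 2) \<partial>\<mu>)"
proof -
  let ?g = "\<lambda>z::'a. norm (x + z) powr \<gamma>"
  let ?e = "real DIM('b)"
  have g: "continuous_on UNIV ?g" by (rule br.norm_powr_continuous[OF \<gamma>])
  have sq: "(a powr \<gamma>)\<^sup>2 = a powr (2 * \<gamma>)" for a :: real
    by (simp add: power2_eq_square powr_add[symmetric])
  have V: "variance_of ?g T (0, w) = T * br.occupation \<gamma> T x w" for w
    unfolding variance_of_def br.occupation_def br.path_def by (simp add: sq)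
  have V0: "0 \<le> br.occupation \<gamma> T x w" for w
    unfolding br.occupation_def set_lebesgue_integral_def by (intro integral_nonneg_AE AE_I2) auto
  have pos: "AE w in \<mu>. 0 < variance_of ?g T (0, w)"
    using br.occupation_pos_AE[OF \<gamma> T, of x] by eventually_elim (use T in \<open>simp add: V\<close>)
  have k: "gauss_kernel (variance_of ?g T (0, w)) (0::'b)
    = (1 / sqrt (2 * pi) ^ DIM('b) * T powr (- ?e / 2)) * br.occupation \<gamma> T x w powr (- ?e / 2)" for w
    unfolding V using T V0[of w] by (subst gauss_kernel_zero_powr) (auto simp: powr_mult)
  have nz: "1 / sqrt (2 * pi) ^ DIM('b) * T powr (- ?e / 2) \<noteq> 0" using T by simp
  have gn: "0 \<le> ?g z" for z by simp
  note d = density_diagonal[OF T g gn ito q law pos, unfolded k]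
  show "integrable \<mu> (\<lambda>w. br.occupation \<gamma> T x w powr (- ?e / 2))"
    using d(1) unfolding integrable_mult_left_iff using nz by blast
  have ga: "gauss_kernel T (0::'a) = 1 / sqrt (2 * pi) ^ DIM('a) * T powr (- real DIM('a) / 2)"
    using T by (intro gauss_kernel_zero_powr) simp
  have tp: "T powr (- real (DIM('a) + DIM('b)) / 2) = T powr (- real DIM('a) / 2) * T powr (- ?e / 2)"
    unfolding powr_add[symmetric] by (simp add: add_divide_distrib diff_divide_distrib)
  show "q (x, y) = 1 / sqrt (2 * pi) ^ (DIM('a) + DIM('b)) * T powr (- real (DIM('a) + DIM('b)) / 2)
      * (\<integral>w. br.occupation \<gamma> T x w powr (- ?e / 2) \<partial>\<mu>)"
    using d(2) unfolding integral_mult_right_zero ga tp power_add by (simp add: mult_ac)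
qed

end

theorem theorem3p2:
  fixes \<gamma> :: real
    and M :: "'w measure"
    and b :: "real \<Rightarrow> 'w \<Rightarrow> real^'d"
    and b' :: "real \<Rightarrow> 'w \<Rightarrow> real^'e"
    and Z :: "(real^'d) \<times> (real^'e) \<Rightarrow> real \<Rightarrow> 'w \<Rightarrow> (real^'d) \<times> (real^'e)"
    and p :: "real \<Rightarrow> ((real^'d) \<times> (real^'e)) \<times> ((real^'d) \<times> (real^'e)) \<Rightarrow> real"
    and \<mu> :: "(real \<Rightarrow> real^'d) measure"
    and y :: "real^'e"
  assumes "\<gamma> > 0"
    and "brownian_motion M b" and "brownian_motion M b'" and "indep_processes M b b'"
    and "\<And>z. grushin_diffusion \<gamma> M b b' z (Z z)"
    and "\<And>T. T > 0 \<Longrightarrow> is_transition_density M Z T (p T)"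
    and "pinned_wiener_measure \<mu>"
  shows "(\<forall>x. x \<noteq> 0 \<longrightarrow>
            ((\<lambda>T. sqrt T ^ (CARD('d) + CARD('e)) * p T ((x, y), (x, y)))
               \<longlongrightarrow> 1 / (sqrt (2 * pi) ^ (CARD('d) + CARD('e)) * norm x powr (\<gamma> * real CARD('e))))
              (at_right 0))
       \<and> integrable \<mu> (\<lambda>w. (\<integral>t\<in>{0..1}. norm (w t) powr (2 * \<gamma>) \<partial>lborel) powr (- real CARD('e) / 2))
       \<and> (\<forall>T\<in>{0<..1}.
            sqrt T powr (real CARD('d) + (1 + \<gamma>) * real CARD('e)) * p T ((0, y), (0, y))
              = 1 / sqrt (2 * pi) ^ (CARD('d) + CARD('e)) *
                (\<integral>w. (\<integral>t\<in>{0..1}. norm (w t) powr (2 * \<gamma>) \<partial>lborel) powr (- real CARD('e) / 2) \<partial>\<mu>))"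
proof -
  note \<gamma> = assms(1)
  have br: "brownian_bridge \<mu> (\<lambda>t w. w t)" using assms(7) by (simp add: pinned_wiener_measure_def)
  interpret M: prob_space M using assms(2) by (rule brownian_motionD)
  interpret mu: prob_space \<mu> using br by (simp add: brownian_bridge_def)
  interpret grushin M b b' \<mu> "\<lambda>t w. w t"
    using assms(2-4) br by unfold_locales auto
  let ?d = "CARD('d)" and ?e = "CARD('e)"
  let ?W = "\<lambda>w :: real \<Rightarrow> real^'d. \<integral>t\<in>{0..1}. norm (w t) powr (2 * \<gamma>) \<partial>lborel"
  let ?E = "\<lambda>T x. \<integral>w. br.occupation \<gamma> T x w powr (- real ?e / 2) \<partial>\<mu>"
  \<comment> \<open>Valid for every \<open>x\<close>, zero or not; the two claims differ only in how
    the expectation depends on \<open>T\<close>.\<close>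
  have main: "integrable \<mu> (\<lambda>w. br.occupation \<gamma> T x w powr (- real ?e / 2)) \<and>
    p T ((x, y), (x, y)) = 1 / sqrt (2 * pi) ^ (?d + ?e) * T powr (- real (?d + ?e) / 2) * ?E T x"
    if T: "0 < T" for T x
  proof -
    obtain J where J: "\<And>t. 0 \<le> t \<Longrightarrow> is_ito_integral M filt b' (\<lambda>s \<omega>. norm (x + b s \<omega>) powr \<gamma>) t (J t)"
      "\<And>t \<omega>. 0 \<le> t \<Longrightarrow> \<omega> \<in> space M \<Longrightarrow> Z (x, y) t \<omega> = (x + b t \<omega>, y + J t \<omega>)"
      using assms(5)[of "(x, y)"] unfolding grushin_diffusion_def fst_conv snd_conv by blast
    have td: "is_transition_density M Z T (p T)" by (rule assms(6)[OF T])
    have q: "continuous_on UNIV (\<lambda>w. p T ((x, y), w))"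
    proof (rule continuous_on_compose2[where g = "p T" and f = "\<lambda>w. ((x, y), w)", OF _ _ subset_UNIV])
      show "continuous_on UNIV (p T)" using td unfolding is_transition_density_def by (rule conjunct1)
      show "continuous_on UNIV (\<lambda>w. ((x, y), w))" by (intro continuous_intros)
    qed
    have law: "has_bochner_integral lborel (\<lambda>w. f w * p T ((x, y), w)) (\<integral>\<omega>. f (x + b T \<omega>, y + J T \<omega>) \<partial>M)"
      if "continuous_on UNIV f" "bounded (range f)" for f :: "(real^'d) \<times> (real^'e) \<Rightarrow> real"
    proof -
      have "(\<integral>\<omega>. f (Z (x, y) T \<omega>) \<partial>M) = (\<integral>\<omega>. f (x + b T \<omega>, y + J T \<omega>) \<partial>M)"
        using J(2) T by (intro Bochner_Integration.integral_cong refl) auto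
      moreover have "has_bochner_integral lborel (\<lambda>w. f w * p T ((x, y), w)) (\<integral>\<omega>. f (Z (x, y) T \<omega>) \<partial>M)"
        using td[unfolded is_transition_density_def, THEN conjunct2, rule_format, OF that] .
      ultimately show ?thesis by (simp only:)
    qed
    have Ji: "is_ito_integral M filt b' (\<lambda>s \<omega>. norm (x + b s \<omega>) powr \<gamma>) T (J T)" using J(1) T by simp
    from grushin_density_diagonal[OF \<gamma> T Ji q law] show ?thesis by simp
  qed
  have diag: "((\<lambda>T. sqrt T ^ (?d + ?e) * p T ((x, y), (x, y)))
      \<longlongrightarrow> 1 / (sqrt (2 * pi) ^ (?d + ?e) * norm x powr (\<gamma> * real ?e))) (at_right 0)" if x: "x \<noteq> 0" for x
  proof -
    have "((\<lambda>T. 1 / sqrt (2 * pi) ^ (?d + ?e) * ?E T x)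
       \<longlongrightarrow> 1 / sqrt (2 * pi) ^ (?d + ?e) * (norm x powr (2 * \<gamma>)) powr (- real ?e / 2)) (at_right 0)"
      by (intro tendsto_mult tendsto_const br.occupation_expectation_tendsto[OF \<gamma> x])
    moreover have "(norm x powr (2 * \<gamma>)) powr (- real ?e / 2) = 1 / norm x powr (\<gamma> * real ?e)"
      by (simp add: powr_powr powr_minus inverse_eq_divide)
    moreover have "eventually (\<lambda>T. 1 / sqrt (2 * pi) ^ (?d + ?e) * ?E T x = sqrt T ^ (?d + ?e) * p T ((x, y), (x, y))) (at_right 0)"
      using eventually_at_right_less
    proof eventually_elim
      case (elim T)
      have "sqrt T ^ (?d + ?e) * T powr (- real (?d + ?e) / 2) = 1"
      proof -
        have "sqrt T ^ (?d + ?e) = T powr (real (?d + ?e) / 2)"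
          using elim by (simp add: powr_half_sqrt[symmetric] powr_power)
        moreover have "T powr (r / 2) * T powr (- r / 2) = 1" for r
          using elim by (simp add: powr_minus)
        ultimately show ?thesis by (simp only:)
      qed
      then show ?case using main[OF elim, of x] by (simp add: mult_ac)
    qed
    ultimately show ?thesis by (simp only: mult_1 times_divide_times_eq filterlim_cong[OF refl refl, symmetric])
  qed
  have o: "br.occupation \<gamma> T 0 w powr (- real ?e / 2) = T powr (- \<gamma> * real ?e / 2) * ?W w powr (- real ?e / 2)" if "0 < T" for T w
    unfolding br.occupation_origin[OF that] by (simp add: powr_mult powr_powr)
  \<comment> \<open>For \<open>T = 1\<close> and \<open>x = 0\<close> the integrand in
    \<open>main\<close> is the loop functional itself.\<close>
  have int: "integrable \<mu> (\<lambda>w. ?W w powr (- real ?e / 2))"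
    using main[of 1 0] o[of 1] by simp
  have origin: "sqrt T powr (real ?d + (1 + \<gamma>) * real ?e) * p T ((0, y), (0, y))
     = 1 / sqrt (2 * pi) ^ (?d + ?e) * (\<integral>w. ?W w powr (- real ?e / 2) \<partial>\<mu>)" if "T \<in> {0<..1}" for T
  proof -
    have T: "0 < T" using that by simp
    \<comment> \<open>Exponents of \<open>T\<close>: the prefactor contributes half of
      \<open>?d + (1 + \<gamma>) * ?e\<close>, the kernels take away half of \<open>?d + ?e\<close>,
      and the scaling in \<open>o\<close> takes away half of \<open>\<gamma> * ?e\<close>.\<close>
    have "sqrt T powr (real ?d + (1 + \<gamma>) * real ?e) * (T powr (- real (?d + ?e) / 2) * T powr (- \<gamma> * real ?e / 2)) = 1"
    proof -
      have "sqrt T powr r = T powr (1 / 2 * r)" for r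
        using T by (simp add: powr_half_sqrt[symmetric] powr_powr)
      moreover have "1 / 2 * (real ?d + (1 + \<gamma>) * real ?e) + (- real (?d + ?e) / 2 + - \<gamma> * real ?e / 2) = 0"
        by (simp add: field_simps)
      ultimately show ?thesis using T by (simp only: powr_add[symmetric] powr_zero_eq_one) simp
    qed
    then show ?thesis using main[OF T, of 0] unfolding o[OF T] by (simp add: mult_ac)
  qed
  show ?thesis using diag int origin by blast
qed

end
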